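(* Let $f:\mathbb{R}^d\to\mathbb{R}$ be differentiable and bounded from below, with $\nabla f$ Lipschitz continuous with parameter $\mathsf{L}>0$, and suppose that $f$ satisfies the Łojasiewicz inequality on $\mathrm{crit}(f)$ (see context). Let $\{\boldsymbol{x}^k\}_k$ be generated by the stochastic gradient method with momentum (SGDM, see context) with $\lambda\in[0,1)$, $\nu\ge0$ and step sizes $\alpha_k=\alpha/(k+\beta)^\gamma$, where $\alpha>0$, $\beta\ge0$ and $\gamma\in(\frac23,1]$, and where the stochastic errors satisfy $\mathbb{E}[\boldsymbol{e}^k\mid\mathcal{F}_k]=0$ and $\mathbb{E}[\|\boldsymbol{e}^k\|^2\mid\mathcal{F}_k]\le\sigma^2$ almost surely for all $k$ (for some constant $\sigma\ge0$). Let $\mathcal{X}:=\{\omega\in\Omega:\liminf_{k\to\infty}\|\boldsymbol{x}^k(\omega)\|<\infty\}$. Then, almost surely on $\mathcal{X}$, $\{\boldsymbol{x}^k\}_k$ converges to a $\mathrm{crit}(f)$-valued limit $\boldsymbol{x}^*$. Moreover, there is an event $\mathcal{R}\in\mathcal{F}$ with $\mathbb{P}(\mathcal{R})=\mathbb{P}(\mathcal{X})$ such that for all $\omega\in\mathcal{R}$ the following rates hold (as $k\to\infty$) for the realizations $x^k=\boldsymbol{x}^k(\omega)$ and $x^*=\boldsymbol{x}^*(\omega)=\lim_k x^k\in\mathrm{crit}(f)$: (a) If $\gamma\in(\frac23,1)$, then for any $\varepsilon>0$, $$\|x^k-x^*\|=o(1/k^{\Phi(\gamma,\theta)-\varepsilon}),\quad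 |f(x^k)-f(x^* )|=o(1/k^{\Psi(\gamma,\theta)-\varepsilon}),\quad \|\nabla f(x^k)\|^2=o(1/k^{\Psi(\gamma,\theta)-\varepsilon}),$$ where $\theta\in[\frac12,1)$ is the Łojasiewicz exponent of $f$ at $x^*$, $\Phi(\gamma,\theta):=\min\{\frac32\gamma-1,\frac{(1-\gamma)(1-\theta)}{2\theta-1}\}$ and $\Psi(\gamma,\theta):=\min\{2\gamma-1,\frac{1-\gamma}{2\theta-1}\}$. (b) If $\gamma=1$, $\theta=\frac12$ and $\alpha>200/\mathsf{C}^2$, where $\theta$ is the Łojasiewicz exponent at $x^*$ and $\mathsf{C}=\mathsf{C}(x^* )$ is the Łojasiewicz constant of the merit function $\mathcal{M}$ at $(x^*,x^* )$ (see context), then for all $\varepsilon>0$, $$\|x^k-x^*\|=o\big(\log(k)^{\frac12+\varepsilon}/\sqrt{k}\big),\quad |f(x^k)-f(x^* )|=o\big(\log(k)^{1+\varepsilon}/k\big),\quad\|\nabla f(x^k)\|^2=o\big(\log(k)^{1+\varepsilon}/k\big).$$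
   Context: SGDM: on a probability space $(\Omega,\mathcal{F},\mathbb{P})$, with deterministic initial points $\boldsymbol{x}^1=\boldsymbol{x}^0=x^0\in\mathbb{R}^d$, deterministic step sizes $\alpha_k>0$ and parameters $\lambda\in[0,1)$, $\nu\ge0$, SGDM generates the stochastic process given for $k\ge1$ by $$\tilde{\boldsymbol{x}}^k=\boldsymbol{x}^k+\nu(\boldsymbol{x}^k-\boldsymbol{x}^{k-1}),\quad \boldsymbol{g}^k=\nabla f(\tilde{\boldsymbol{x}}^k)-\boldsymbol{e}^k,\quad \boldsymbol{x}^{k+1}=\boldsymbol{x}^k-\alpha_k\boldsymbol{g}^k+\lambda(\boldsymbol{x}^k-\boldsymbol{x}^{k-1}),$$ where $\boldsymbol{e}^k:\Omega\to\mathbb{R}^d$ are random vectors (stochastic errors). The filtration is $\mathcal{F}_k=\sigma(\boldsymbol{x}^0,\boldsymbol{x}^1,\dots,\boldsymbol{x}^k)$. $\mathrm{crit}(f)=\{x\in\mathbb{R}^d:\nabla f(x)=0\}$. The function $f$ satisfies the Łojasiewicz inequality on $\mathrm{crit}(f)$ if for every $x^*\in\mathrm{crit}(f)$ there are $\eta\in(0,\infty]$, a neighborhood $U(x^* )$ of $x^*$, a constant $\mathsf{C}_f=\mathsf{C}_f(x^* )>0$ and an exponent $\theta=\theta(x^* )\in[\frac12,1)$ (the Łojasiewicz exponent of $f$ at $x^*$) such that $\|\nabla f(x)\|\ge\mathsf{C}_f|f(x)-f(x^* )|^\theta$ for all $x\in U(x^* )$ with $0<|f(x)-f(x^* )|<\eta$.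 Merit function: $\mathcal{M}(x,z)=f(z)+\zeta\|z-x\|^2$ on $\mathbb{R}^d\times\mathbb{R}^d$ with $\zeta=\frac{3\mathsf{L}}{1-\lambda}$. If $f$ has Łojasiewicz exponent $\theta$ at $x^*$, then $\mathcal{M}$ satisfies the Łojasiewicz inequality at $(x^*,x^* )$ with the same exponent: there are $\eta\in(0,\infty]$, a neighborhood $U(x^* )$ of $x^*$ and a constant $\mathsf{C}=\mathsf{C}(x^* )>0$ such that $\|\nabla\mathcal{M}(x,z)\|\ge\mathsf{C}|\mathcal{M}(x,z)-f(x^* )|^\theta$ for all $x,z\in U(x^* )\cap\{y\in\mathbb{R}^d:|f(y)-f(x^* )|<\eta\}$. The constant $\mathsf{C}$ in part (b) is such a constant (with $\theta=\frac12$). Conventions: $\frac{1-\gamma}{2\theta-1}$ and $\frac{(1-\gamma)(1-\theta)}{2\theta-1}$ are read as $+\infty$ when $\theta=\frac12$ and $\gamma<1$. The implied $o$-terms may depend on $\omega$ and $\varepsilon$. *)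

theory Defs
  imports "HOL-Analysis.Analysis" "HOL-Probability.Probability"
begin

text \<open>The space \<open>\<real>\<^sup>d\<close> is an arbitrary type \<open>'a::euclidean_space\<close>.\<close>

definition grad :: "('a::real_inner \<Rightarrow> real) \<Rightarrow> 'a \<Rightarrow> 'a" where
  "grad f x = (THE D. GDERIV f x :> D)"

definition crit :: "('a::real_inner \<Rightarrow> real) \<Rightarrow> 'a set" where
  "crit f = {x. grad f x = 0}"


subsection \<open>The Lojasiewicz inequality\<close>

text \<open>\<open>\<theta>\<close> is a Lojasiewicz exponent of \<open>f\<close> at \<open>xs\<close>. Such an exponent is not unique. The bound
  \<open>\<eta>\<close> ranges over \<open>(0, \<infinity>]\<close>, hence the extended reals.\<close>

definition lojasiewicz_exponent :: "('a::real_inner \<Rightarrow> real) \<Rightarrow> 'a \<Rightarrow> real \<Rightarrow> bool" where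
  "lojasiewicz_exponent f xs \<theta> \<longleftrightarrow> 1 / 2 \<le> \<theta> \<and> \<theta> < 1 \<and>
     (\<exists>(\<eta>::ereal) U C. 0 < \<eta> \<and> open U \<and> xs \<in> U \<and> 0 < C \<and>
        (\<forall>x\<in>U. 0 < \<bar>f x - f xs\<bar> \<and> ereal \<bar>f x - f xs\<bar> < \<eta> \<longrightarrow>
           norm (grad f x) \<ge> C * \<bar>f x - f xs\<bar> powr \<theta>))"

definition lojasiewicz_on_crit :: "('a::real_inner \<Rightarrow> real) \<Rightarrow> bool" where
  "lojasiewicz_on_crit f \<longleftrightarrow> (\<forall>xs\<in>crit f. \<exists>\<theta>. lojasiewicz_exponent f xs \<theta>)"

definition merit :: "('a::real_inner \<Rightarrow> real) \<Rightarrow> real \<Rightarrow> real \<Rightarrow> 'a \<times> 'a \<Rightarrow> real" where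
  "merit f L lam = (\<lambda>(x, z). f z + (3 * L / (1 - lam)) * (norm (z - x))\<^sup>2)"

text \<open>\<open>C\<close> is a Lojasiewicz constant, for the exponent \<open>\<theta>\<close>, of the merit function at \<open>(xs, xs)\<close>,
  where the merit function has the value \<open>f xs\<close>.\<close>

definition merit_lojasiewicz_constant ::
  "('a::real_inner \<Rightarrow> real) \<Rightarrow> real \<Rightarrow> real \<Rightarrow> 'a \<Rightarrow> real \<Rightarrow> real \<Rightarrow> bool" where
  "merit_lojasiewicz_constant f L lam xs \<theta> C \<longleftrightarrow> 0 < C \<and>
     (\<exists>(\<eta>::ereal) U. 0 < \<eta> \<and> open U \<and> xs \<in> U \<and>
        (\<forall>x \<in> U \<inter> {y. ereal \<bar>f y - f xs\<bar> < \<eta>}. \<forall>z \<in> U \<inter> {y. ereal \<bar>f y - f xs\<bar> < \<eta>}.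
           norm (grad (merit f L lam) (x, z)) \<ge> C * \<bar>merit f L lam (x, z) - f xs\<bar> powr \<theta>))"


subsection \<open>Stochastic gradient method with momentum\<close>

definition natural_filtration ::
  "'w measure \<Rightarrow> (nat \<Rightarrow> 'w \<Rightarrow> 'a::topological_space) \<Rightarrow> nat \<Rightarrow> 'w measure" where
  "natural_filtration M X k =
     sigma (space M) (\<Union>i\<le>k. {X i -` A \<inter> space M | A. A \<in> sets borel})"

text \<open>The library has conditional expectations of real functions only; for an integrable
  \<open>\<real>\<^sup>d\<close>-valued \<open>X\<close> the conditional expectation is taken coordinatewise.\<close>

definition vec_cond_exp ::
  "'w measure \<Rightarrow> 'w measure \<Rightarrow> ('w \<Rightarrow> 'a::euclidean_space) \<Rightarrow> 'w \<Rightarrow> 'a" where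
  "vec_cond_exp M F X = (\<lambda>\<omega>. \<Sum>b\<in>Basis. real_cond_exp M F (\<lambda>\<omega>'. X \<omega>' \<bullet> b) \<omega> *\<^sub>R b)"

text \<open>The errors \<open>e k\<close> and the steps \<open>a k\<close> are used for \<open>k \<ge> 1\<close> only, so \<open>k - 1\<close> below never truncates.\<close>

definition sgdm ::
  "'w measure \<Rightarrow> ('a::real_inner \<Rightarrow> real) \<Rightarrow> 'a \<Rightarrow> real \<Rightarrow> real \<Rightarrow> (nat \<Rightarrow> real) \<Rightarrow>
   (nat \<Rightarrow> 'w \<Rightarrow> 'a) \<Rightarrow> (nat \<Rightarrow> 'w \<Rightarrow> 'a) \<Rightarrow> bool" where
  "sgdm M f x0 lam \<nu> a e x \<longleftrightarrow>
     (\<forall>\<omega>\<in>space M. x 0 \<omega> = x0 \<and> x 1 \<omega> = x0 \<and>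
        (\<forall>k\<ge>1. let xt = x k \<omega> + \<nu> *\<^sub>R (x k \<omega> - x (k - 1) \<omega>);
                   g = grad f xt - e k \<omega>
               in x (k + 1) \<omega> = x k \<omega> - a k *\<^sub>R g + lam *\<^sub>R (x k \<omega> - x (k - 1) \<omega>)))"

text \<open>The quantity \<open>E[\<parallel>e\<^sup>k\<parallel>\<^sup>2 | F\<^sub>k]\<close> is taken in the extended nonnegative reals, where it exists
  without any integrability assumption; the bound by \<open>\<sigma>\<^sup>2\<close> makes \<open>e k\<close> square integrable, so that
  the conditional mean is meaningful.\<close>

definition sgdm_errors ::
  "'w measure \<Rightarrow> (nat \<Rightarrow> 'w \<Rightarrow> 'a::euclidean_space) \<Rightarrow> (nat \<Rightarrow> 'w \<Rightarrow> 'a) \<Rightarrow> real \<Rightarrow> bool" where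
  "sgdm_errors M x e \<sigma> \<longleftrightarrow>
     (\<forall>k\<ge>1. e k \<in> borel_measurable M \<and>
        (AE \<omega> in M. vec_cond_exp M (natural_filtration M x k) (e k) \<omega> = 0) \<and>
        (AE \<omega> in M. nn_cond_exp M (natural_filtration M x k) (\<lambda>\<omega>'. ennreal ((norm (e k \<omega>'))\<^sup>2)) \<omega>
                      \<le> ennreal (\<sigma>\<^sup>2)))"

definition liminf_bounded_event :: "'w measure \<Rightarrow> (nat \<Rightarrow> 'w \<Rightarrow> 'a::real_normed_vector) \<Rightarrow> 'w set" where
  "liminf_bounded_event M x =
     {\<omega>\<in>space M. liminf (\<lambda>k. ereal (norm (x k \<omega>))) < \<infinity>}"


subsection \<open>Rate exponents\<close>

text \<open>For \<open>\<theta> = 1/2\<close> the fractions with denominator \<open>2 * \<theta> - 1\<close> are read as \<open>\<infinity>\<close> and drop out of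
  the minima. The exponents are used for \<open>\<gamma> < 1\<close> only.\<close>

definition Phi_rate :: "real \<Rightarrow> real \<Rightarrow> real" where
  "Phi_rate \<gamma> \<theta> = (if \<theta> = 1 / 2 then 3 / 2 * \<gamma> - 1
     else min (3 / 2 * \<gamma> - 1) ((1 - \<gamma>) * (1 - \<theta>) / (2 * \<theta> - 1)))"

definition Psi_rate :: "real \<Rightarrow> real \<Rightarrow> real" where
  "Psi_rate \<gamma> \<theta> = (if \<theta> = 1 / 2 then 2 * \<gamma> - 1
     else min (2 * \<gamma> - 1) ((1 - \<gamma>) / (2 * \<theta> - 1)))"

end

theory Submission
  imports Defs "HOL-Real_Asymp.Real_Asymp"
begin

text \<open>With \<open>d\<^sub>k = x\<^sub>k - x\<^sub>k\<^sub>-\<^sub>1\<close> and \<open>\<kappa> = 1 / (1 - lam)\<close> the point \<open>x\<^sub>k + lam \<kappa> d\<^sub>k\<close> performs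
  perturbed stochastic gradient steps of size \<open>\<kappa> \<alpha>\<^sub>k\<close>. The errors are absorbed by exponential
  filters \<open>u\<^sub>k\<^sub>+\<^sub>1 = (1 - q\<^sub>k) u\<^sub>k + \<alpha>\<^sub>k e\<^sub>k\<close> with \<open>q\<^sub>k\<close> proportional to \<open>\<alpha>\<^sub>k\<close>: the point
  \<open>z\<^sub>k = x\<^sub>k + lam \<kappa> d\<^sub>k - \<kappa> u\<^sub>k\<close> follows a deterministic gradient recursion whose defects have
  the size of the filtered errors. Splitting \<open>d\<^sub>k\<close> in the same way into a filter of the errors
  and a remainder \<open>h\<^sub>k\<close>, the total size \<open>\<rho>\<^sub>k\<close> of the filters satisfies, almost surely,
  \<open>\<Sum> t\<^sub>k \<alpha>\<^sub>k \<rho>\<^sub>k\<^sup>2 < \<infinity>\<close> and \<open>sup t\<^sub>k \<rho>\<^sub>k\<^sup>2 < \<infinity>\<close> for \<open>t\<^sub>k = k powr (2\<gamma> - 1) / ln k powr (1 + \<epsilon>)\<close>, by a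
  second moment recursion and a maximal inequality.

  The rest is pathwise. The energy \<open>f z\<^sub>k + \<parallel>h\<^sub>k\<parallel>\<^sup>2\<close> plus a multiple of the tail of
  \<open>\<Sum> \<alpha>\<^sub>k \<rho>\<^sub>k\<^sup>2\<close> decreases. Its gap to the limit dominates \<open>\<parallel>\<nabla>f z\<^sub>k\<parallel>\<^sup>2\<close>, \<open>\<parallel>h\<^sub>k\<parallel>\<^sup>2\<close> and
  \<open>\<bar>f z\<^sub>k - f x\<^sup>*\<bar>\<close>, and the Lojasiewicz inequality turns the decrease into finite length and into
  the recursion \<open>D\<^sub>k\<^sub>+\<^sub>1 \<le> D\<^sub>k - c \<alpha>\<^sub>k (D\<^sub>k powr 2\<theta> - K t\<^sub>k powr -2\<theta>)\<close> for the gap. Since an exponent may be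
  enlarged, \<open>\<theta>\<close> is replaced by \<open>max \<theta> (\<gamma> / (4\<gamma> - 2))\<close>; at this critical value the length bounds
  from the gap and from the noise tail balance, which produces the exponent \<open>3\<gamma>/2 - 1\<close>.\<close>

section \<open>Gradients\<close>

text \<open>The raw steps contain noise of size \<open>\<alpha>_k * norm e_k\<close>, and the
  \<open>\<alpha>_k\<close> are not summable, so neither a descent inequality nor a length estimate
  applies to the iterates directly. Filtering trades this noise for the decay term
  \<open>q_k u_k\<close>; with \<open>q_k\<close> proportional to \<open>\<alpha>_k\<close> that
  term has the order of a gradient evaluated at a point displaced by \<open>u_k\<close>. Two demands
  fix the weight \<open>t\<close>: \<open>t_k \<alpha>_k^2\<close> must be summable, which gives the
  power \<open>2\<gamma> - 1\<close> and the logarithm, and \<open>t\<close> may grow at most by the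
  factor \<open>1 + q_k\<close> per step, which for \<open>\<gamma> = 1\<close> makes the
  proportionality constant in \<open>q_k\<close> matter. The condition \<open>\<gamma> > 2/3\<close>
  enters through the length caused by noise: at the critical exponent
  \<open>(2\<gamma> - 1) \<theta> = \<gamma>/2\<close>, so
  \<open>\<alpha>_k t_k powr -\<theta>\<close> has order \<open>k powr -(3\<gamma>/2)\<close> up to
  logarithms, which is summable with tails of order
  \<open>k powr -(3\<gamma>/2 - 1)\<close>.\<close>

lemma GDERIV_unique:
  assumes "GDERIV f x :> D" "GDERIV f x :> D'"
  shows "D = D'"
proof -
  have "(\<lambda>h. h \<bullet> D) = (\<lambda>h. h \<bullet> D')"
    using assms unfolding gderiv_def by (rule has_derivative_unique)
  then have "(D - D') \<bullet> (D - D') = 0"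
    by (metis inner_diff_right right_minus_eq)
  then show ?thesis by simp
qed

lemma grad_eqI: "GDERIV f x :> D \<Longrightarrow> grad f x = D"
  unfolding grad_def by (blast intro: GDERIV_unique the_equality)

lemma GDERIV_grad:
  fixes f :: "'a::euclidean_space \<Rightarrow> real"
  assumes "f differentiable (at x)"
  shows "GDERIV f x :> grad f x"
proof -
  obtain f' where f': "(f has_derivative f') (at x)"
    using assms by (auto simp: differentiable_def)
  \<comment> \<open>Riesz representation in coordinates. \<open>grad\<close> is a definite
    description, so a vector satisfying \<open>GDERIV\<close> has to be exhibited before
    \<open>grad_eqI\<close> applies.\<close>
  have "f' = (\<lambda>h. h \<bullet> (\<Sum>b\<in>Basis. f' b *\<^sub>R b))"
  proof
    fix h
    have "f' h = f' (\<Sum>b\<in>Basis. (h \<bullet> b) *\<^sub>R b)"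
      by (simp add: euclidean_representation)
    also have "\<dots> = (\<Sum>b\<in>Basis. (h \<bullet> b) * f' b)"
      using has_derivative_linear[OF f'] by (simp add: linear_sum linear_cmul)
    finally show "f' h = h \<bullet> (\<Sum>b\<in>Basis. f' b *\<^sub>R b)"
      by (simp add: inner_sum_right mult.commute)
  qed
  then have "GDERIV f x :> (\<Sum>b\<in>Basis. f' b *\<^sub>R b)"
    using f' unfolding gderiv_def by metis
  then show ?thesis using grad_eqI by metis
qed

text \<open>The mean value theorem on the segment yields one intermediate gradient, which the
  Lipschitz condition compares with the one at \<open>x\<close>. Bounding its parameter by 1 gives
  the constant \<open>L\<close> instead of the sharp \<open>L / 2\<close>, without
  integration.\<close>

lemma lipschitz_grad_taylor:
  fixes f :: "'a::euclidean_space \<Rightarrow> real"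
  assumes diff: "\<And>y. f differentiable (at y)" and lip: "L-lipschitz_on UNIV (grad f)"
  shows "\<bar>f y - f x - grad f x \<bullet> (y - x)\<bar> \<le> L * (norm (y - x))\<^sup>2"
proof -
  define p where "p s = f (x + s *\<^sub>R (y - x))" for s
  have der: "(p has_real_derivative (grad f (x + s *\<^sub>R (y - x)) \<bullet> (y - x))) (at s)" for s
  proof -
    have "(f has_derivative (\<lambda>h. h \<bullet> grad f (x + s *\<^sub>R (y - x)))) (at (x + s *\<^sub>R (y - x)))"
      using GDERIV_grad[OF diff] unfolding gderiv_def .
    moreover have "((\<lambda>s. x + s *\<^sub>R (y - x)) has_derivative (\<lambda>h. h *\<^sub>R (y - x))) (at s)"
      by (auto intro!: derivative_eq_intros)
    ultimately have "(p has_derivative (\<lambda>h. (h *\<^sub>R (y - x)) \<bullet> grad f (x + s *\<^sub>R (y - x)))) (at s)"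
      unfolding p_def using has_derivative_compose by blast
    then show ?thesis
      unfolding has_field_derivative_def
      by (rule has_derivative_eq_rhs) (auto simp: inner_commute mult.commute)
  qed
  obtain s where s: "0 < s" "s < 1" "p 1 - p 0 = (1 - 0) * (grad f (x + s *\<^sub>R (y - x)) \<bullet> (y - x))"
    using MVT2[of 0 1 p "\<lambda>s. grad f (x + s *\<^sub>R (y - x)) \<bullet> (y - x)"] der by auto
  have "0 \<le> L" using lip lipschitz_on_nonneg by blast
  have "f y - f x - grad f x \<bullet> (y - x) = (grad f (x + s *\<^sub>R (y - x)) - grad f x) \<bullet> (y - x)"
    using s(3) by (simp add: p_def inner_diff_left)
  also have "\<bar>\<dots>\<bar> \<le> norm (grad f (x + s *\<^sub>R (y - x)) - grad f x) * norm (y - x)"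
    by (rule Cauchy_Schwarz_ineq2)
  also have "\<dots> \<le> (L * norm (s *\<^sub>R (y - x))) * norm (y - x)"
    using lipschitz_onD[OF lip, of "x + s *\<^sub>R (y - x)" x]
    by (intro mult_right_mono) (auto simp: dist_norm)
  also have "\<dots> = s * (L * (norm (y - x))\<^sup>2)"
    using s by (simp add: power2_eq_square)
  also have "\<dots> \<le> 1 * (L * (norm (y - x))\<^sup>2)"
    using s \<open>0 \<le> L\<close> by (intro mult_right_mono) auto
  finally show ?thesis by simp
qed

section \<open>Inexact gradient descent with momentum\<close>

text \<open>A device for comparing two null sequences: if the difference decreases, it is
  nonnegative. Later bounds of the form "quantity at most a multiple of the gap" thus reduce to a
  comparison of one-step changes.\<close>

lemma eventually_decreasing_nonneg:
  fixes s :: "nat \<Rightarrow> real"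
  assumes dec: "\<And>k. N \<le> k \<Longrightarrow> s (Suc k) \<le> s k" and lim: "s \<longlonglongrightarrow> 0" and k: "N \<le> k"
  shows "0 \<le> s k"
proof -
  have "s m \<le> s k" if "k \<le> m" for m
    using that
  proof (induction m rule: dec_induct)
    case (step n)
    then show ?case using dec[of n] k by linarith
  qed simp
  then have "eventually (\<lambda>m. s m \<le> s k) sequentially"
    by (rule eventually_sequentiallyI)
  then show ?thesis using tendsto_upperbound[OF lim] by simp
qed

lemma eventually_decreasing_convergent:
  fixes s :: "nat \<Rightarrow> real"
  assumes dec: "\<And>k. N \<le> k \<Longrightarrow> s (Suc k) \<le> s k" and bound: "\<And>k. m \<le> s k"
  shows "convergent s"
proof -
  have "decseq (\<lambda>k. s (k + N))"
    by (rule decseq_SucI) (simp add: dec)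
  then obtain l where "(\<lambda>k. s (k + N)) \<longlonglongrightarrow> l"
    using decseq_convergent bound by blast
  then have "s \<longlonglongrightarrow> l" by (rule LIMSEQ_offset)
  then show ?thesis unfolding convergent_def by blast
qed

text \<open>The deterministic interface: of the stochastic errors only their filtered size \<rho> is
  visible, through the defects of the two recursions and one summability condition. Everything built
  on this locale holds path by path.\<close>

locale inexact_momentum =
  fixes f :: "'a::euclidean_space \<Rightarrow> real" and g :: "'a \<Rightarrow> 'a"
    and L lam B :: real and z h :: "nat \<Rightarrow> 'a" and a \<rho> :: "nat \<Rightarrow> real"
  assumes L_nonneg: "0 \<le> L"
    and taylor: "\<And>x y. \<bar>f y - f x - g x \<bullet> (y - x)\<bar> \<le> L * (norm (y - x))\<^sup>2"
    and lip: "\<And>x y. norm (g y - g x) \<le> L * norm (y - x)"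
    and bdd: "bdd_below (range f)"
    and lam: "0 \<le> lam" "lam < 1"
    and B_nonneg: "0 \<le> B"
    and a_pos: "\<And>k. 0 < a k"
    and a_lim: "a \<longlonglongrightarrow> 0"
    and a_div: "\<not> summable a"
    and rho_nonneg: "\<And>k. 0 \<le> \<rho> k"
    and noise_summable: "summable (\<lambda>k. a k * (\<rho> k)\<^sup>2)"
    and z_step: "\<And>k. norm (z (Suc k) - z k + a k *\<^sub>R g (z k)) \<le> a k * (B * (\<rho> k + norm (h k)))"
    and h_step: "\<And>k. norm (h (Suc k)) \<le>
      lam * norm (h k) + a k * (norm (g (z k)) + B * (\<rho> k + norm (h k)))"
begin

definition noise_tail :: "nat \<Rightarrow> real" where
  "noise_tail k = (\<Sum>j. a (j + k) * (\<rho> (j + k))\<^sup>2)"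

lemma noise_tail_eq: "noise_tail k = (\<Sum>j. a j * (\<rho> j)\<^sup>2) - (\<Sum>j<k. a j * (\<rho> j)\<^sup>2)"
  unfolding noise_tail_def by (rule suminf_minus_initial_segment[OF noise_summable])

lemma noise_tail_Suc: "noise_tail k = a k * (\<rho> k)\<^sup>2 + noise_tail (Suc k)"
  by (simp add: noise_tail_eq)

lemma noise_tail_nonneg: "0 \<le> noise_tail k"
  unfolding noise_tail_def
  by (intro suminf_nonneg summable_ignore_initial_segment[OF noise_summable])
     (simp add: a_pos less_imp_le)

lemma noise_tail_lim: "noise_tail \<longlonglongrightarrow> 0"
proof -
  have "(\<lambda>k. (\<Sum>j. a j * (\<rho> j)\<^sup>2) - (\<Sum>j<k. a j * (\<rho> j)\<^sup>2)) \<longlonglongrightarrow> 0"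
    using tendsto_diff[OF tendsto_const[of "\<Sum>j. a j * (\<rho> j)\<^sup>2"] summable_LIMSEQ[OF noise_summable]]
    by simp
  then show ?thesis by (simp add: noise_tail_eq[abs_def])
qed

text \<open>The factor of the tail has two parts: \<open>2 * B\<^sup>2\<close> pays for the noise in
  one descent step, and the additional 1 leaves \<open>a k * (\<rho> k)\<^sup>2\<close> as a genuine
  decrease, so that the noise can be charged to the energy later on.\<close>

definition energy :: "nat \<Rightarrow> real" where
  "energy k = f (z k) + (norm (h k))\<^sup>2 + (2 * B\<^sup>2 + 1) * noise_tail k"

lemma z_step_norm: "norm (z (Suc k) - z k) \<le> a k * (norm (g (z k)) + B * (\<rho> k + norm (h k)))"
proof -
  have "norm (z (Suc k) - z k)
      \<le> norm (z (Suc k) - z k + a k *\<^sub>R g (z k)) + norm (a k *\<^sub>R g (z k))"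
    using norm_triangle_ineq4[of "z (Suc k) - z k + a k *\<^sub>R g (z k)" "a k *\<^sub>R g (z k)"] by simp
  then show ?thesis
    using z_step[of k] a_pos[of k] by (simp add: algebra_simps)
qed

lemma f_step:
  "f (z (Suc k)) - f (z k) \<le> - a k * (norm (g (z k)))\<^sup>2
     + a k * norm (g (z k)) * (B * (\<rho> k + norm (h k)))
     + L * (a k)\<^sup>2 * (norm (g (z k)) + B * (\<rho> k + norm (h k)))\<^sup>2"
proof -
  let ?G = "norm (g (z k))" and ?Y = "B * (\<rho> k + norm (h k))"
  let ?r = "z (Suc k) - z k + a k *\<^sub>R g (z k)"
  have "g (z k) \<bullet> (z (Suc k) - z k) = g (z k) \<bullet> ?r - a k * ?G\<^sup>2"
    by (simp add: inner_right_distrib power2_norm_eq_inner)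
  moreover have "g (z k) \<bullet> ?r \<le> ?G * (a k * ?Y)"
    using norm_cauchy_schwarz[of "g (z k)" ?r] z_step[of k]
    by (meson mult_left_mono norm_ge_zero order_trans)
  moreover have "L * (norm (z (Suc k) - z k))\<^sup>2 \<le> L * (a k * (?G + ?Y))\<^sup>2"
    using z_step_norm[of k] L_nonneg by (intro mult_left_mono power_mono) auto
  moreover have "f (z (Suc k)) - f (z k) - g (z k) \<bullet> (z (Suc k) - z k) \<le> L * (norm (z (Suc k) - z k))\<^sup>2"
    using taylor[where x = "z k" and y = "z (Suc k)"] by linarith
  moreover have "L * (a k * (?G + ?Y))\<^sup>2 = L * (a k)\<^sup>2 * (?G + ?Y)\<^sup>2"
    by (simp add: power_mult_distrib)
  moreover have "?G * (a k * ?Y) = a k * ?G * ?Y" by simp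
  ultimately show ?thesis by linarith
qed

text \<open>Convexity of the square: the bound in \<open>h_step\<close> is a convex combination of
  \<open>norm (h k)\<close> and \<open>W\<close> with weights \<open>lam\<close> and
  \<open>1 - lam\<close>, so the contraction factor \<open>lam\<close> survives squaring without a
  Young parameter.\<close>

lemma h_step_square:
  "(norm (h (Suc k)))\<^sup>2 \<le> lam * (norm (h k))\<^sup>2
     + (a k)\<^sup>2 / (1 - lam) * (norm (g (z k)) + B * (\<rho> k + norm (h k)))\<^sup>2"
proof -
  define W where "W = a k * (norm (g (z k)) + B * (\<rho> k + norm (h k))) / (1 - lam)"
  have "norm (h (Suc k)) \<le> lam * norm (h k) + (1 - lam) * W"
    using h_step[of k] lam by (simp add: W_def)
  then have "(norm (h (Suc k)))\<^sup>2 \<le> (lam * norm (h k) + (1 - lam) * W)\<^sup>2"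
    by (intro power_mono) auto
  also have "\<dots> = lam * (norm (h k))\<^sup>2 + (1 - lam) * W\<^sup>2 - lam * (1 - lam) * (norm (h k) - W)\<^sup>2"
    by (simp add: power2_eq_square algebra_simps)
  also have "\<dots> \<le> lam * (norm (h k))\<^sup>2 + (1 - lam) * W\<^sup>2"
    using lam by simp
  also have "(1 - lam) * W\<^sup>2 = (a k)\<^sup>2 / (1 - lam) * (norm (g (z k)) + B * (\<rho> k + norm (h k)))\<^sup>2"
    using lam by (simp add: W_def power2_eq_square)
  finally show ?thesis .
qed

text \<open>Of the full descent \<open>a k * G\<^sup>2\<close> the cross term takes one half and the
  second-order terms, by the first smallness condition, one quarter. The defect \<open>Y\<close>
  costs at most \<open>a k * Y\<^sup>2\<close>, hence at most \<open>2 * B\<^sup>2 * a k\<close>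
  times the squares of \<rho> and \<open>h\<close>: the part with \<rho> is paid by the noise tail,
  the part with \<open>h\<close> by half of the contraction margin \<open>1 - lam\<close>, which is
  the second smallness condition.\<close>

lemma energy_step:
  assumes small: "a k * (2 * L + 2 / (1 - lam)) \<le> 1 / 4" "a k * (2 * B\<^sup>2) \<le> (1 - lam) / 2"
  shows "energy (Suc k) + a k / 4 * (norm (g (z k)))\<^sup>2 + (1 - lam) / 2 * (norm (h k))\<^sup>2
           + a k * (\<rho> k)\<^sup>2 \<le> energy k"
proof -
  define G H r Y where "G = norm (g (z k))" and "H = norm (h k)" and "r = \<rho> k" and "Y = B * (r + H)"
  have f: "f (z (Suc k)) - f (z k) \<le> - a k * G\<^sup>2 + a k * G * Y + L * (a k)\<^sup>2 * (G + Y)\<^sup>2"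
    using f_step[of k] by (simp add: G_def H_def r_def Y_def)
  have hh: "(norm (h (Suc k)))\<^sup>2 \<le> lam * H\<^sup>2 + (a k)\<^sup>2 / (1 - lam) * (G + Y)\<^sup>2"
    using h_step_square[of k] by (simp add: G_def H_def r_def Y_def)
  have GY: "(G + Y)\<^sup>2 \<le> 2 * (G\<^sup>2 + Y\<^sup>2)" "G * Y \<le> (G\<^sup>2 + Y\<^sup>2) / 2"
    using sum_squares_bound[of G Y] by (simp_all add: power2_sum algebra_simps)
  have "(r + H)\<^sup>2 \<le> 2 * (r\<^sup>2 + H\<^sup>2)"
    using sum_squares_bound[of r H] by (simp add: power2_sum algebra_simps)
  then have "Y\<^sup>2 \<le> B\<^sup>2 * (2 * (r\<^sup>2 + H\<^sup>2))"
    unfolding Y_def power_mult_distrib by (intro mult_left_mono) auto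
  then have Y: "a k * Y\<^sup>2 \<le> a k * (B\<^sup>2 * (2 * (r\<^sup>2 + H\<^sup>2)))"
    using a_pos[of k] by (intro mult_left_mono) auto
  have "(L + 1 / (1 - lam)) * (a k)\<^sup>2 * (G + Y)\<^sup>2 \<le> (L + 1 / (1 - lam)) * (a k)\<^sup>2 * (2 * (G\<^sup>2 + Y\<^sup>2))"
    using L_nonneg lam GY by (intro mult_left_mono) auto
  also have "\<dots> = a k * (2 * L + 2 / (1 - lam)) * (a k * (G\<^sup>2 + Y\<^sup>2))"
    by (simp add: power2_eq_square algebra_simps)
  also have "\<dots> \<le> 1 / 4 * (a k * (G\<^sup>2 + Y\<^sup>2))"
    using small a_pos[of k] by (intro mult_right_mono) auto
  finally have quad: "L * (a k)\<^sup>2 * (G + Y)\<^sup>2 + (a k)\<^sup>2 / (1 - lam) * (G + Y)\<^sup>2 \<le> a k * G\<^sup>2 / 4 + a k * Y\<^sup>2 / 4"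
    by (simp add: algebra_simps)
  have cross: "a k * G * Y \<le> a k * G\<^sup>2 / 2 + a k * Y\<^sup>2 / 2"
    using mult_left_mono[OF GY(2), of "a k"] a_pos[of k] by (simp add: algebra_simps)
  have "a k * (2 * B\<^sup>2) * H\<^sup>2 \<le> (1 - lam) / 2 * H\<^sup>2"
    using small by (intro mult_right_mono) auto
  moreover have "0 \<le> a k * (B\<^sup>2 * (2 * (r\<^sup>2 + H\<^sup>2)))"
    using a_pos[of k] by simp
  moreover have "0 \<le> a k * (B\<^sup>2 * r\<^sup>2)"
    using a_pos[of k] by simp
  moreover have "(1 - lam) / 2 * H\<^sup>2 = H\<^sup>2 / 2 - lam * H\<^sup>2 / 2"
    by (simp add: left_diff_distrib diff_divide_distrib)
  ultimately have "f (z (Suc k)) + (norm (h (Suc k)))\<^sup>2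
      \<le> f (z k) + H\<^sup>2 - a k * G\<^sup>2 / 4 - (H\<^sup>2 / 2 - lam * H\<^sup>2 / 2) + 2 * (a k * (B\<^sup>2 * r\<^sup>2))"
    using f hh quad cross Y
    by (simp only: distrib_left mult.assoc mult.left_commute[of "a k" 2] mult.left_commute[of "B\<^sup>2" 2])
  then show ?thesis
    unfolding energy_def noise_tail_Suc[of k] by (simp add: G_def H_def r_def algebra_simps diff_divide_distrib)
qed

text \<open>A common coefficient for the three squares in \<open>energy_step\<close>: once
  \<open>a k \<le> 1\<close>, the number \<open>c\<^sub>0 * a k\<close> lies below each of
  \<open>a k / 4\<close>, \<open>(1 - lam) / 2\<close> and \<open>a k\<close>.\<close>

definition c\<^sub>0 :: real where "c\<^sub>0 = min (1 / 4) ((1 - lam) / 2)"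

lemma c0: "0 < c\<^sub>0" "c\<^sub>0 \<le> 1 / 4" "c\<^sub>0 \<le> (1 - lam) / 2"
  unfolding c\<^sub>0_def using lam by (simp, simp, intro min.cobounded2)

lemma eventually_a_small:
  assumes "0 \<le> C" "0 < \<epsilon>" shows "eventually (\<lambda>k. a k * C \<le> \<epsilon>) sequentially"
proof -
  have "(\<lambda>k. a k * C) \<longlonglongrightarrow> 0 * C" by (intro tendsto_intros a_lim)
  then have "eventually (\<lambda>k. a k * C < \<epsilon>) sequentially"
    using assms by (intro order_tendstoD) auto
  then show ?thesis by eventually_elim simp
qed

lemma eventually_energy_step:
  "eventually (\<lambda>k. energy (Suc k) + a k / 4 * (norm (g (z k)))\<^sup>2 + (1 - lam) / 2 * (norm (h k))\<^sup>2
           + a k * (\<rho> k)\<^sup>2 \<le> energy k) sequentially"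
proof -
  have "eventually (\<lambda>k. a k * (2 * L + 2 / (1 - lam)) \<le> 1 / 4) sequentially"
    "eventually (\<lambda>k. a k * (2 * B\<^sup>2) \<le> (1 - lam) / 2) sequentially"
    using L_nonneg lam by (intro eventually_a_small; simp)+
  then show ?thesis by eventually_elim (rule energy_step)
qed

lemma energy_bounded_below: "\<exists>m. \<forall>k. m \<le> energy k"
proof -
  obtain m where "\<And>y. m \<le> f y" using bdd by (auto simp: bdd_below_def)
  then have "m \<le> energy k" for k
    unfolding energy_def using noise_tail_nonneg[of k] by (smt (verit) mult_nonneg_nonneg zero_le_power2)
  then show ?thesis by blast
qed

lemma energy_convergent: "convergent energy"
proof -
  obtain m where m: "\<And>k. m \<le> energy k" using energy_bounded_below by blast
  obtain N where N: "\<And>k. k \<ge> N \<Longrightarrow> energy (Suc k) + a k / 4 * (norm (g (z k)))\<^sup>2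
      + (1 - lam) / 2 * (norm (h k))\<^sup>2 + a k * (\<rho> k)\<^sup>2 \<le> energy k"
    using eventually_energy_step unfolding eventually_sequentially by blast
  have dec: "energy (Suc k) \<le> energy k" if "k \<ge> N" for k
  proof -
    have "0 \<le> a k / 4 * (norm (g (z k)))\<^sup>2 + (1 - lam) / 2 * (norm (h k))\<^sup>2 + a k * (\<rho> k)\<^sup>2"
      using a_pos[of k] lam by simp
    then show ?thesis using N[OF that] by linarith
  qed
  show ?thesis by (rule eventually_decreasing_convergent[where N = N and m = m]) (use dec m in auto)
qed

definition flim :: real where "flim = lim energy"

definition gap :: "nat \<Rightarrow> real" where "gap k = energy k - flim"

lemma gap_lim: "gap \<longlonglongrightarrow> 0"
proof -
  have "energy \<longlonglongrightarrow> flim"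
    using energy_convergent unfolding flim_def by (simp add: convergent_LIMSEQ_iff)
  then show ?thesis unfolding gap_def by (simp add: LIM_zero)
qed

text \<open>One fixed threshold in place of \<open>eventually\<close>, because the comparison by
  decreasing differences needs an index from which every single step decreases.\<close>

definition N\<^sub>0 :: nat where
  "N\<^sub>0 = (SOME N. \<forall>k\<ge>N. gap (Suc k) + a k / 4 * (norm (g (z k)))\<^sup>2
     + (1 - lam) / 2 * (norm (h k))\<^sup>2 + a k * (\<rho> k)\<^sup>2 \<le> gap k \<and> a k \<le> 1)"

lemma N0:
  assumes "N\<^sub>0 \<le> k"
  shows gap_step: "gap (Suc k) + a k / 4 * (norm (g (z k)))\<^sup>2
     + (1 - lam) / 2 * (norm (h k))\<^sup>2 + a k * (\<rho> k)\<^sup>2 \<le> gap k"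
    and a_le_one: "a k \<le> 1"
proof -
  have "eventually (\<lambda>k. a k \<le> 1) sequentially"
    using eventually_a_small[of 1 1] by simp
  then have "eventually (\<lambda>k. gap (Suc k) + a k / 4 * (norm (g (z k)))\<^sup>2
      + (1 - lam) / 2 * (norm (h k))\<^sup>2 + a k * (\<rho> k)\<^sup>2 \<le> gap k \<and> a k \<le> 1) sequentially"
    (is "eventually ?P _")
    using eventually_energy_step by eventually_elim (simp add: gap_def)
  then have "\<forall>k\<ge>N\<^sub>0. ?P k"
    unfolding eventually_sequentially N\<^sub>0_def by (rule someI_ex)
  then show "gap (Suc k) + a k / 4 * (norm (g (z k)))\<^sup>2
     + (1 - lam) / 2 * (norm (h k))\<^sup>2 + a k * (\<rho> k)\<^sup>2 \<le> gap k" "a k \<le> 1"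
    using assms by auto
qed

lemma gap_decrease:
  assumes k: "N\<^sub>0 \<le> k"
  shows "c\<^sub>0 * (a k * ((norm (g (z k)))\<^sup>2 + (norm (h k))\<^sup>2 + (\<rho> k)\<^sup>2)) \<le> gap k - gap (Suc k)"
proof -
  have "c\<^sub>0 * (a k * (norm (g (z k)))\<^sup>2) \<le> 1 / 4 * (a k * (norm (g (z k)))\<^sup>2)"
    using c0 a_pos[of k] by (intro mult_right_mono) auto
  moreover have "c\<^sub>0 * (a k * (\<rho> k)\<^sup>2) \<le> 1 * (a k * (\<rho> k)\<^sup>2)"
    using c0 a_pos[of k] by (intro mult_right_mono) auto
  moreover have "c\<^sub>0 * (a k * (norm (h k))\<^sup>2) \<le> (1 - lam) / 2 * (1 * (norm (h k))\<^sup>2)"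
    using c0 a_pos[of k] a_le_one[OF k] lam by (intro mult_mono) auto
  moreover have "c\<^sub>0 * (a k * ((norm (g (z k)))\<^sup>2 + (norm (h k))\<^sup>2 + (\<rho> k)\<^sup>2)) = c\<^sub>0 * (a k * (norm (g (z k)))\<^sup>2)
      + c\<^sub>0 * (a k * (norm (h k))\<^sup>2) + c\<^sub>0 * (a k * (\<rho> k)\<^sup>2)"
    by (simp add: distrib_left)
  ultimately show ?thesis
    using gap_step[OF k] by simp
qed

lemma gap_Suc_le: "N\<^sub>0 \<le> k \<Longrightarrow> gap (Suc k) \<le> gap k"
  using gap_decrease[of k] c0 a_pos[of k]
  by (smt (verit) mult_nonneg_nonneg zero_le_power2)

lemma gap_nonneg: "N\<^sub>0 \<le> k \<Longrightarrow> 0 \<le> gap k"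
  by (rule eventually_decreasing_nonneg[OF gap_Suc_le gap_lim])

text \<open>In \<open>gap_step\<close> the term with \<open>h\<close> carries no factor
  \<open>a k\<close>, so a single step already spends this amount, and the gap remains nonnegative
  afterwards.\<close>

lemma h_bound: "N\<^sub>0 \<le> k \<Longrightarrow> c\<^sub>0 * (norm (h k))\<^sup>2 \<le> gap k"
proof -
  assume k: "N\<^sub>0 \<le> k"
  have "c\<^sub>0 * (norm (h k))\<^sup>2 \<le> (1 - lam) / 2 * (norm (h k))\<^sup>2"
    using c0 by (intro mult_right_mono) auto
  moreover have "0 \<le> a k / 4 * (norm (g (z k)))\<^sup>2" "0 \<le> a k * (\<rho> k)\<^sup>2"
    using a_pos[of k] by simp_all
  ultimately show ?thesis using gap_step[OF k] gap_nonneg[of "Suc k"] k by simp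
qed

text \<open>In each step the gap loses at least \<open>a k * (\<rho> k)\<^sup>2\<close>, which is
  exactly what the tail loses; so the difference decreases to 0.\<close>

lemma noise_tail_le_gap:
  assumes "N\<^sub>0 \<le> k" shows "noise_tail k \<le> gap k"
proof -
  have "0 \<le> gap k - noise_tail k"
  proof (rule eventually_decreasing_nonneg[OF _ _ assms])
    fix k assume k: "N\<^sub>0 \<le> k"
    have "0 \<le> a k / 4 * (norm (g (z k)))\<^sup>2" "0 \<le> (1 - lam) / 2 * (norm (h k))\<^sup>2"
      using a_pos[of k] lam by simp_all
    then show "gap (Suc k) - noise_tail (Suc k) \<le> gap k - noise_tail k"
      using gap_step[OF k] noise_tail_Suc[of k] by linarith
  next
    show "(\<lambda>k. gap k - noise_tail k) \<longlonglongrightarrow> 0"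
      using tendsto_diff[OF gap_lim noise_tail_lim] by simp
  qed
  then show ?thesis by simp
qed

lemma f_eq_gap: "f (z k) - flim = gap k - (norm (h k))\<^sup>2 - (2 * B\<^sup>2 + 1) * noise_tail k"
  by (simp add: gap_def energy_def)

lemma f_bound:
  assumes k: "N\<^sub>0 \<le> k"
  shows "\<bar>f (z k) - flim\<bar> \<le> (2 * B\<^sup>2 + 2 + 1 / c\<^sub>0) * gap k"
proof -
  have "(norm (h k))\<^sup>2 \<le> 1 / c\<^sub>0 * gap k"
    using h_bound[OF k] c0 by (simp add: field_simps)
  moreover have "(2 * B\<^sup>2 + 1) * noise_tail k \<le> (2 * B\<^sup>2 + 1) * gap k"
    using noise_tail_le_gap[OF k] by (intro mult_left_mono) auto
  moreover have "0 \<le> (2 * B\<^sup>2 + 1) * noise_tail k"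
    using noise_tail_nonneg by simp
  moreover have "(2 * B\<^sup>2 + 2 + 1 / c\<^sub>0) * gap k = (2 * B\<^sup>2 + 1) * gap k + gap k + 1 / c\<^sub>0 * gap k"
    by (simp add: distrib_right)
  moreover have "0 \<le> (norm (h k))\<^sup>2" "0 \<le> (2 * B\<^sup>2 + 1) * gap k" "0 \<le> 1 / c\<^sub>0 * gap k"
    using gap_nonneg[OF k] c0 by auto
  ultimately show ?thesis
    using f_eq_gap[of k] gap_nonneg[OF k] unfolding abs_le_iff by linarith
qed

text \<open>The factors come from \<open>grad_square_step\<close>: \<open>L\<close> from the
  difference and \<open>2 + L\<close> from the sum of consecutive gradient norms,
  \<open>3 * (1 + B\<^sup>2)\<close> from squaring a sum of three terms, and
  \<open>1 / c\<^sub>0\<close> from \<open>gap_decrease\<close>.\<close>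

definition c\<^sub>1 :: real where "c\<^sub>1 = 3 * L * (2 + L) * (1 + B\<^sup>2) / c\<^sub>0"

lemma c1_nonneg: "0 \<le> c\<^sub>1"
  using L_nonneg c0 by (simp add: c\<^sub>1_def)

text \<open>Factor the difference of squares: the difference of the norms is of order
  \<open>a k * (G + Y)\<close> and their sum of order \<open>G + Y\<close>. The product is
  \<open>a k\<close> times squares, precisely what \<open>gap_decrease\<close> can pay for.\<close>

lemma grad_square_step:
  assumes k: "N\<^sub>0 \<le> k"
  shows "\<bar>(norm (g (z (Suc k))))\<^sup>2 - (norm (g (z k)))\<^sup>2\<bar> \<le> c\<^sub>1 * (gap k - gap (Suc k))"
proof -
  define G G' H r Y where "G = norm (g (z k))" and "G' = norm (g (z (Suc k)))"
    and "H = norm (h k)" and "r = \<rho> k" and "Y = B * (r + H)"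
  have pos: "0 \<le> G" "0 \<le> G'" "0 \<le> Y"
    using rho_nonneg B_nonneg by (simp_all add: G_def G'_def Y_def H_def r_def)
  have ak: "0 < a k" "a k \<le> 1" using a_pos a_le_one[OF k] by auto
  have dz: "norm (z (Suc k) - z k) \<le> a k * (G + Y)"
    using z_step_norm[of k] by (simp add: G_def H_def r_def Y_def)
  have "\<bar>G' - G\<bar> \<le> L * norm (z (Suc k) - z k)"
    unfolding G_def G'_def using norm_triangle_ineq3 lip by (meson order_trans)
  also have "\<dots> \<le> L * (a k * (G + Y))"
    using dz L_nonneg by (rule mult_left_mono)
  finally have dG: "\<bar>G' - G\<bar> \<le> L * (a k * (G + Y))" .
  have "L * (a k * (G + Y)) \<le> L * (1 * (G + Y))"
    using ak pos L_nonneg by (intro mult_left_mono mult_right_mono) auto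
  then have sG: "G' + G \<le> (2 + L) * (G + Y)"
    using dG pos by (simp add: algebra_simps abs_le_iff)
  have "\<bar>G'\<^sup>2 - G\<^sup>2\<bar> = \<bar>G' - G\<bar> * (G' + G)"
    using pos by (simp add: power2_eq_square abs_mult[symmetric] square_diff_square_factored)
       (simp add: abs_mult)
  also have "\<dots> \<le> (L * (a k * (G + Y))) * ((2 + L) * (G + Y))"
    using dG sG pos L_nonneg ak by (intro mult_mono) auto
  also have "\<dots> = L * (2 + L) * (a k * (G + Y)\<^sup>2)"
    by (simp add: power2_eq_square)
  also have "\<dots> \<le> L * (2 + L) * (a k * (3 * ((1 + B\<^sup>2) * (G\<^sup>2 + H\<^sup>2 + r\<^sup>2))))"
  proof -
    have "(G + B * r + B * H)\<^sup>2 \<le> 3 * (G\<^sup>2 + (B * r)\<^sup>2 + (B * H)\<^sup>2)"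
      using sum_squares_bound[of G "B * r"] sum_squares_bound[of G "B * H"]
        sum_squares_bound[of "B * r" "B * H"]
      by (simp add: power2_eq_square algebra_simps)
    also have "\<dots> \<le> 3 * ((1 + B\<^sup>2) * (G\<^sup>2 + H\<^sup>2 + r\<^sup>2))"
      by (simp add: power_mult_distrib algebra_simps)
    finally have "(G + Y)\<^sup>2 \<le> 3 * ((1 + B\<^sup>2) * (G\<^sup>2 + H\<^sup>2 + r\<^sup>2))"
      by (simp add: Y_def algebra_simps)
    then show ?thesis
      using L_nonneg ak by (intro mult_left_mono) auto
  qed
  also have "\<dots> = c\<^sub>1 * (c\<^sub>0 * (a k * (G\<^sup>2 + H\<^sup>2 + r\<^sup>2)))"
    using c0 by (simp add: c\<^sub>1_def)
  also have "\<dots> \<le> c\<^sub>1 * (gap k - gap (Suc k))"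
    using gap_decrease[OF k] c1_nonneg by (intro mult_left_mono) (auto simp: G_def H_def r_def)
  finally show ?thesis by (simp add: G_def G'_def)
qed

text \<open>By \<open>grad_square_step\<close> the squared gradient norm plus
  \<open>c\<^sub>1 * gap\<close> is eventually decreasing, hence convergent, and the gap vanishes in
  the limit. A positive limit \<open>l\<close> would make \<open>a k\<close> at most a constant
  times a telescoping decrement, against \<open>a_div\<close>.\<close>

lemma grad_lim: "(\<lambda>k. (norm (g (z k)))\<^sup>2) \<longlonglongrightarrow> 0"
proof -
  let ?b = "\<lambda>k. (norm (g (z k)))\<^sup>2"
  let ?s = "\<lambda>k. ?b (k + N\<^sub>0) + c\<^sub>1 * gap (k + N\<^sub>0)"
  have "convergent ?s"
  proof (rule eventually_decreasing_convergent[of 0])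
    show "?s (Suc k) \<le> ?s k" for k
      using grad_square_step[of "k + N\<^sub>0"] by (simp add: algebra_simps abs_le_iff)
    show "0 \<le> ?s k" for k
      using c1_nonneg gap_nonneg[of "k + N\<^sub>0"] by simp
  qed
  then obtain l where "?s \<longlonglongrightarrow> l" by (auto simp: convergent_def)
  then have "(\<lambda>k. ?s k - c\<^sub>1 * gap (k + N\<^sub>0)) \<longlonglongrightarrow> l - c\<^sub>1 * 0"
    by (intro tendsto_intros LIMSEQ_ignore_initial_segment[OF gap_lim])
  then have "(\<lambda>k. ?b (k + N\<^sub>0)) \<longlonglongrightarrow> l" by simp
  then have lim: "?b \<longlonglongrightarrow> l" by (rule LIMSEQ_offset)
  have "\<not> 0 < l"
  proof
    assume "0 < l"
    then have "eventually (\<lambda>k. l / 2 < ?b k) sequentially"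
      using lim by (intro order_tendstoD) auto
    then have ev: "eventually (\<lambda>k. norm (a k) \<le> 2 / (l * c\<^sub>0) * (gap k - gap (Suc k))) sequentially"
      using eventually_ge_at_top[of N\<^sub>0]
    proof eventually_elim
      case (elim k)
      have "l / 2 \<le> ?b k + (norm (h k))\<^sup>2 + (\<rho> k)\<^sup>2"
        using elim by (smt (verit) zero_le_power2)
      then have "c\<^sub>0 * (a k * (l / 2)) \<le> c\<^sub>0 * (a k * (?b k + (norm (h k))\<^sup>2 + (\<rho> k)\<^sup>2))"
        using c0 a_pos[of k] by (intro mult_left_mono) auto
      also have "\<dots> \<le> gap k - gap (Suc k)" by (rule gap_decrease[OF elim(2)])
      finally show ?case
        using c0 \<open>0 < l\<close> a_pos[of k] by (simp add: field_simps)
    qed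
    have "summable (\<lambda>k. 2 / (l * c\<^sub>0) * (gap k - gap (Suc k)))"
      by (intro summable_mult telescope_summable'[OF gap_lim])
    then show False
      using summable_comparison_test_ev[OF ev] a_div by simp
  qed
  moreover have "0 \<le> l"
    using lim by (rule LIMSEQ_le_const) auto
  ultimately show ?thesis using lim by simp
qed

text \<open>The other sign in \<open>grad_square_step\<close>: now \<open>c\<^sub>1 * gap\<close>
  minus the squared gradient norm decreases, and by \<open>grad_lim\<close> it tends to 0.\<close>

lemma grad_bound:
  assumes "N\<^sub>0 \<le> k" shows "(norm (g (z k)))\<^sup>2 \<le> c\<^sub>1 * gap k"
proof -
  have "0 \<le> c\<^sub>1 * gap k - (norm (g (z k)))\<^sup>2"
  proof (rule eventually_decreasing_nonneg[OF _ _ assms])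
    show "c\<^sub>1 * gap (Suc k) - (norm (g (z (Suc k))))\<^sup>2 \<le> c\<^sub>1 * gap k - (norm (g (z k)))\<^sup>2"
      if "N\<^sub>0 \<le> k" for k
      using grad_square_step[OF that] by (simp add: algebra_simps abs_le_iff)
    show "(\<lambda>k. c\<^sub>1 * gap k - (norm (g (z k)))\<^sup>2) \<longlonglongrightarrow> 0"
      using tendsto_diff[OF tendsto_mult[OF tendsto_const gap_lim] grad_lim] by force
  qed
  then show ?thesis by simp
qed

end

section \<open>Real analysis: concave powers, trapping of a path, a nonlinear recursion\<close>

lemma powr_subadditive:
  fixes x y \<theta> :: real
  assumes "0 \<le> x" "0 \<le> y" "0 < \<theta>" "\<theta> \<le> 1"
  shows "(x + y) powr \<theta> \<le> x powr \<theta> + y powr \<theta>"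
proof (cases "x + y = 0")
  case False
  then have pos: "0 < x + y" using assms by simp
  \<comment> \<open>Ratios in the unit interval do not shrink under a power of exponent at most 1;
    adding the two normalized ratios gives subadditivity.\<close>
  have *: "w / (x + y) \<le> (w / (x + y)) powr \<theta>" if "0 \<le> w" "w \<le> x + y" for w
  proof (cases "w = 0")
    case False
    then have "(w / (x + y)) powr 1 \<le> (w / (x + y)) powr \<theta>"
      using that pos assms by (intro powr_mono') auto
    then show ?thesis using that pos False by simp
  qed simp
  have "1 = x / (x + y) + y / (x + y)"
    using pos by (simp add: add_divide_distrib[symmetric])
  also have "\<dots> \<le> (x / (x + y)) powr \<theta> + (y / (x + y)) powr \<theta>"
    using *[of x] *[of y] assms by simp
  also have "\<dots> = (x powr \<theta> + y powr \<theta>) / (x + y) powr \<theta>"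
    using assms by (simp add: powr_divide add_divide_distrib)
  finally show ?thesis using pos by (simp add: field_simps)
qed (use assms in auto)

text \<open>The tangent inequality at \<open>x\<close> for the concave power with exponent
  \<open>1 - \<theta>\<close>. Young's inequality, the weighted arithmetic-geometric mean, replaces
  differentiation.\<close>

lemma powr_concave_diff:
  fixes x y \<theta> :: real
  assumes "0 \<le> y" "y \<le> x" "0 < x" "0 \<le> \<theta>" "\<theta> < 1"
  shows "(1 - \<theta>) * (x - y) / x powr \<theta> \<le> x powr (1 - \<theta>) - y powr (1 - \<theta>)"
proof -
  have "y powr (1 - \<theta>) * x powr \<theta> \<le> (1 - \<theta>) * y + \<theta> * x"
    using assms Youngs_inequality_0[of "1 - \<theta>" \<theta> y x] by (cases "y = 0") auto
  moreover have "x powr (1 - \<theta>) * x powr \<theta> = x"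
    using assms by (simp add: powr_add[symmetric])
  ultimately have "(1 - \<theta>) * (x - y) \<le> (x powr (1 - \<theta>) - y powr (1 - \<theta>)) * x powr \<theta>"
    by (simp add: algebra_simps)
  then show ?thesis using assms by (simp add: field_simps)
qed

text \<open>\<Lambda> acts as a potential for path length, but is known to work only within \<delta>
  of \<open>zs\<close>. A visit within \<open>\<delta> / 2\<close> at a time when \<Lambda> is below
  \<open>\<delta> / 2\<close> leaves too little length to exit the ball, so from then on the
  potential works at all times.\<close>

lemma trapped_sequence:
  fixes z :: "nat \<Rightarrow> 'a::real_normed_vector"
  assumes lim: "\<Lambda> \<longlonglongrightarrow> 0" and nonneg: "\<And>k. N \<le> k \<Longrightarrow> 0 \<le> \<Lambda> k" and "0 < \<delta>"
    and step: "\<And>k. N \<le> k \<Longrightarrow> norm (z k - zs) < \<delta> \<Longrightarrow> norm (z (Suc k) - z k) \<le> \<Lambda> k - \<Lambda> (Suc k)"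
    and acc: "\<And>r. 0 < r \<Longrightarrow> \<exists>\<^sub>F k in sequentially. norm (z k - zs) < r"
  shows "eventually (\<lambda>k. norm (z k - zs) \<le> \<Lambda> k) sequentially"
proof -
  have "0 < \<delta> / 2" using \<open>0 < \<delta>\<close> by simp
  have "eventually (\<lambda>k. \<Lambda> k < \<delta> / 2 \<and> N \<le> k) sequentially"
    by (rule eventually_conj[OF order_tendstoD(2)[OF lim \<open>0 < \<delta> / 2\<close>] eventually_ge_at_top])
  then have "\<exists>\<^sub>F k in sequentially. (\<Lambda> k < \<delta> / 2 \<and> N \<le> k) \<and> norm (z k - zs) < \<delta> / 2"
    by (rule frequently_eventually_conj[OF acc[OF \<open>0 < \<delta> / 2\<close>]])
  from frequently_ex[OF this] obtain K where K: "norm (z K - zs) < \<delta> / 2" "\<Lambda> K < \<delta> / 2" "N \<le> K"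
    by blast
  have near: "norm (z k - zs) < \<delta> \<and> norm (z k - z K) \<le> \<Lambda> K - \<Lambda> k" if "K \<le> k" for k
    using that
  proof (induction k rule: dec_induct)
    case base
    then show ?case using K \<open>0 < \<delta>\<close> by simp
  next
    case (step k)
    then have k: "N \<le> Suc k" "N \<le> k" using K by auto
    have "norm (z (Suc k) - z k) \<le> \<Lambda> k - \<Lambda> (Suc k)"
      using assms(4)[of k] k step by auto
    then have *: "norm (z (Suc k) - z K) \<le> \<Lambda> K - \<Lambda> (Suc k)"
      using step norm_triangle_ineq[of "z (Suc k) - z k" "z k - z K"] by simp
    then show ?case
      using nonneg[OF k(1)] K norm_triangle_ineq[of "z (Suc k) - z K" "z K - zs"] by simp
  qed
  have diff: "norm (z m - z k) \<le> \<Lambda> k - \<Lambda> m" if "K \<le> k" "k \<le> m" for k m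
    using that(2)
  proof (induction m rule: dec_induct)
    case (step m)
    then have "norm (z (Suc m) - z m) \<le> \<Lambda> m - \<Lambda> (Suc m)"
      using assms(4)[of m] near[of m] K that by auto
    then show ?case
      using step norm_triangle_ineq[of "z (Suc m) - z m" "z m - z k"] by simp
  qed simp
  \<comment> \<open>The path returns arbitrarily close to \<open>zs\<close> at arbitrarily late
    times \<open>m\<close>, and the length from \<open>k\<close> to \<open>m\<close> is at most
    \<open>\<Lambda> k\<close>.\<close>
  have "norm (z k - zs) \<le> \<Lambda> k" if k: "K \<le> k" for k
  proof (rule field_le_epsilon)
    fix r :: real assume "0 < r"
    then have "\<exists>\<^sub>F m in sequentially. k \<le> m \<and> norm (z m - zs) < r"
      using acc by (intro frequently_eventually_conj eventually_ge_at_top)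
    from frequently_ex[OF this] obtain m where m: "norm (z m - zs) < r" "k \<le> m"
      by blast
    then have "norm (z m - z k) \<le> \<Lambda> k"
      using diff[OF k m(2)] nonneg[of m] K k by auto
    then show "norm (z k - zs) \<le> \<Lambda> k + r"
      using m norm_triangle_ineq4[of "z m - zs" "z m - z k"] by (simp add: norm_minus_commute)
  qed
  then show ?thesis by (rule eventually_sequentiallyI)
qed

text \<open>The product \<open>D k * s k\<close> cannot grow while it is at least \<open>J\<close>:
  then \<open>D\<close> shrinks by a factor \<open>1 - q\<close> and \<open>s\<close> grows at most
  by \<open>1 + q\<close>, with the same \<open>q\<close>. Below \<open>J\<close> it can at most
  double in one step, since \<open>D\<close> decreases and \<open>s\<close> at most doubles.\<close>

lemma nonlinear_recursion_rate:
  fixes D a s t :: "nat \<Rightarrow> real"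
  assumes D_nonneg: "\<forall>\<^sub>F k in sequentially. 0 \<le> D k"
    and D_dec: "\<forall>\<^sub>F k in sequentially. D (Suc k) \<le> D k"
    and rec: "\<forall>\<^sub>F k in sequentially.
        D (Suc k) \<le> D k - c * a k * (D k powr (2 * \<theta>) - K * t k powr (- (2 * \<theta>)))"
    and s: "\<forall>\<^sub>F k in sequentially. 0 < s k \<and> s k \<le> t k"
    and s_ratio: "\<forall>\<^sub>F k in sequentially. s (Suc k) \<le> s k * (1 + c / 2 * a k * s k powr (1 - 2 * \<theta>))"
    and s_ratio2: "\<forall>\<^sub>F k in sequentially. s (Suc k) \<le> 2 * s k"
    and a: "\<And>k. 0 < a k" and c: "0 < c" and K: "0 \<le> K" and \<theta>: "1 / 2 \<le> \<theta>"
  obtains K' where "0 \<le> K'" "\<forall>\<^sub>F k in sequentially. D k \<le> K' / s k"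
proof -
  \<comment> \<open>On \<open>J \<le> D k * s k\<close>, the bound by \<open>2 * K\<close> makes the
    noise term at most half of \<open>D k powr (2 * \<theta>)\<close>, and the bound by 1 gives
    \<open>1 / s k \<le> D k\<close>, which linearizes the other half to a multiple of
    \<open>s k powr (1 - 2 * \<theta>) * D k\<close>.\<close>
  define J where "J = max 1 (2 * K)"
  have J: "1 \<le> J" "2 * K \<le> J powr (2 * \<theta>)"
  proof -
    show "1 \<le> J" by (simp add: J_def)
    then have "J powr 1 \<le> J powr (2 * \<theta>)" using \<theta> by (intro powr_mono) auto
    then show "2 * K \<le> J powr (2 * \<theta>)" using \<open>1 \<le> J\<close> by (simp add: J_def)
  qed
  have "\<forall>\<^sub>F k in sequentially. 0 \<le> D k \<and> 0 \<le> D (Suc k) \<and> 0 < s k \<and> 0 < s (Suc k) \<and>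
      (D k * s k \<le> J \<longrightarrow> D (Suc k) * s (Suc k) \<le> 2 * J) \<and>
      (J \<le> D k * s k \<longrightarrow> D (Suc k) * s (Suc k) \<le> D k * s k)"
    using D_nonneg D_dec rec s s_ratio s_ratio2 eventually_sequentially_Suc[THEN iffD2, OF s]
      eventually_sequentially_Suc[THEN iffD2, OF D_nonneg]
  proof eventually_elim
    case (elim k)
    then have pos: "0 \<le> D k" "0 < s k" "0 < t k" "0 < s (Suc k)" "0 \<le> D (Suc k)" by auto
    have "D (Suc k) * s (Suc k) \<le> 2 * J" if "D k * s k \<le> J"
    proof -
      have "D (Suc k) * s (Suc k) \<le> D k * (2 * s k)"
        using elim pos by (intro mult_mono) auto
      then show ?thesis using that by simp
    qed
    moreover have "D (Suc k) * s (Suc k) \<le> D k * s k" if "J \<le> D k * s k"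
    proof -
      define q where "q = c / 2 * a k * s k powr (1 - 2 * \<theta>)"
      have q0: "0 \<le> q" using a[of k] c by (simp add: q_def)
      have Dge: "J / s k \<le> D k" using that pos by (simp add: field_simps)
      have Dpos: "0 < D k" using Dge J pos by (smt (verit) divide_pos_pos)
      have "2 * K * t k powr (- (2 * \<theta>)) \<le> J powr (2 * \<theta>) * s k powr (- (2 * \<theta>))"
        using J elim pos \<theta> K by (intro mult_mono powr_mono2') auto
      also have "\<dots> = (J / s k) powr (2 * \<theta>)"
        using J pos by (simp add: powr_divide powr_minus_divide)
      also have "\<dots> \<le> D k powr (2 * \<theta>)"
        using Dge J pos \<theta> by (intro powr_mono2) auto
      finally have half: "D k powr (2 * \<theta>) / 2 \<le> D k powr (2 * \<theta>) - K * t k powr (- (2 * \<theta>))"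
        by simp
      have "(1 / s k) powr (2 * \<theta> - 1) \<le> D k powr (2 * \<theta> - 1)"
        using Dge J pos \<theta> by (intro powr_mono2) (auto simp: field_simps)
      moreover have "(1 / s k) powr (2 * \<theta> - 1) = s k powr (1 - 2 * \<theta>)"
        using pos powr_minus_divide[of "s k" "2 * \<theta> - 1"] by (simp add: powr_divide)
      moreover have "D k powr (2 * \<theta> - 1) * D k = D k powr (2 * \<theta>)"
        using powr_add[of "D k" "2 * \<theta> - 1" 1] Dpos by simp
      ultimately have "s k powr (1 - 2 * \<theta>) * D k \<le> D k powr (2 * \<theta>)"
        using pos mult_right_mono by metis
      then have "c / 2 * a k * (s k powr (1 - 2 * \<theta>) * D k) \<le> c / 2 * a k * D k powr (2 * \<theta>)"
        using c a[of k] by (intro mult_left_mono) auto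
      moreover have "c * a k * (D k powr (2 * \<theta>) / 2) \<le> c * a k * (D k powr (2 * \<theta>) - K * t k powr (- (2 * \<theta>)))"
        using half c a[of k] by (intro mult_left_mono) auto
      ultimately have dec: "D (Suc k) \<le> D k * (1 - q)"
        using elim by (simp add: q_def algebra_simps)
      have "D (Suc k) * s (Suc k) \<le> D (Suc k) * (s k * (1 + q))"
        using elim pos by (intro mult_left_mono) (auto simp: q_def)
      also have "\<dots> \<le> (D k * (1 - q)) * (s k * (1 + q))"
        using dec pos q0 by (intro mult_right_mono) auto
      also have "\<dots> = D k * s k * (1 - q\<^sup>2)"
        by (simp add: power2_eq_square algebra_simps)
      also have "\<dots> \<le> D k * s k * 1"
        using pos by (intro mult_left_mono) auto
      finally show ?thesis by simp
    qed
    ultimately show ?case using pos by blast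
  qed
  then obtain M where M: "\<And>k. M \<le> k \<Longrightarrow> 0 \<le> D k \<and> 0 < s k \<and>
      (D k * s k \<le> J \<longrightarrow> D (Suc k) * s (Suc k) \<le> 2 * J) \<and>
      (J \<le> D k * s k \<longrightarrow> D (Suc k) * s (Suc k) \<le> D k * s k)"
    unfolding eventually_sequentially by blast
  define K' where "K' = max (2 * J) (D M * s M)"
  have "D k * s k \<le> K'" if "M \<le> k" for k
    using that
  proof (induction k rule: dec_induct)
    case base
    then show ?case by (simp add: K'_def)
  next
    case (step k)
    then show ?case using M[of k] by (cases "D k * s k \<le> J") (auto simp: K'_def)
  qed
  then have "\<forall>\<^sub>F k in sequentially. D k \<le> K' / s k"
    using M by (intro eventually_sequentiallyI[of M]) (simp add: field_simps)
  moreover have "0 \<le> K'" using J by (simp add: K'_def)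
  ultimately show thesis using that by blast
qed

context inexact_momentum
begin

lemma h_lim: "(\<lambda>k. norm (h k)) \<longlonglongrightarrow> 0"
proof -
  have "(\<lambda>k. (norm (h k))\<^sup>2) \<longlonglongrightarrow> 0"
  proof (rule tendsto_sandwich[OF _ _ tendsto_const])
    show "\<forall>\<^sub>F k in sequentially. (norm (h k))\<^sup>2 \<le> gap k / c\<^sub>0"
      using eventually_ge_at_top[of N\<^sub>0]
      by eventually_elim (use h_bound c0 in \<open>simp add: field_simps\<close>)
    show "(\<lambda>k. gap k / c\<^sub>0) \<longlonglongrightarrow> 0"
      using tendsto_divide[OF gap_lim tendsto_const, of c\<^sub>0] c0 by simp
  qed simp
  then show ?thesis
    using tendsto_real_sqrt[of "\<lambda>k. (norm (h k))\<^sup>2" 0] by simp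
qed

lemma f_lim: "(\<lambda>k. f (z k)) \<longlonglongrightarrow> flim"
proof -
  have "(\<lambda>k. flim + (gap k - (norm (h k))\<^sup>2 - (2 * B\<^sup>2 + 1) * noise_tail k)) \<longlonglongrightarrow>
      flim + (0 - 0\<^sup>2 - (2 * B\<^sup>2 + 1) * 0)"
    by (intro tendsto_intros gap_lim h_lim noise_tail_lim)
  then show ?thesis by (simp add: f_eq_gap[symmetric])
qed

lemma gap_le: "gap k \<le> \<bar>f (z k) - flim\<bar> + (norm (h k))\<^sup>2 + (2 * B\<^sup>2 + 1) * noise_tail k"
  using f_eq_gap[of k] by linarith

text \<open>Since \<open>t\<close> increases from \<open>N\<close> on, \<open>t k\<close> may be
  moved under the sum and enlarged to \<open>t j\<close>; what results is part of the convergent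
  weighted series.\<close>

lemma noise_tail_rate:
  assumes sum: "summable (\<lambda>k. t k * (a k * (\<rho> k)\<^sup>2))"
    and mono: "\<And>j k. N \<le> k \<Longrightarrow> k \<le> j \<Longrightarrow> t k \<le> t j" and pos: "\<And>k. N \<le> k \<Longrightarrow> 0 < t k"
  obtains S where "0 \<le> S" "\<forall>\<^sub>F k in sequentially. noise_tail k \<le> S / t k"
proof -
  define w where "w k = t k * (a k * (\<rho> k)\<^sup>2)" for k
  define S where "S = (\<Sum>j. w (j + N))"
  have sumN: "summable (\<lambda>j. w (j + k))" for k
    unfolding w_def by (rule summable_ignore_initial_segment[OF sum])
  have w_nonneg: "0 \<le> w j" if "N \<le> j" for j
    using pos[OF that] a_pos[of j] by (simp add: w_def)
  have "noise_tail k \<le> S / t k" if k: "N \<le> k" for k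
  proof -
    have "t k * noise_tail k = (\<Sum>j. t k * (a (j + k) * (\<rho> (j + k))\<^sup>2))"
      unfolding noise_tail_def
      by (intro suminf_mult[symmetric] summable_ignore_initial_segment[OF noise_summable])
    also have "\<dots> \<le> (\<Sum>j. w (j + k))"
      unfolding w_def using mono[OF k] a_pos
      by (intro suminf_le summable_mult summable_ignore_initial_segment noise_summable sum mult_right_mono)
         (auto simp: less_imp_le)
    also have "\<dots> = (\<Sum>j. w (j + (k - N) + N))"
      using k by simp
    also have "\<dots> = S - (\<Sum>j<k - N. w (j + N))"
      unfolding S_def by (rule suminf_minus_initial_segment[OF sumN])
    also have "\<dots> \<le> S"
      using w_nonneg by (simp add: sum_nonneg)
    finally show ?thesis using pos[OF k] by (simp add: field_simps)
  qed
  then have "\<forall>\<^sub>F k in sequentially. noise_tail k \<le> S / t k"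
    by (rule eventually_sequentiallyI)
  moreover have "0 \<le> S"
    unfolding S_def using sumN[of N] w_nonneg by (intro suminf_nonneg) auto
  ultimately show thesis using that by blast
qed

end

section \<open>Descent under a local Lojasiewicz inequality\<close>

text \<open>The inequality is centred at \<open>flim\<close>, the value that \<open>f\<close> takes
  at accumulation points. Points with \<open>f y = flim\<close> need no exclusion, because 0 raised
  to \<theta> is 0.\<close>

locale lojasiewicz_path = inexact_momentum +
  fixes zs :: 'a and \<theta> C \<delta> \<eta> S :: real and t :: "nat \<Rightarrow> real"
  assumes theta: "1 / 2 \<le> \<theta>" "\<theta> < 1"
    and C_pos: "0 < C" and delta_pos: "0 < \<delta>" and eta_pos: "0 < \<eta>"
    and loja: "\<And>y. norm (y - zs) < \<delta> \<Longrightarrow> \<bar>f y - flim\<bar> < \<eta> \<Longrightarrow>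
      C * \<bar>f y - flim\<bar> powr \<theta> \<le> norm (g y)"
    and S_nonneg: "0 \<le> S"
    and t_pos: "\<forall>\<^sub>F k in sequentially. 0 < t k"
    and tail_rate: "\<forall>\<^sub>F k in sequentially. noise_tail k \<le> S / t k"
begin

lemma loja_eventually:
  "\<forall>\<^sub>F k in sequentially. norm (z k - zs) < \<delta> \<longrightarrow> C * \<bar>f (z k) - flim\<bar> powr \<theta> \<le> norm (g (z k))"
proof -
  have "(\<lambda>k. \<bar>f (z k) - flim\<bar>) \<longlonglongrightarrow> 0"
    using tendsto_rabs_zero[OF LIM_zero[OF f_lim]] by simp
  then have "\<forall>\<^sub>F k in sequentially. \<bar>f (z k) - flim\<bar> < \<eta>"
    using eta_pos by (rule order_tendstoD)
  then show ?thesis by eventually_elim (simp add: loja)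
qed

text \<open>One summand for each contribution to the gap in \<open>gap_powr_bound\<close>: function
  value, remainder momentum \<open>h\<close>, and noise tail.\<close>

definition k\<^sub>1 :: real where "k\<^sub>1 = 1 / C + 1 + ((2 * B\<^sup>2 + 1) * S) powr \<theta>"

lemma k1: "1 \<le> k\<^sub>1" "1 / C \<le> k\<^sub>1" "((2 * B\<^sup>2 + 1) * S) powr \<theta> \<le> k\<^sub>1"
  using C_pos by (auto simp: k\<^sub>1_def)

text \<open>Subadditivity splits the gap into its three contributions. The assumption
  \<open>1 / 2 \<le> \<theta>\<close> turns the squared norm of \<open>h\<close> raised to \<theta>
  into at most the norm itself, once that norm is below 1; the tail rate produces
  \<open>t k powr - \<theta>\<close>.\<close>

lemma gap_powr_bound:
  "\<forall>\<^sub>F k in sequentially. norm (z k - zs) < \<delta> \<longrightarrow>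
     gap k powr \<theta> \<le> k\<^sub>1 * (norm (g (z k)) + norm (h k) + t k powr - \<theta>)"
proof -
  have "\<forall>\<^sub>F k in sequentially. norm (h k) < 1"
    using h_lim by (rule order_tendstoD) simp
  then show ?thesis
    using loja_eventually t_pos tail_rate eventually_ge_at_top[of N\<^sub>0]
  proof eventually_elim
    case (elim k)
    show ?case
    proof
      assume near: "norm (z k - zs) < \<delta>"
      let ?w = "(2 * B\<^sup>2 + 1) * noise_tail k"
      have w: "0 \<le> ?w" using noise_tail_nonneg by simp
      have "gap k powr \<theta> \<le> (\<bar>f (z k) - flim\<bar> + (norm (h k))\<^sup>2 + ?w) powr \<theta>"
        using gap_le gap_nonneg elim theta by (intro powr_mono2) auto
      also have "\<dots> \<le> (\<bar>f (z k) - flim\<bar> + (norm (h k))\<^sup>2) powr \<theta> + ?w powr \<theta>"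
        using w theta by (intro powr_subadditive) auto
      also have "\<dots> \<le> \<bar>f (z k) - flim\<bar> powr \<theta> + (norm (h k))\<^sup>2 powr \<theta> + ?w powr \<theta>"
        using theta by (intro add_right_mono powr_subadditive) auto
      also have "\<bar>f (z k) - flim\<bar> powr \<theta> \<le> k\<^sub>1 * norm (g (z k))"
      proof -
        have "\<bar>f (z k) - flim\<bar> powr \<theta> \<le> 1 / C * norm (g (z k))"
          using elim near C_pos by (simp add: field_simps)
        also have "\<dots> \<le> k\<^sub>1 * norm (g (z k))"
          using k1 by (intro mult_right_mono) auto
        finally show ?thesis .
      qed
      also have "(norm (h k))\<^sup>2 powr \<theta> \<le> k\<^sub>1 * norm (h k)"
      proof -
        have "(norm (h k))\<^sup>2 powr \<theta> = norm (h k) powr (2 * \<theta>)"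
        proof (cases "h k = 0")
          case False
          then have "(norm (h k))\<^sup>2 = norm (h k) powr 2" by simp
          then show ?thesis by (simp only: powr_powr)
        qed (use theta in auto)
        also have "\<dots> \<le> norm (h k) powr 1"
          using elim theta by (intro powr_mono') auto
        also have "\<dots> \<le> k\<^sub>1 * norm (h k)"
          using k1 mult_right_mono[of 1 k\<^sub>1 "norm (h k)"] by simp
        finally show ?thesis .
      qed
      also have "?w powr \<theta> \<le> k\<^sub>1 * t k powr - \<theta>"
      proof -
        have "?w \<le> (2 * B\<^sup>2 + 1) * (S / t k)"
          using elim by (intro mult_left_mono) auto
        then have "?w powr \<theta> \<le> ((2 * B\<^sup>2 + 1) * S / t k) powr \<theta>"
          using w theta by (intro powr_mono2) auto
        also have "\<dots> = ((2 * B\<^sup>2 + 1) * S) powr \<theta> * t k powr - \<theta>"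
          using S_nonneg elim by (simp add: powr_divide powr_minus_divide)
        also have "\<dots> \<le> k\<^sub>1 * t k powr - \<theta>"
          using k1 by (intro mult_right_mono) auto
        finally show ?thesis .
      qed
      finally show "gap k powr \<theta> \<le> k\<^sub>1 * (norm (g (z k)) + norm (h k) + t k powr - \<theta>)"
        by (simp add: algebra_simps)
    qed
  qed
qed

text \<open>The 6 is 3 from squaring a sum of three terms times 2 from
  \<open>G + H + \<tau> \<le> 2 * X\<close>; the factor \<open>1 - \<theta>\<close> belongs to
  \<open>powr_concave_diff\<close>.\<close>

definition k\<^sub>2 :: real where "k\<^sub>2 = 6 * k\<^sub>1 / ((1 - \<theta>) * c\<^sub>0)"

lemma k2_nonneg: "0 \<le> k\<^sub>2"
  using k1 theta c0 by (simp add: k\<^sub>2_def)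

text \<open>The desingularization argument with a noise floor. If the step measure \<open>X\<close>
  is at most \<open>t k powr - \<theta>\<close>, the last term pays for it. Otherwise
  \<open>gap k powr \<theta>\<close> is at most a multiple of \<open>X\<close>, and concavity
  converts a decrease of order \<open>a k * X\<^sup>2\<close> into one of order
  \<open>a k * X\<close> for \<open>gap powr (1 - \<theta>)\<close>.\<close>

lemma length_step:
  "\<forall>\<^sub>F k in sequentially. norm (z k - zs) < \<delta> \<longrightarrow>
     a k * (norm (g (z k)) + norm (h k) + \<rho> k)
     \<le> k\<^sub>2 * (gap k powr (1 - \<theta>) - gap (Suc k) powr (1 - \<theta>)) + a k * t k powr - \<theta>"
  using gap_powr_bound eventually_ge_at_top[of N\<^sub>0]
proof eventually_elim
  case (elim k)
  show ?case
  proof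
    assume near: "norm (z k - zs) < \<delta>"
    define G H r \<tau> X where "G = norm (g (z k))" and "H = norm (h k)" and "r = \<rho> k"
      and "\<tau> = t k powr - \<theta>" and "X = G + H + r"
    have pos: "0 \<le> G" "0 \<le> H" "0 \<le> r" "0 \<le> \<tau>" "0 < a k" "0 \<le> X"
      using a_pos rho_nonneg by (auto simp: G_def H_def r_def \<tau>_def X_def)
    have dec: "c\<^sub>0 * (a k * (G\<^sup>2 + H\<^sup>2 + r\<^sup>2)) \<le> gap k - gap (Suc k)"
      using gap_decrease elim by (simp add: G_def H_def r_def)
    have X3: "X\<^sup>2 \<le> 3 * (G\<^sup>2 + H\<^sup>2 + r\<^sup>2)"
      using sum_squares_bound[of G H] sum_squares_bound[of G r] sum_squares_bound[of H r]
      by (simp add: X_def power2_eq_square algebra_simps)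
    have "c\<^sub>0 * (a k * X\<^sup>2) \<le> c\<^sub>0 * (a k * (3 * (G\<^sup>2 + H\<^sup>2 + r\<^sup>2)))"
      using X3 c0 pos by (intro mult_left_mono) auto
    then have decX: "c\<^sub>0 * (a k * X\<^sup>2) \<le> 3 * (gap k - gap (Suc k))"
      using dec by (simp add: algebra_simps)
    have gaps: "0 \<le> gap k" "0 \<le> gap (Suc k)" "gap (Suc k) \<le> gap k"
      using gap_nonneg[of k] gap_nonneg[of "Suc k"] gap_Suc_le elim by auto
    then have phi: "0 \<le> gap k powr (1 - \<theta>) - gap (Suc k) powr (1 - \<theta>)"
      using theta by (simp add: powr_mono2)
    have "a k * X \<le> k\<^sub>2 * (gap k powr (1 - \<theta>) - gap (Suc k) powr (1 - \<theta>)) + a k * \<tau>"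
    proof (cases "\<tau> < X \<and> X \<noteq> 0")
      case False
      then have "X \<le> \<tau>" using pos by auto
      then have "a k * X \<le> a k * \<tau>" using pos by (intro mult_left_mono) auto
      then show ?thesis using k2_nonneg phi by (simp add: add_increasing)
    next
      case True
      then have "0 < X" using pos by simp
      then have "0 < c\<^sub>0 * (a k * X\<^sup>2)" using pos c0 by simp
      then have "0 < 3 * (gap k - gap (Suc k))" using decX by (rule less_le_trans)
      then have "0 < gap k" using gaps by simp
      have "gap k powr \<theta> \<le> k\<^sub>1 * (G + H + \<tau>)"
        using elim near by (simp add: G_def H_def \<tau>_def)
      also have "\<dots> \<le> k\<^sub>1 * (2 * X)"
        using True k1 pos by (intro mult_left_mono) (auto simp: X_def)
      finally have up: "gap k powr \<theta> \<le> 2 * k\<^sub>1 * X" by simp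
      have "(1 - \<theta>) * (c\<^sub>0 * (a k * X\<^sup>2) / 3) / (2 * k\<^sub>1 * X) \<le> (1 - \<theta>) * (gap k - gap (Suc k)) / gap k powr \<theta>"
        using up decX \<open>0 < gap k\<close> \<open>0 < X\<close> k1 theta c0 pos gaps by (intro frac_le mult_left_mono) auto
      also have "\<dots> \<le> gap k powr (1 - \<theta>) - gap (Suc k) powr (1 - \<theta>)"
        using gaps theta \<open>0 < gap k\<close> by (intro powr_concave_diff) auto
      finally have "k\<^sub>2 * ((1 - \<theta>) * (c\<^sub>0 * (a k * X\<^sup>2) / 3) / (2 * k\<^sub>1 * X)) \<le>
          k\<^sub>2 * (gap k powr (1 - \<theta>) - gap (Suc k) powr (1 - \<theta>))"
        using k2_nonneg by (rule mult_left_mono)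
      also have "k\<^sub>2 * ((1 - \<theta>) * (c\<^sub>0 * (a k * X\<^sup>2) / 3) / (2 * k\<^sub>1 * X)) = a k * X"
        using k1 theta c0 \<open>0 < X\<close> by (simp add: k\<^sub>2_def power2_eq_square field_simps)
      finally show ?thesis using pos by (simp add: add_increasing2)
    qed
    then show "a k * (norm (g (z k)) + norm (h k) + \<rho> k)
       \<le> k\<^sub>2 * (gap k powr (1 - \<theta>) - gap (Suc k) powr (1 - \<theta>)) + a k * t k powr - \<theta>"
      by (simp add: X_def G_def H_def r_def \<tau>_def)
  qed
qed

lemma gap_powr_lim: "(\<lambda>k. gap k powr (1 - \<theta>)) \<longlonglongrightarrow> 0"
proof (rule tendsto_zero_powrI[OF gap_lim tendsto_const])
  show "\<forall>\<^sub>F k in sequentially. 0 \<le> gap k"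
    using eventually_ge_at_top[of N\<^sub>0] by eventually_elim (rule gap_nonneg)
qed (use theta in auto)

text \<open>Any null sequence \<open>s\<close> whose decrements dominate
  \<open>a k * t k powr - \<theta>\<close> bounds the tails of that series. Together with the power
  of the gap it forms the potential for \<open>trapped_sequence\<close>; the factor
  \<open>1 + B\<close> passes from the three norms to the length of a step of
  \<open>z\<close>.\<close>

lemma path_convergence:
  assumes s_lim: "s \<longlonglongrightarrow> 0"
    and s: "\<forall>\<^sub>F k in sequentially. a k * t k powr - \<theta> \<le> s k - s (Suc k)"
    and acc: "\<And>r. 0 < r \<Longrightarrow> \<exists>\<^sub>F k in sequentially. norm (z k - zs) < r"
  shows "\<forall>\<^sub>F k in sequentially.
    norm (z k - zs) \<le> (1 + B) * (k\<^sub>2 * gap k powr (1 - \<theta>) + s k)"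
proof -
  define \<Lambda> where "\<Lambda> k = (1 + B) * (k\<^sub>2 * gap k powr (1 - \<theta>) + s k)" for k
  have ev: "\<forall>\<^sub>F k in sequentially. norm (z k - zs) < \<delta> \<longrightarrow> norm (z (Suc k) - z k) \<le> \<Lambda> k - \<Lambda> (Suc k)"
    using length_step s
  proof eventually_elim
    case (elim k)
    show ?case
    proof
      assume near: "norm (z k - zs) < \<delta>"
      define G H r where "G = norm (g (z k))" and "H = norm (h k)" and "r = \<rho> k"
      have pos: "0 \<le> G" "0 \<le> H" "0 \<le> r"
        using rho_nonneg by (auto simp: G_def H_def r_def)
      have "norm (z (Suc k) - z k) \<le> a k * (G + B * (r + H))"
        using z_step_norm[of k] by (simp add: G_def H_def r_def)
      also have "\<dots> \<le> a k * ((1 + B) * (G + H + r))"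
        using B_nonneg pos a_pos[of k] by (intro mult_left_mono) (auto simp: algebra_simps)
      also have "\<dots> = (1 + B) * (a k * (G + H + r))" by simp
      also have "\<dots> \<le> (1 + B) * (k\<^sub>2 * (gap k powr (1 - \<theta>) - gap (Suc k) powr (1 - \<theta>)) + (s k - s (Suc k)))"
        using elim near B_nonneg by (intro mult_left_mono) (auto simp: G_def H_def r_def)
      finally show "norm (z (Suc k) - z k) \<le> \<Lambda> k - \<Lambda> (Suc k)"
        by (simp add: \<Lambda>_def algebra_simps)
    qed
  qed
  obtain N where N: "\<And>k. N \<le> k \<Longrightarrow> norm (z k - zs) < \<delta> \<Longrightarrow> norm (z (Suc k) - z k) \<le> \<Lambda> k - \<Lambda> (Suc k)"
    using ev unfolding eventually_sequentially by blast
  obtain M where M: "\<And>k. M \<le> k \<Longrightarrow> a k * t k powr - \<theta> \<le> s k - s (Suc k)"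
    using s unfolding eventually_sequentially by blast
  have s_nonneg: "0 \<le> s k" if "M \<le> k" for k
  proof (rule eventually_decreasing_nonneg[OF _ s_lim that])
    show "s (Suc k) \<le> s k" if "M \<le> k" for k
      using M[OF that] a_pos[of k] by (smt (verit) powr_ge_zero mult_nonneg_nonneg)
  qed
  have "\<Lambda> \<longlonglongrightarrow> (1 + B) * (k\<^sub>2 * 0 + 0)"
    unfolding \<Lambda>_def by (intro tendsto_intros s_lim gap_powr_lim)
  then have lim: "\<Lambda> \<longlonglongrightarrow> 0" by simp
  show ?thesis
    unfolding \<Lambda>_def[symmetric]
  proof (rule trapped_sequence[OF lim _ delta_pos _ acc])
    show "0 \<le> \<Lambda> k" if "max M N \<le> k" for k
      using s_nonneg that k2_nonneg B_nonneg by (simp add: \<Lambda>_def)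
    show "norm (z (Suc k) - z k) \<le> \<Lambda> k - \<Lambda> (Suc k)" if "max M N \<le> k" "norm (z k - zs) < \<delta>" for k
      using N that by simp
  qed
qed

lemma path_limit:
  assumes s_lim: "s \<longlonglongrightarrow> 0"
    and s: "\<forall>\<^sub>F k in sequentially. a k * t k powr - \<theta> \<le> s k - s (Suc k)"
    and acc: "\<And>r. 0 < r \<Longrightarrow> \<exists>\<^sub>F k in sequentially. norm (z k - zs) < r"
  shows "z \<longlonglongrightarrow> zs"
proof -
  have "(\<lambda>k. (1 + B) * (k\<^sub>2 * gap k powr (1 - \<theta>) + s k)) \<longlonglongrightarrow> (1 + B) * (k\<^sub>2 * 0 + 0)"
    by (intro tendsto_intros s_lim gap_powr_lim)
  then have "(\<lambda>k. (1 + B) * (k\<^sub>2 * gap k powr (1 - \<theta>) + s k)) \<longlonglongrightarrow> 0" by simp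
  from tendsto_sandwich[OF _ path_convergence[OF assms] tendsto_const this]
  have "(\<lambda>k. norm (z k - zs)) \<longlonglongrightarrow> 0" by simp
  then show ?thesis by (simp add: LIM_zero_iff tendsto_norm_zero_iff)
qed

text \<open>Squaring \<open>gap_powr_bound\<close> bounds the squares of gradient and
  \<open>h\<close> from below in terms of the gap, up to the noise floor;
  \<open>gap_decrease\<close> then turns them into a decrease.\<close>

lemma gap_recursion:
  assumes conv: "z \<longlonglongrightarrow> zs"
  shows "\<forall>\<^sub>F k in sequentially. gap (Suc k) \<le>
    gap k - c\<^sub>0 / (3 * k\<^sub>1\<^sup>2) * a k * (gap k powr (2 * \<theta>) - 3 * k\<^sub>1\<^sup>2 * t k powr (- (2 * \<theta>)))"
proof -
  have "\<forall>\<^sub>F k in sequentially. norm (z k - zs) < \<delta>"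
    using conv delta_pos by (simp add: tendsto_iff dist_norm)
  then show ?thesis
    using gap_powr_bound eventually_ge_at_top[of N\<^sub>0] t_pos
  proof eventually_elim
    case (elim k)
    define G H \<tau> where "G = norm (g (z k))" and "H = norm (h k)" and "\<tau> = t k powr - \<theta>"
    have "(gap k powr \<theta>)\<^sup>2 \<le> (k\<^sub>1 * (G + H + \<tau>))\<^sup>2"
      using elim by (intro power_mono) (auto simp: G_def H_def \<tau>_def)
    moreover have "(gap k powr \<theta>)\<^sup>2 = gap k powr (2 * \<theta>)"
      using theta by (cases "gap k = 0") (simp_all add: power2_eq_square powr_add[symmetric])
    moreover have "(k\<^sub>1 * (G + H + \<tau>))\<^sup>2 \<le> k\<^sub>1\<^sup>2 * (3 * (G\<^sup>2 + H\<^sup>2 + \<tau>\<^sup>2))"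
      unfolding power_mult_distrib
      using sum_squares_bound[of G H] sum_squares_bound[of G \<tau>] sum_squares_bound[of H \<tau>]
      by (intro mult_left_mono) (auto simp: power2_eq_square algebra_simps)
    moreover have "\<tau>\<^sup>2 = t k powr (- (2 * \<theta>))"
      using elim by (simp add: \<tau>_def power2_eq_square powr_add[symmetric])
    ultimately have "gap k powr (2 * \<theta>) - 3 * k\<^sub>1\<^sup>2 * t k powr (- (2 * \<theta>)) \<le> 3 * k\<^sub>1\<^sup>2 * (G\<^sup>2 + H\<^sup>2)"
      by (simp add: algebra_simps)
    then have "c\<^sub>0 / (3 * k\<^sub>1\<^sup>2) * a k * (gap k powr (2 * \<theta>) - 3 * k\<^sub>1\<^sup>2 * t k powr (- (2 * \<theta>)))
        \<le> c\<^sub>0 / (3 * k\<^sub>1\<^sup>2) * a k * (3 * k\<^sub>1\<^sup>2 * (G\<^sup>2 + H\<^sup>2))"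
      using c0 a_pos[of k] by (intro mult_left_mono) auto
    also have "\<dots> = c\<^sub>0 * (a k * (G\<^sup>2 + H\<^sup>2))"
      using k1 by simp
    also have "\<dots> \<le> c\<^sub>0 * (a k * (G\<^sup>2 + H\<^sup>2 + (\<rho> k)\<^sup>2))"
      using c0 a_pos[of k] by (intro mult_left_mono) auto
    also have "\<dots> \<le> gap k - gap (Suc k)"
      using gap_decrease elim by (simp add: G_def H_def)
    finally show ?case by simp
  qed
qed

text \<open>For \<open>\<gamma> = 1\<close> the rate depends on the size of the coefficient, so the
  crude one of \<open>gap_recursion\<close> is replaced by an explicit multiple of
  \<open>C\<^sup>2\<close>. For \<open>\<theta> = 1 / 2\<close> the squared inequality is linear in
  the gap, and the factor 1/4 is that of the gradient in \<open>gap_step\<close>; the part with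
  \<open>h\<close> is covered by \<open>(1 - lam) / 2\<close> once \<open>a k\<close> is
  small.\<close>

lemma gap_recursion_half:
  assumes conv: "z \<longlonglongrightarrow> zs" and half: "\<theta> = 1 / 2"
  shows "\<forall>\<^sub>F k in sequentially. gap (Suc k) \<le>
    gap k - C\<^sup>2 / 4 * a k * (gap k powr (2 * \<theta>) - (2 * B\<^sup>2 + 1) * S * t k powr (- (2 * \<theta>)))"
proof -
  have "\<forall>\<^sub>F k in sequentially. norm (z k - zs) < \<delta>"
    using conv delta_pos by (simp add: tendsto_iff dist_norm)
  moreover have "\<forall>\<^sub>F k in sequentially. a k * (C\<^sup>2 / 4) \<le> (1 - lam) / 2"
    using lam by (intro eventually_a_small) auto
  ultimately show ?thesis
    using loja_eventually eventually_ge_at_top[of N\<^sub>0] t_pos tail_rate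
  proof eventually_elim
    case (elim k)
    define G H where "G = norm (g (z k))" and "H = norm (h k)"
    have "(C * \<bar>f (z k) - flim\<bar> powr \<theta>)\<^sup>2 \<le> G\<^sup>2"
      using elim C_pos by (intro power_mono) (auto simp: G_def)
    then have GC: "C\<^sup>2 * \<bar>f (z k) - flim\<bar> \<le> G\<^sup>2"
      using half by (simp add: power_mult_distrib powr_half_sqrt)
    have pw: "gap k powr (2 * \<theta>) = gap k" "t k powr (- (2 * \<theta>)) = 1 / t k"
    proof -
      have "2 * \<theta> = 1" using half by simp
      then show "gap k powr (2 * \<theta>) = gap k" "t k powr (- (2 * \<theta>)) = 1 / t k"
        using gap_nonneg[of k] elim by (simp_all add: powr_minus_divide)
    qed
    have "(2 * B\<^sup>2 + 1) * noise_tail k \<le> (2 * B\<^sup>2 + 1) * (S / t k)"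
      using elim by (intro mult_left_mono) auto
    then have "gap k - (2 * B\<^sup>2 + 1) * (S / t k) \<le> \<bar>f (z k) - flim\<bar> + H\<^sup>2"
      using gap_le[of k] by (simp add: H_def)
    then have "C\<^sup>2 / 4 * a k * (gap k - (2 * B\<^sup>2 + 1) * (S / t k)) \<le> C\<^sup>2 / 4 * a k * (\<bar>f (z k) - flim\<bar> + H\<^sup>2)"
      using a_pos[of k] by (intro mult_left_mono) auto
    also have "\<dots> = a k / 4 * (C\<^sup>2 * \<bar>f (z k) - flim\<bar>) + a k * (C\<^sup>2 / 4) * H\<^sup>2"
      by (simp add: algebra_simps)
    also have "\<dots> \<le> a k / 4 * G\<^sup>2 + (1 - lam) / 2 * H\<^sup>2"
      using GC elim a_pos[of k] by (intro add_mono mult_left_mono mult_right_mono) auto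
    also have "\<dots> \<le> gap k - gap (Suc k)"
    proof -
      have "0 \<le> a k * (\<rho> k)\<^sup>2" using a_pos[of k] by simp
      then show ?thesis using gap_step elim unfolding G_def H_def by (smt (verit))
    qed
    finally have "C\<^sup>2 / 4 * a k * (gap k - (2 * B\<^sup>2 + 1) * (S / t k)) \<le> gap k - gap (Suc k)" .
    moreover have "(2 * B\<^sup>2 + 1) * S * (1 / t k) = (2 * B\<^sup>2 + 1) * (S / t k)" by simp
    ultimately show ?case
      unfolding pw by (simp only: le_diff_eq add.commute)
  qed
qed

end

section \<open>Filtered martingale differences\<close>

primrec filt :: "(nat \<Rightarrow> real) \<Rightarrow> (nat \<Rightarrow> real) \<Rightarrow> (nat \<Rightarrow> 'a::real_vector) \<Rightarrow> nat \<Rightarrow> 'a" where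
  "filt q \<alpha> e 0 = 0"
| "filt q \<alpha> e (Suc k) = (1 - q k) *\<^sub>R filt q \<alpha> e k + \<alpha> k *\<^sub>R e k"

lemma norm_linear_combination_square:
  fixes x y :: "'a::real_inner"
  shows "(norm (c *\<^sub>R x + d *\<^sub>R y))\<^sup>2 = c\<^sup>2 * (norm x)\<^sup>2 + d\<^sup>2 * (norm y)\<^sup>2 + 2 * c * d * (x \<bullet> y)"
  unfolding power2_norm_eq_inner
  by (simp add: inner_add_left inner_add_right inner_commute power2_eq_square algebra_simps)

text \<open>Indices are shifted: \<open>e k\<close> is revealed between \<open>F k\<close> and
  \<open>F (Suc k)\<close>. In the application it is the error with index \<open>Suc k\<close>, and
  \<open>F k\<close> is generated by the iterates up to \<open>Suc k\<close>.\<close>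

locale martingale_errors = prob_space M for M :: "'w measure" +
  fixes F :: "nat \<Rightarrow> 'w measure" and e :: "nat \<Rightarrow> 'w \<Rightarrow> 'a::euclidean_space" and \<sigma> :: real
  assumes subalg: "\<And>k. subalgebra M (F k)"
    and incr: "\<And>k. sets (F k) \<subseteq> sets (F (Suc k))"
    and e_meas: "\<And>k. e k \<in> borel_measurable (F (Suc k))"
    and e_mean: "\<And>k. AE \<omega> in M. vec_cond_exp M (F k) (e k) \<omega> = 0"
    and e_var: "\<And>k. AE \<omega> in M. nn_cond_exp M (F k) (\<lambda>\<omega>'. ennreal ((norm (e k \<omega>'))\<^sup>2)) \<omega>
                  \<le> ennreal (\<sigma>\<^sup>2)"
begin

lemma sigma_finite: "sigma_finite_subalgebra M (F k)"
  by (intro finite_measure_subalgebra_is_sigma_finite finite_measure_subalgebra.intro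
      finite_measure_subalgebra_axioms.intro subalg finite_measure_axioms)

lemma F_measurable: "X \<in> measurable (F k) N \<Longrightarrow> X \<in> measurable M N"
  using measurable_from_subalg[OF subalg] .

lemma F_sets: "A \<in> sets (F k) \<Longrightarrow> A \<in> sets M"
  using subalg[of k] by (auto simp: subalgebra_def)

lemma space_F: "space (F k) = space M"
  using subalg[of k] by (simp add: subalgebra_def)

lemma F_Suc: "X \<in> measurable (F k) N \<Longrightarrow> X \<in> measurable (F (Suc k)) N"
  using incr[of k] space_F by (intro measurable_from_subalg[of "F (Suc k)" "F k"]) (auto simp: subalgebra_def)

lemma F_mono: "j \<le> k \<Longrightarrow> X \<in> measurable (F j) N \<Longrightarrow> X \<in> measurable (F k) N"
  by (induction k rule: dec_induct) (auto intro: F_Suc)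

lemma e_measurable [measurable]: "e k \<in> borel_measurable M"
  using e_meas by (rule F_measurable)

lemma e_nn_integral: "(\<integral>\<^sup>+ \<omega>. ennreal ((norm (e k \<omega>))\<^sup>2) \<partial>M) \<le> ennreal (\<sigma>\<^sup>2)"
proof -
  interpret S: sigma_finite_subalgebra M "F k" by (rule sigma_finite)
  have "(\<integral>\<^sup>+ \<omega>. ennreal ((norm (e k \<omega>))\<^sup>2) \<partial>M)
      = (\<integral>\<^sup>+ \<omega>. 1 * nn_cond_exp M (F k) (\<lambda>\<omega>'. ennreal ((norm (e k \<omega>'))\<^sup>2)) \<omega> \<partial>M)"
    by (subst S.nn_cond_exp_intg) auto
  also have "\<dots> \<le> (\<integral>\<^sup>+ \<omega>. ennreal (\<sigma>\<^sup>2) \<partial>M)"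
    using e_var[of k] by (intro nn_integral_mono_AE) auto
  also have "\<dots> = ennreal (\<sigma>\<^sup>2)"
    by (simp add: emeasure_space_1)
  finally show ?thesis .
qed

lemma e_square_integrable: "integrable M (\<lambda>\<omega>. (norm (e k \<omega>))\<^sup>2)"
  using e_nn_integral[of k] by (intro integrableI_nonneg) (auto intro: order_le_less_trans)

lemma e_second_moment: "expectation (\<lambda>\<omega>. (norm (e k \<omega>))\<^sup>2) \<le> \<sigma>\<^sup>2"
proof -
  have "ennreal (expectation (\<lambda>\<omega>. (norm (e k \<omega>))\<^sup>2)) \<le> ennreal (\<sigma>\<^sup>2)"
    using e_nn_integral[of k] by (subst (asm) nn_integral_eq_integral[OF e_square_integrable]) auto
  then show ?thesis by simp
qed

lemma integrable_inner_of_squares: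
  fixes X Y :: "'w \<Rightarrow> 'b::euclidean_space"
  assumes [measurable]: "X \<in> borel_measurable M" "Y \<in> borel_measurable M"
    and X: "integrable M (\<lambda>\<omega>. (norm (X \<omega>))\<^sup>2)" and Y: "integrable M (\<lambda>\<omega>. (norm (Y \<omega>))\<^sup>2)"
  shows "integrable M (\<lambda>\<omega>. X \<omega> \<bullet> Y \<omega>)"
proof (rule Bochner_Integration.integrable_bound)
  show "integrable M (\<lambda>\<omega>. (norm (X \<omega>))\<^sup>2 + (norm (Y \<omega>))\<^sup>2)"
    using X Y by (rule Bochner_Integration.integrable_add)
  have "\<bar>X \<omega> \<bullet> Y \<omega>\<bar> \<le> (norm (X \<omega>))\<^sup>2 + (norm (Y \<omega>))\<^sup>2" for \<omega>
    using Cauchy_Schwarz_ineq2[of "X \<omega>" "Y \<omega>"] sum_squares_bound[of "norm (X \<omega>)" "norm (Y \<omega>)"]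
      mult_nonneg_nonneg[of "norm (X \<omega>)" "norm (Y \<omega>)"] by simp
  then show "AE \<omega> in M. norm (X \<omega> \<bullet> Y \<omega>) \<le> norm ((norm (X \<omega>))\<^sup>2 + (norm (Y \<omega>))\<^sup>2)"
    by (auto simp: abs_of_nonneg)
qed simp

text \<open>Works coordinatewise, as \<open>vec_cond_exp\<close> does: the
  \<open>F k\<close>-measurable coordinate of \<open>X\<close> is pulled out of the conditional
  expectation, which vanishes.\<close>

lemma orthogonal:
  assumes X: "X \<in> borel_measurable (F k)" and int: "integrable M (\<lambda>\<omega>. (norm (X \<omega>))\<^sup>2)"
  shows "integrable M (\<lambda>\<omega>. X \<omega> \<bullet> e k \<omega>)" and "expectation (\<lambda>\<omega>. X \<omega> \<bullet> e k \<omega>) = 0"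
proof -
  interpret S: sigma_finite_subalgebra M "F k" by (rule sigma_finite)
  have XM [measurable]: "X \<in> borel_measurable M" using X by (rule F_measurable)
  show "integrable M (\<lambda>\<omega>. X \<omega> \<bullet> e k \<omega>)"
    by (rule integrable_inner_of_squares) (use int e_square_integrable in auto)
  have coord: "integrable M (\<lambda>\<omega>. (X \<omega> \<bullet> b) * (e k \<omega> \<bullet> b))"
    "expectation (\<lambda>\<omega>. (X \<omega> \<bullet> b) * (e k \<omega> \<bullet> b)) = 0" if b: "b \<in> Basis" for b
  proof -
    have sq: "integrable M (\<lambda>\<omega>. (norm (Z \<omega> \<bullet> b))\<^sup>2)"
      if "integrable M (\<lambda>\<omega>. (norm (Z \<omega>))\<^sup>2)" "Z \<in> borel_measurable M" for Z :: "'w \<Rightarrow> 'a"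
    proof (rule Bochner_Integration.integrable_bound[OF that(1)])
      have "(norm (Z \<omega> \<bullet> b))\<^sup>2 \<le> (norm (Z \<omega>))\<^sup>2" for \<omega>
        using Basis_le_norm[OF b, of "Z \<omega>"] by (intro power_mono) auto
      then show "AE \<omega> in M. norm ((norm (Z \<omega> \<bullet> b))\<^sup>2) \<le> norm ((norm (Z \<omega>))\<^sup>2)"
        by simp
    qed (use that in simp)
    show int': "integrable M (\<lambda>\<omega>. (X \<omega> \<bullet> b) * (e k \<omega> \<bullet> b))"
      using integrable_inner_of_squares[of "\<lambda>\<omega>. X \<omega> \<bullet> b" "\<lambda>\<omega>. e k \<omega> \<bullet> b"]
        sq[OF int] sq[OF e_square_integrable] by simp
    have zero: "AE \<omega> in M. real_cond_exp M (F k) (\<lambda>\<omega>'. e k \<omega>' \<bullet> b) \<omega> = 0"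
      using e_mean[of k]
    proof eventually_elim
      case (elim \<omega>)
      then have "vec_cond_exp M (F k) (e k) \<omega> \<bullet> b = 0" by simp
      then show ?case
        using b by (simp add: vec_cond_exp_def inner_sum_left_Basis)
    qed
    have "expectation (\<lambda>\<omega>. (X \<omega> \<bullet> b) * (e k \<omega> \<bullet> b))
        = expectation (\<lambda>\<omega>. (X \<omega> \<bullet> b) * real_cond_exp M (F k) (\<lambda>\<omega>'. e k \<omega>' \<bullet> b) \<omega>)"
      using X int' by (intro S.real_cond_exp_intg(2)[symmetric]) auto
    also have "\<dots> = 0"
      using zero by (intro integral_eq_zero_AE) auto
    finally show "expectation (\<lambda>\<omega>. (X \<omega> \<bullet> b) * (e k \<omega> \<bullet> b)) = 0" .
  qed
  have "expectation (\<lambda>\<omega>. X \<omega> \<bullet> e k \<omega>) = expectation (\<lambda>\<omega>. \<Sum>b\<in>Basis. (X \<omega> \<bullet> b) * (e k \<omega> \<bullet> b))"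
    by (subst euclidean_inner) simp
  also have "\<dots> = 0"
    using coord by (subst Bochner_Integration.integral_sum) auto
  finally show "expectation (\<lambda>\<omega>. X \<omega> \<bullet> e k \<omega>) = 0" .
qed

lemma square_integrable_step:
  assumes X: "X \<in> borel_measurable (F k)" and int: "integrable M (\<lambda>\<omega>. (norm (X \<omega>))\<^sup>2)"
  shows "integrable M (\<lambda>\<omega>. (norm (c *\<^sub>R X \<omega> + d *\<^sub>R e k \<omega>))\<^sup>2)"
proof -
  have "(norm (c *\<^sub>R X \<omega> + d *\<^sub>R e k \<omega>))\<^sup>2
      = c\<^sup>2 * (norm (X \<omega>))\<^sup>2 + d\<^sup>2 * (norm (e k \<omega>))\<^sup>2 + 2 * c * d * (X \<omega> \<bullet> e k \<omega>)" for \<omega>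
    by (rule norm_linear_combination_square)
  then show ?thesis
    using int e_square_integrable[of k] orthogonal(1)[OF X int] by simp
qed

text \<open>The event \<open>A\<close> serves the truncation in the maximal inequality. Absorbing
  its indicator into \<open>X\<close> keeps the factor \<open>F k\<close>-measurable, so the mixed
  term still has mean zero.\<close>

lemma second_moment_step:
  assumes X: "X \<in> borel_measurable (F k)" and int: "integrable M (\<lambda>\<omega>. (norm (X \<omega>))\<^sup>2)"
    and A: "A \<in> sets (F k)"
  shows "expectation (\<lambda>\<omega>. indicator A \<omega> * (norm (c *\<^sub>R X \<omega> + d *\<^sub>R e k \<omega>))\<^sup>2)
     \<le> c\<^sup>2 * expectation (\<lambda>\<omega>. indicator A \<omega> * (norm (X \<omega>))\<^sup>2) + d\<^sup>2 * \<sigma>\<^sup>2"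
proof -
  have [measurable]: "A \<in> sets M" using A by (rule F_sets)
  define Y where "Y \<omega> = indicator A \<omega> *\<^sub>R X \<omega>" for \<omega>
  have Y: "Y \<in> borel_measurable (F k)" unfolding Y_def using X A by measurable
  have normY: "(norm (Y \<omega>))\<^sup>2 = indicator A \<omega> * (norm (X \<omega>))\<^sup>2" for \<omega>
    by (simp add: Y_def indicator_def)
  have intA: "integrable M (\<lambda>\<omega>. indicator A \<omega> * Z \<omega>)" if "integrable M Z" for Z :: "'w \<Rightarrow> real"
    using integrable_mult_indicator[OF \<open>A \<in> sets M\<close> that] by simp
  have intY: "integrable M (\<lambda>\<omega>. (norm (Y \<omega>))\<^sup>2)"
    unfolding normY by (rule intA[OF int])
  have eq: "indicator A \<omega> * (norm (c *\<^sub>R X \<omega> + d *\<^sub>R e k \<omega>))\<^sup>2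
      = c\<^sup>2 * (indicator A \<omega> * (norm (X \<omega>))\<^sup>2) + d\<^sup>2 * (indicator A \<omega> * (norm (e k \<omega>))\<^sup>2)
        + 2 * c * d * (Y \<omega> \<bullet> e k \<omega>)" for \<omega>
    by (cases "\<omega> \<in> A") (simp_all add: Y_def norm_linear_combination_square)
  have "expectation (\<lambda>\<omega>. indicator A \<omega> * (norm (c *\<^sub>R X \<omega> + d *\<^sub>R e k \<omega>))\<^sup>2)
      = c\<^sup>2 * expectation (\<lambda>\<omega>. indicator A \<omega> * (norm (X \<omega>))\<^sup>2)
        + d\<^sup>2 * expectation (\<lambda>\<omega>. indicator A \<omega> * (norm (e k \<omega>))\<^sup>2)"
    unfolding eq using intA[OF int] intA[OF e_square_integrable[of k]] orthogonal[OF Y intY] by simp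
  moreover have "expectation (\<lambda>\<omega>. indicator A \<omega> * (norm (e k \<omega>))\<^sup>2) \<le> expectation (\<lambda>\<omega>. (norm (e k \<omega>))\<^sup>2)"
    by (intro integral_mono intA e_square_integrable) (simp add: indicator_def)
  ultimately show ?thesis
    using e_second_moment[of k] by (smt (verit) mult_left_mono zero_le_power2)
qed

definition filtered :: "(nat \<Rightarrow> real) \<Rightarrow> (nat \<Rightarrow> real) \<Rightarrow> nat \<Rightarrow> 'w \<Rightarrow> 'a" where
  "filtered q \<alpha> k \<omega> = filt q \<alpha> (\<lambda>j. e j \<omega>) k"

lemma filtered_simps:
  "filtered q \<alpha> 0 = (\<lambda>\<omega>. 0)"
  "filtered q \<alpha> (Suc k) = (\<lambda>\<omega>. (1 - q k) *\<^sub>R filtered q \<alpha> k \<omega> + \<alpha> k *\<^sub>R e k \<omega>)"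
  by (auto simp: filtered_def)

lemma filtered_measurable_F: "filtered q \<alpha> k \<in> borel_measurable (F k)"
proof (induction k)
  case (Suc k)
  from F_Suc[OF Suc] e_meas[of k] show ?case by (simp add: filtered_simps)
qed (simp add: filtered_simps)

lemma filtered_measurable [measurable]: "filtered q \<alpha> k \<in> borel_measurable M"
  using filtered_measurable_F by (rule F_measurable)

lemma filtered_square_integrable: "integrable M (\<lambda>\<omega>. (norm (filtered q \<alpha> k \<omega>))\<^sup>2)"
  by (induction k) (auto simp: filtered_simps intro: square_integrable_step filtered_measurable_F)

section \<open>Weighted second moments and a maximal inequality for the filter\<close>

context
  fixes q \<alpha> t :: "nat \<Rightarrow> real" and N :: nat
  assumes t_pos: "\<And>k. N \<le> k \<Longrightarrow> 0 < t k"
    and q: "\<And>k. N \<le> k \<Longrightarrow> 0 \<le> q k" "\<And>k. N \<le> k \<Longrightarrow> q k \<le> 1"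
    and t_ratio: "\<And>k. N \<le> k \<Longrightarrow> t (Suc k) \<le> (1 + q k) * t k"
    and sum: "summable (\<lambda>k. t (Suc k) * (\<alpha> k)\<^sup>2)"
begin

abbreviation "X \<equiv> filtered q \<alpha>"

text \<open>Initial weighted energy plus all noise ever injected. It bounds both the expected
  weighted sum and \<open>K\<close> times the probability of ever reaching level
  \<open>K\<close>.\<close>

definition "R = t N * expectation (\<lambda>\<omega>. (norm (X N \<omega>))\<^sup>2) + \<sigma>\<^sup>2 * (\<Sum>k. t (Suc (k + N)) * (\<alpha> (k + N))\<^sup>2)"

text \<open>Of the two factors \<open>1 - q k\<close> one compensates the growth of the weight,
  because \<open>(1 + q) * (1 - q) \<le> 1\<close>. The other is left over and yields the summable
  surplus \<open>q k * t k\<close> in \<open>expectation_sum_bound\<close>.\<close>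

lemma contraction: "N \<le> k \<Longrightarrow> t (Suc k) * (1 - q k)\<^sup>2 \<le> t k * (1 - q k)"
proof -
  assume k: "N \<le> k"
  have "t (Suc k) * (1 - q k)\<^sup>2 \<le> (1 + q k) * t k * (1 - q k)\<^sup>2"
    using t_ratio[OF k] by (rule mult_right_mono) simp
  also have "\<dots> = t k * (1 - q k) * (1 - (q k)\<^sup>2)"
    by (simp add: power2_eq_square algebra_simps)
  also have "\<dots> \<le> t k * (1 - q k) * 1"
    using t_pos[OF k] q[OF k] by (intro mult_left_mono) auto
  finally show ?thesis by simp
qed

lemma weighted_moment_step:
  assumes k: "N \<le> k" and A: "A \<in> sets (F k)"
  shows "t (Suc k) * expectation (\<lambda>\<omega>. indicator A \<omega> * (norm (X (Suc k) \<omega>))\<^sup>2)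
     \<le> t k * (1 - q k) * expectation (\<lambda>\<omega>. indicator A \<omega> * (norm (X k \<omega>))\<^sup>2) + \<sigma>\<^sup>2 * (t (Suc k) * (\<alpha> k)\<^sup>2)"
proof -
  let ?E = "expectation (\<lambda>\<omega>. indicator A \<omega> * (norm (X k \<omega>))\<^sup>2)"
  have "expectation (\<lambda>\<omega>. indicator A \<omega> * (norm (X (Suc k) \<omega>))\<^sup>2) \<le> (1 - q k)\<^sup>2 * ?E + (\<alpha> k)\<^sup>2 * \<sigma>\<^sup>2"
    using second_moment_step[OF filtered_measurable_F[of q \<alpha> k] filtered_square_integrable[of q \<alpha> k] A,
        of "1 - q k" "\<alpha> k"]
    by (simp add: filtered_simps)
  then have "t (Suc k) * expectation (\<lambda>\<omega>. indicator A \<omega> * (norm (X (Suc k) \<omega>))\<^sup>2)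
      \<le> t (Suc k) * ((1 - q k)\<^sup>2 * ?E + (\<alpha> k)\<^sup>2 * \<sigma>\<^sup>2)"
    using t_pos[of "Suc k"] k by (intro mult_left_mono) auto
  also have "\<dots> = t (Suc k) * (1 - q k)\<^sup>2 * ?E + \<sigma>\<^sup>2 * (t (Suc k) * (\<alpha> k)\<^sup>2)"
    by (simp add: algebra_simps)
  also have "\<dots> \<le> t k * (1 - q k) * ?E + \<sigma>\<^sup>2 * (t (Suc k) * (\<alpha> k)\<^sup>2)"
    using contraction[OF k] by (intro add_right_mono mult_right_mono integral_nonneg_AE) auto
  finally show ?thesis .
qed

lemma partial_noise_sum: "(\<Sum>k\<in>{N..<n}. t (Suc k) * (\<alpha> k)\<^sup>2) \<le> (\<Sum>k. t (Suc (k + N)) * (\<alpha> (k + N))\<^sup>2)"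
proof (cases "N \<le> n")
  case True
  have "(\<Sum>k\<in>{N..<n}. t (Suc k) * (\<alpha> k)\<^sup>2) = (\<Sum>k<n - N. t (Suc (k + N)) * (\<alpha> (k + N))\<^sup>2)"
    using True by (intro sum.reindex_bij_witness[of _ "\<lambda>k. k + N" "\<lambda>k. k - N"]) auto
  also have "\<dots> \<le> (\<Sum>k. t (Suc (k + N)) * (\<alpha> (k + N))\<^sup>2)"
    using t_pos summable_ignore_initial_segment[OF sum, of N]
    by (intro sum_le_suminf) (auto simp: less_imp_le)
  finally show ?thesis .
next
  case False
  then show ?thesis
    using t_pos summable_ignore_initial_segment[OF sum, of N]
    by (auto intro!: suminf_nonneg simp: less_imp_le)
qed

lemma expectation_sum_bound:
  assumes "N \<le> n"
  shows "(\<Sum>k\<in>{N..<n}. q k * t k * expectation (\<lambda>\<omega>. (norm (X k \<omega>))\<^sup>2)) \<le> R"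
proof -
  define m where "m k = expectation (\<lambda>\<omega>. (norm (X k \<omega>))\<^sup>2)" for k
  have step: "q k * t k * m k \<le> t k * m k - t (Suc k) * m (Suc k) + \<sigma>\<^sup>2 * (t (Suc k) * (\<alpha> k)\<^sup>2)"
    if "N \<le> k" for k
  proof -
    have eq: "expectation (\<lambda>\<omega>. indicator (space M) \<omega> * (norm (X j \<omega>))\<^sup>2) = m j" for j
      unfolding m_def by (intro Bochner_Integration.integral_cong) auto
    have "space M \<in> sets (F k)" using sets.top[of "F k"] by (simp add: space_F)
    then show ?thesis
      using weighted_moment_step[OF that, of "space M"] unfolding eq by (simp add: algebra_simps)
  qed
  have "(\<Sum>k\<in>{N..<n}. q k * t k * m k)
      \<le> t N * m N - t n * m n + \<sigma>\<^sup>2 * (\<Sum>k\<in>{N..<n}. t (Suc k) * (\<alpha> k)\<^sup>2)"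
    using assms
  proof (induction n rule: dec_induct)
    case (step n)
    then show ?case using assms(1) \<open>\<And>k. N \<le> k \<Longrightarrow> q k * t k * m k \<le> _ k\<close>[of n]
      by (simp add: sum.atLeastLessThan_Suc algebra_simps)
  qed simp
  moreover have "0 \<le> t n * m n" using t_pos[OF assms] by (simp add: m_def)
  moreover have "\<sigma>\<^sup>2 * (\<Sum>k\<in>{N..<n}. t (Suc k) * (\<alpha> k)\<^sup>2) \<le> \<sigma>\<^sup>2 * (\<Sum>k. t (Suc (k + N)) * (\<alpha> (k + N))\<^sup>2)"
    using partial_noise_sum by (rule mult_left_mono) simp
  ultimately show ?thesis by (simp add: R_def m_def)
qed

lemma AE_weighted_summable: "AE \<omega> in M. summable (\<lambda>k. q k * t k * (norm (X k \<omega>))\<^sup>2)"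
proof -
  \<comment> \<open>Shifted by \<open>N\<close>, since the signs of \<open>q\<close> and
    \<open>t\<close> are known only from \<open>N\<close> on.\<close>
  define f where "f k \<omega> = q (k + N) * t (k + N) * (norm (X (k + N) \<omega>))\<^sup>2" for k \<omega>
  have f_nonneg: "0 \<le> f k \<omega>" for k \<omega>
    using q t_pos by (simp add: f_def less_imp_le)
  have f_int: "integrable M (f k)" for k
    unfolding f_def[abs_def] using filtered_square_integrable by simp
  have [measurable]: "f k \<in> borel_measurable M" for k using f_int by auto
  have partial: "(\<Sum>k<n. expectation (f k)) \<le> R" for n
  proof -
    have "(\<Sum>k<n. expectation (f k)) = (\<Sum>k\<in>{N..<n + N}. q k * t k * expectation (\<lambda>\<omega>. (norm (X k \<omega>))\<^sup>2))"
      by (rule sum.reindex_bij_witness[of _ "\<lambda>k. k - N" "\<lambda>k. k + N"]) (auto simp: f_def[abs_def])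
    then show ?thesis using expectation_sum_bound[of "n + N"] by simp
  qed
  have "(\<integral>\<^sup>+ \<omega>. (\<Sum>k. ennreal (f k \<omega>)) \<partial>M) = (\<Sum>k. \<integral>\<^sup>+ \<omega>. ennreal (f k \<omega>) \<partial>M)"
    by (rule nn_integral_suminf) simp
  also have "\<dots> = (\<Sum>k. ennreal (expectation (f k)))"
    using f_int f_nonneg by (intro suminf_cong nn_integral_eq_integral) auto
  also have "\<dots> \<le> ennreal R"
  proof (rule suminf_le_const)
    show "(\<Sum>k<n. ennreal (expectation (f k))) \<le> ennreal R" for n
      using partial[of n] f_nonneg by (simp add: sum_ennreal ennreal_leI)
  qed simp
  finally have "(\<integral>\<^sup>+ \<omega>. (\<Sum>k. ennreal (f k \<omega>)) \<partial>M) \<noteq> \<infinity>"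
    by (auto simp: top_unique)
  then have "AE \<omega> in M. (\<Sum>k. ennreal (f k \<omega>)) \<noteq> \<infinity>"
    by (intro nn_integral_PInf_AE) auto
  then show ?thesis
  proof eventually_elim
    case (elim \<omega>)
    then have "summable (\<lambda>k. f k \<omega>)"
      using f_nonneg by (intro summable_suminf_not_top) auto
    then show ?case unfolding f_def by (subst (asm) summable_iff_shift)
  qed
qed

text \<open>The range is half-open: \<open>below K (Suc n)\<close> involves times up to
  \<open>n\<close> only, so it lies in \<open>F n\<close> and may serve as the truncating event of
  \<open>weighted_moment_step\<close>, and \<open>below K N\<close> is the whole space.\<close>

definition "below K n = {\<omega> \<in> space M. \<forall>j\<in>{N..<n}. t j * (norm (X j \<omega>))\<^sup>2 < K}"

lemma below_sets: "below K (Suc n) \<in> sets (F n)"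
proof -
  have "(\<lambda>\<omega>. t j * (norm (X j \<omega>))\<^sup>2) \<in> borel_measurable (F n)" if "j \<le> n" for j
    using F_mono[OF that filtered_measurable_F] by simp
  then have "{\<omega> \<in> space (F n). \<forall>j\<in>{N..<Suc n}. t j * (norm (X j \<omega>))\<^sup>2 < K} \<in> sets (F n)"
    by (intro sets.sets_Collect_finite_All) auto
  then show ?thesis by (simp add: below_def space_F)
qed

lemma below_measurable [measurable]: "below K n \<in> sets M"
  unfolding below_def by measurable

lemma below_antimono: "m \<le> n \<Longrightarrow> below K n \<subseteq> below K m"
  by (auto simp: below_def)

text \<open>A Doob-type stopping argument: \<open>I k\<close> is the weighted second moment over the
  paths that have not reached \<open>K\<close> before time \<open>k\<close>. Paths reaching it at
  time \<open>k\<close> leave this set and carry away at least \<open>K\<close> times their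
  probability, while \<open>I\<close> gains only the noise of that step; then telescope.\<close>

lemma maximal_inequality:
  assumes K: "0 < K" and n: "N \<le> n"
  shows "K * (1 - prob (below K n)) \<le> R"
proof -
  define I where "I k = t k * expectation (\<lambda>\<omega>. indicator (below K k) \<omega> * (norm (X k \<omega>))\<^sup>2)" for k
  have int: "integrable M (\<lambda>\<omega>. indicator (below K j) \<omega> * (norm (X k \<omega>))\<^sup>2)" for j k
    using integrable_mult_indicator[OF below_measurable filtered_square_integrable] by simp
  have step: "K * (prob (below K k) - prob (below K (Suc k))) \<le> I k - I (Suc k) + \<sigma>\<^sup>2 * (t (Suc k) * (\<alpha> k)\<^sup>2)"
    if k: "N \<le> k" for k
  proof -
    let ?A = "below K k - below K (Suc k)"
    have sub: "below K (Suc k) \<subseteq> below K k" by (rule below_antimono) simp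
    have "K * prob ?A + t k * expectation (\<lambda>\<omega>. indicator (below K (Suc k)) \<omega> * (norm (X k \<omega>))\<^sup>2)
        = expectation (\<lambda>\<omega>. K * indicator ?A \<omega> + t k * (indicator (below K (Suc k)) \<omega> * (norm (X k \<omega>))\<^sup>2))"
      using int by (simp add: emeasure_eq_measure)
    also have "\<dots> \<le> expectation (\<lambda>\<omega>. t k * (indicator (below K k) \<omega> * (norm (X k \<omega>))\<^sup>2))"
    proof (intro integral_mono)
      fix \<omega> assume "\<omega> \<in> space M"
      show "K * indicator ?A \<omega> + t k * (indicator (below K (Suc k)) \<omega> * (norm (X k \<omega>))\<^sup>2)
          \<le> t k * (indicator (below K k) \<omega> * (norm (X k \<omega>))\<^sup>2)"
      proof -
        have "\<omega> \<in> below K (Suc k) \<longleftrightarrow> \<omega> \<in> below K k \<and> t k * (norm (X k \<omega>))\<^sup>2 < K"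
          using k by (auto simp: below_def less_Suc_eq)
        then show ?thesis
          using t_pos[OF k] by (auto simp: indicator_def)
      qed
    qed (use int in \<open>auto simp: emeasure_eq_measure\<close>)
    also have "\<dots> = I k" by (simp add: I_def)
    finally have 1: "K * prob ?A + t k * expectation (\<lambda>\<omega>. indicator (below K (Suc k)) \<omega> * (norm (X k \<omega>))\<^sup>2) \<le> I k" .
    let ?E = "expectation (\<lambda>\<omega>. indicator (below K (Suc k)) \<omega> * (norm (X k \<omega>))\<^sup>2)"
    have "I (Suc k) \<le> t k * (1 - q k) * ?E + \<sigma>\<^sup>2 * (t (Suc k) * (\<alpha> k)\<^sup>2)"
      unfolding I_def by (rule weighted_moment_step[OF k below_sets])
    moreover have "t k * (1 - q k) * ?E \<le> t k * 1 * ?E"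
      using q[OF k] t_pos[OF k] by (intro mult_right_mono mult_left_mono integral_nonneg_AE) auto
    moreover have "prob ?A = prob (below K k) - prob (below K (Suc k))"
      using sub by (intro finite_measure_Diff) auto
    ultimately show ?thesis using 1 by simp
  qed
  have "K * (prob (below K N) - prob (below K n)) \<le> I N - I n + \<sigma>\<^sup>2 * (\<Sum>k\<in>{N..<n}. t (Suc k) * (\<alpha> k)\<^sup>2)"
    using n
  proof (induction n rule: dec_induct)
    case (step n)
    then show ?case
      using \<open>\<And>k. N \<le> k \<Longrightarrow> K * (prob (below K k) - prob (below K (Suc k))) \<le> _ k\<close>[of n]
      by (simp add: sum.atLeastLessThan_Suc algebra_simps)
  qed simp
  moreover have "below K N = space M" by (simp add: below_def)
  moreover have "I N = t N * expectation (\<lambda>\<omega>. (norm (X N \<omega>))\<^sup>2)"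
    unfolding I_def \<open>below K N = space M\<close>
    by (intro arg_cong[where f = "\<lambda>x. t N * x"] Bochner_Integration.integral_cong) auto
  moreover have "0 \<le> I n"
    unfolding I_def using t_pos[OF n] by (intro mult_nonneg_nonneg integral_nonneg_AE) auto
  moreover have "\<sigma>\<^sup>2 * (\<Sum>k\<in>{N..<n}. t (Suc k) * (\<alpha> k)\<^sup>2) \<le> \<sigma>\<^sup>2 * (\<Sum>k. t (Suc (k + N)) * (\<alpha> (k + N))\<^sup>2)"
    using partial_noise_sum by (rule mult_left_mono) simp
  ultimately show ?thesis by (simp add: R_def prob_space)
qed

text \<open>An unbounded path leaves \<open>below K\<close> for every integer \<open>K\<close>,
  which by the maximal inequality has probability at most \<open>R / K\<close>.\<close>

lemma AE_weighted_bounded: "AE \<omega> in M. \<exists>K. \<forall>k\<ge>N. t k * (norm (X k \<omega>))\<^sup>2 \<le> K"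
proof -
  define Bad where "Bad = {\<omega> \<in> space M. \<forall>i. \<exists>k\<ge>N. real (Suc i) \<le> t k * (norm (X k \<omega>))\<^sup>2}"
  have [measurable]: "Bad \<in> sets M" unfolding Bad_def by measurable
  have bound: "prob Bad \<le> R / real (Suc i)" for i
  proof -
    have lim: "(\<lambda>n. prob (below (real (Suc i)) n)) \<longlonglongrightarrow> prob (\<Inter>n. below (real (Suc i)) n)"
      by (rule finite_Lim_measure_decseq) (auto simp: decseq_def intro!: below_antimono)
    have "1 - R / real (Suc i) \<le> prob (\<Inter>n. below (real (Suc i)) n)"
    proof (rule LIMSEQ_le_const[OF lim], intro exI allI impI)
      fix n assume "N \<le> n"
      then show "1 - R / real (Suc i) \<le> prob (below (real (Suc i)) n)"
        using maximal_inequality[of "real (Suc i)" n] by (simp add: field_simps)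
    qed
    moreover have "prob Bad \<le> prob (space M - (\<Inter>n. below (real (Suc i)) n))"
    proof (rule finite_measure_mono)
      show "Bad \<subseteq> space M - (\<Inter>n. below (real (Suc i)) n)"
      proof
        fix \<omega> assume \<omega>: "\<omega> \<in> Bad"
        then obtain k where "k \<ge> N" "real (Suc i) \<le> t k * (norm (X k \<omega>))\<^sup>2"
          unfolding Bad_def by blast
        then have "\<omega> \<notin> below (real (Suc i)) (Suc k)"
          by (auto simp: below_def intro!: bexI[of _ k])
        then show "\<omega> \<in> space M - (\<Inter>n. below (real (Suc i)) n)"
          using \<omega> by (auto simp: Bad_def)
      qed
    qed auto
    moreover have "prob (space M - (\<Inter>n. below (real (Suc i)) n)) = 1 - prob (\<Inter>n. below (real (Suc i)) n)"
      by (rule prob_compl) auto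
    ultimately show ?thesis by simp
  qed
  have "(\<lambda>i. R / real (Suc i)) \<longlonglongrightarrow> 0"
    using LIMSEQ_Suc[OF lim_const_over_n[of R]] by simp
  then have "prob Bad \<le> 0"
    using bound by (intro LIMSEQ_le_const) auto
  then have "Bad \<in> null_sets M"
    by (intro null_setsI) (auto simp: emeasure_eq_measure measure_le_0_iff)
  then have "AE \<omega> in M. \<omega> \<notin> Bad" by (rule AE_not_in)
  then show ?thesis
  proof (rule AE_mp, intro AE_I2 impI)
    fix \<omega> assume "\<omega> \<in> space M" "\<omega> \<notin> Bad"
    then obtain i where "\<not> (\<exists>k\<ge>N. real (Suc i) \<le> t k * (norm (X k \<omega>))\<^sup>2)"
      unfolding Bad_def by blast
    then show "\<exists>K. \<forall>k\<ge>N. t k * (norm (X k \<omega>))\<^sup>2 \<le> K"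
      by (intro exI[of _ "real (Suc i)"]) (meson linear)
  qed
qed

end

end

section \<open>Step sizes and weights\<close>

text \<open>The terms are comparable to the decrements of \<open>ln powr - \<epsilon>\<close>, the
  antiderivative up to a constant, and these telescope. The term for \<open>k = 0\<close> is 0
  because division by zero gives 0.\<close>

lemma summable_inverse_ln_powr:
  assumes "0 < (\<epsilon>::real)"
  shows "summable (\<lambda>k. 1 / (real (Suc k) * ln (real (Suc k)) powr (1 + \<epsilon>)))"
proof (rule summable_comparison_test_bigo)
  have "(\<lambda>k. ln (real (Suc k)) powr - \<epsilon>) \<longlonglongrightarrow> 0"
    using assms by real_asymp
  from telescope_summable'[OF this]
  have "summable (\<lambda>k. ln (real (Suc k)) powr - \<epsilon> - ln (real (Suc (Suc k))) powr - \<epsilon>)" .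
  moreover have "\<forall>\<^sub>F k in sequentially. 0 \<le> ln (real (Suc k)) powr - \<epsilon> - ln (real (Suc (Suc k))) powr - \<epsilon>"
    using eventually_ge_at_top[of 1]
  proof eventually_elim
    case (elim k)
    then have "ln (real (Suc (Suc k))) powr - \<epsilon> \<le> ln (real (Suc k)) powr - \<epsilon>"
      using assms by (intro powr_mono2') auto
    then show ?case by simp
  qed
  ultimately show "summable (\<lambda>k. norm (ln (real (Suc k)) powr - \<epsilon> - ln (real (Suc (Suc k))) powr - \<epsilon>))"
    by (subst summable_cong) (auto elim: eventually_mono)
  show "(\<lambda>k. 1 / (real (Suc k) * ln (real (Suc k)) powr (1 + \<epsilon>)))
    \<in> O(\<lambda>k. ln (real (Suc k)) powr - \<epsilon> - ln (real (Suc (Suc k))) powr - \<epsilon>)"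
    using assms by real_asymp
qed

text \<open>Supplies the length potential for \<open>\<gamma> = 1\<close>,
  \<open>\<theta> = 1 / 2\<close>. The negative derivative is the function divided by its argument
  times \<open>1 / 2 - b / ln\<close>, which eventually exceeds 1/4 with room for the unit
  shift.\<close>

lemma ln_powr_div_sqrt_diff:
  assumes "0 < (b::real)"
  shows "\<forall>\<^sub>F k in sequentially. 1 / 4 * (ln (real (Suc k)) powr b * real (Suc k) powr (- (1 / 2)) / real (Suc k))
    \<le> ln (real (Suc k)) powr b * real (Suc k) powr (- (1 / 2))
      - ln (real (Suc (Suc k))) powr b * real (Suc (Suc k)) powr (- (1 / 2))"
  using assms by real_asymp

text \<open>The mean value theorem with an intermediate point below
  \<open>x + 1 \<le> 2 * x\<close>, whence the power of 2. It supplies the length potential for pure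
  power weights.\<close>

lemma powr_minus_diff_ge:
  assumes "1 \<le> (x::real)" "0 < r"
  shows "r * 2 powr (- r - 1) * x powr (- r - 1) \<le> x powr - r - (x + 1) powr - r"
proof -
  have "\<exists>y>x. y < x + 1 \<and> (x + 1) powr - r - x powr - r = (x + 1 - x) * (- r * y powr (- r - 1))"
    using assms by (intro MVT2) (auto intro!: derivative_eq_intros)
  then obtain y where y: "x < y" "y < x + 1" "x powr - r - (x + 1) powr - r = r * y powr (- r - 1)"
    by fastforce
  have "(2 * x) powr (- r - 1) \<le> y powr (- r - 1)"
    using y assms by (intro powr_mono2') auto
  then have "r * (2 powr (- r - 1) * x powr (- r - 1)) \<le> r * y powr (- r - 1)"
    using assms by (intro mult_left_mono) (auto simp: powr_mult)
  then show ?thesis using y by simp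
qed

text \<open>With squared steps of order \<open>k powr (- 2 * \<gamma>)\<close> the product has order
  \<open>1 / (k * ln k powr (1 + \<epsilon>))\<close>, just summable. At \<open>k = 0\<close> the
  logarithm vanishes and the division makes the weight 0, so it is positive only from 1 on.\<close>

definition log_weight :: "real \<Rightarrow> real \<Rightarrow> nat \<Rightarrow> real" where
  "log_weight \<gamma> \<epsilon> k = real (Suc k) powr (2 * \<gamma> - 1) / ln (real (Suc k)) powr (1 + \<epsilon>)"

lemma log_weight_pos: "1 \<le> k \<Longrightarrow> 0 < log_weight \<gamma> \<epsilon> k"
  by (simp add: log_weight_def)

text \<open>The power has exponent at most 1 and the logarithm in the denominator only helps. This
  growth is the reason why filter rates are required to be at least
  \<open>1 / real (Suc k)\<close>.\<close>

lemma log_weight_ratio: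
  assumes "1 \<le> k" "1 / 2 \<le> \<gamma>" "\<gamma> \<le> 1" "0 \<le> \<epsilon>"
  shows "log_weight \<gamma> \<epsilon> (Suc k) \<le> (1 + 1 / real (Suc k)) * log_weight \<gamma> \<epsilon> k"
proof -
  have eq: "real (Suc (Suc k)) = (1 + 1 / real (Suc k)) * real (Suc k)"
    by (simp add: field_simps)
  have "(1 + 1 / real (Suc k)) powr (2 * \<gamma> - 1) \<le> (1 + 1 / real (Suc k)) powr 1"
    using assms by (intro powr_mono) auto
  then have "(1 + 1 / real (Suc k)) powr (2 * \<gamma> - 1) * real (Suc k) powr (2 * \<gamma> - 1)
     \<le> (1 + 1 / real (Suc k)) * real (Suc k) powr (2 * \<gamma> - 1)"
    by (intro mult_right_mono) (auto simp: add_nonneg_nonneg)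
  then have "real (Suc (Suc k)) powr (2 * \<gamma> - 1) \<le> (1 + 1 / real (Suc k)) * real (Suc k) powr (2 * \<gamma> - 1)"
    unfolding eq by (subst powr_mult) (auto simp: add_nonneg_nonneg)
  moreover have "ln (real (Suc k)) powr (1 + \<epsilon>) \<le> ln (real (Suc (Suc k))) powr (1 + \<epsilon>)"
    using assms by (intro powr_mono2) auto
  moreover have "0 < ln (real (Suc k)) powr (1 + \<epsilon>)"
    using assms by simp
  ultimately have "log_weight \<gamma> \<epsilon> (Suc k) \<le>
      ((1 + 1 / real (Suc k)) * real (Suc k) powr (2 * \<gamma> - 1)) / ln (real (Suc k)) powr (1 + \<epsilon>)"
    unfolding log_weight_def by (intro frac_le) (auto simp: add_nonneg_nonneg)
  then show ?thesis by (simp add: log_weight_def)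
qed

lemma log_weight_ge_powr:
  assumes "0 < p"
  shows "\<forall>\<^sub>F k in sequentially. real (Suc k) powr (2 * \<gamma> - 1 - p) \<le> log_weight \<gamma> \<epsilon> k"
proof -
  have "\<forall>\<^sub>F k in sequentially. ln (real (Suc k)) powr (1 + \<epsilon>) \<le> real (Suc k) powr p"
    using assms by real_asymp
  then show ?thesis
    using eventually_ge_at_top[of 1]
  proof eventually_elim
    case (elim k)
    have "real (Suc k) powr (2 * \<gamma> - 1 - p) * ln (real (Suc k)) powr (1 + \<epsilon>)
        \<le> real (Suc k) powr (2 * \<gamma> - 1 - p) * real (Suc k) powr p"
      using elim by (intro mult_left_mono) auto
    also have "\<dots> = real (Suc k) powr (2 * \<gamma> - 1)"
      by (simp flip: powr_add)
    finally show ?case using elim by (simp add: log_weight_def field_simps)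
  qed
qed

text \<open>Shifted by one: \<open>step_seq \<alpha> \<beta> \<gamma> k\<close> is the step of the
  method with index \<open>Suc k\<close>, the first one used having index 1.\<close>

definition step_seq :: "real \<Rightarrow> real \<Rightarrow> real \<Rightarrow> nat \<Rightarrow> real" where
  "step_seq \<alpha> \<beta> \<gamma> k = \<alpha> / (real (Suc k) + \<beta>) powr \<gamma>"

text \<open>Up to the cap at 1 this is 2 over the power of the shifted index. The factor 2 gives
  \<open>1 / real (Suc k) \<le> gain \<alpha> \<beta> \<gamma> k\<close> even for
  \<open>\<gamma> = 1\<close> as soon as \<open>\<beta> \<le> real (Suc k)\<close>.\<close>

definition gain :: "real \<Rightarrow> real \<Rightarrow> real \<Rightarrow> nat \<Rightarrow> real" where
  "gain \<alpha> \<beta> \<gamma> k = min 1 (2 / \<alpha> * step_seq \<alpha> \<beta> \<gamma> k)"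

context
  fixes \<alpha> \<beta> \<gamma> :: real
  assumes \<alpha>: "0 < \<alpha>" and \<beta>: "0 \<le> \<beta>" and \<gamma>: "2 / 3 < \<gamma>" "\<gamma> \<le> 1"
begin

lemma step_seq_pos: "0 < step_seq \<alpha> \<beta> \<gamma> k"
  using \<alpha> \<beta> by (simp add: step_seq_def add_pos_nonneg)

lemma step_seq_le: "step_seq \<alpha> \<beta> \<gamma> k \<le> \<alpha> * real (Suc k) powr - \<gamma>"
proof -
  have "(real (Suc k) + \<beta>) powr - \<gamma> \<le> real (Suc k) powr - \<gamma>"
    using \<beta> \<gamma> by (intro powr_mono2') auto
  then show ?thesis
    using \<alpha> by (simp add: step_seq_def powr_minus_divide divide_inverse)
qed

lemma step_seq_le_alpha: "step_seq \<alpha> \<beta> \<gamma> k \<le> \<alpha>"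
proof -
  have "real (Suc k) powr - \<gamma> \<le> real (Suc k) powr 0"
    using \<gamma> by (intro powr_mono) auto
  then have "\<alpha> * real (Suc k) powr - \<gamma> \<le> \<alpha> * 1"
    using \<alpha> by (intro mult_left_mono) auto
  then show ?thesis using step_seq_le[of k] by linarith
qed

lemma step_seq_ge_powr: "\<alpha> / (1 + \<beta>) * real (Suc k) powr - \<gamma> \<le> step_seq \<alpha> \<beta> \<gamma> k"
proof -
  have "(real (Suc k) + \<beta>) powr \<gamma> \<le> ((1 + \<beta>) * real (Suc k)) powr \<gamma>"
    using \<beta> \<gamma> by (intro powr_mono2) (auto simp: algebra_simps)
  also have "\<dots> = (1 + \<beta>) powr \<gamma> * real (Suc k) powr \<gamma>"
    using \<beta> by (simp add: powr_mult)
  also have "\<dots> \<le> (1 + \<beta>) powr 1 * real (Suc k) powr \<gamma>"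
    using \<beta> \<gamma> by (intro mult_right_mono powr_mono) auto
  finally have "(real (Suc k) + \<beta>) powr \<gamma> \<le> (1 + \<beta>) * real (Suc k) powr \<gamma>"
    using \<beta> by simp
  then have "\<alpha> / ((1 + \<beta>) * real (Suc k) powr \<gamma>) \<le> \<alpha> / (real (Suc k) + \<beta>) powr \<gamma>"
    using \<alpha> \<beta> by (intro divide_left_mono) (auto simp: add_pos_nonneg)
  then show ?thesis
    by (simp add: step_seq_def powr_minus_divide)
qed

lemma step_seq_ge: "\<alpha> / (1 + \<beta>) / real (Suc k) \<le> step_seq \<alpha> \<beta> \<gamma> k"
proof -
  have "real (Suc k) powr - 1 \<le> real (Suc k) powr - \<gamma>"
    using \<gamma> by (intro powr_mono) auto
  then have "\<alpha> / (1 + \<beta>) * real (Suc k) powr - 1 \<le> \<alpha> / (1 + \<beta>) * real (Suc k) powr - \<gamma>"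
    using \<alpha> \<beta> by (intro mult_left_mono) auto
  then show ?thesis
    using step_seq_ge_powr[of k] by (simp add: powr_minus_divide)
qed

lemma step_seq_lim: "step_seq \<alpha> \<beta> \<gamma> \<longlonglongrightarrow> 0"
proof (rule tendsto_sandwich[OF _ _ tendsto_const])
  show "(\<lambda>k. \<alpha> * real (Suc k) powr - \<gamma>) \<longlonglongrightarrow> 0"
    using \<gamma> by real_asymp
qed (use step_seq_pos step_seq_le in \<open>auto simp: less_imp_le\<close>)

lemma step_seq_not_summable: "\<not> summable (step_seq \<alpha> \<beta> \<gamma>)"
proof
  assume "summable (step_seq \<alpha> \<beta> \<gamma>)"
  then have "summable (\<lambda>k. \<alpha> / (1 + \<beta>) / real (Suc k))"
  proof (rule summable_comparison_test')
    show "norm (\<alpha> / (1 + \<beta>) / real (Suc k)) \<le> step_seq \<alpha> \<beta> \<gamma> k" if "0 \<le> k" for k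
    proof -
      have "0 \<le> \<alpha> / (1 + \<beta>) / real (Suc k)" using \<alpha> \<beta> by simp
      then show ?thesis using step_seq_ge[of k] by (simp only: real_norm_def abs_of_nonneg)
    qed
  qed
  then have "summable (\<lambda>k. (1 + \<beta>) / \<alpha> * (\<alpha> / (1 + \<beta>) / real (Suc k)))"
    by (rule summable_mult)
  then have "summable (\<lambda>k. inverse (real (Suc k)))"
    using \<alpha> \<beta> by (simp add: divide_inverse)
  then show False
    using not_summable_harmonic[where 'a = real] summable_Suc_iff[of "\<lambda>k. inverse (real k)"] by simp
qed

lemma gain_bounds: "0 \<le> gain \<alpha> \<beta> \<gamma> k" "gain \<alpha> \<beta> \<gamma> k \<le> 1"
  "gain \<alpha> \<beta> \<gamma> k \<le> 2 / \<alpha> * step_seq \<alpha> \<beta> \<gamma> k"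
  "step_seq \<alpha> \<beta> \<gamma> k \<le> \<alpha> * gain \<alpha> \<beta> \<gamma> k"
  using \<alpha> step_seq_pos[of k] step_seq_le_alpha[of k] by (auto simp: gain_def min_def field_simps)

lemma gain_ge: "\<forall>\<^sub>F k in sequentially. 1 / real (Suc k) \<le> gain \<alpha> \<beta> \<gamma> k"
proof -
  have "\<forall>\<^sub>F k in sequentially. \<beta> \<le> real (Suc k)" by real_asymp
  then show ?thesis
  proof eventually_elim
    case (elim k)
    have "(real (Suc k) + \<beta>) powr \<gamma> \<le> (real (Suc k) + \<beta>) powr 1"
      using \<beta> \<gamma> by (intro powr_mono) auto
    also have "\<dots> \<le> 2 * real (Suc k)" using elim \<beta> by simp
    finally have "2 / (2 * real (Suc k)) \<le> 2 / (real (Suc k) + \<beta>) powr \<gamma>"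
      using \<beta> by (intro divide_left_mono) (auto simp: add_pos_nonneg)
    moreover have "1 / real (Suc k) = 2 / (2 * real (Suc k))" by (simp del: of_nat_Suc)
    moreover have "2 / \<alpha> * step_seq \<alpha> \<beta> \<gamma> k = 2 / (real (Suc k) + \<beta>) powr \<gamma>"
      using \<alpha> by (simp add: step_seq_def)
    moreover have "1 / real (Suc k) \<le> 1" by simp
    ultimately show ?case by (simp only: gain_def min.bounded_iff)
  qed
qed

lemma log_weight_step_summable:
  assumes "0 < \<epsilon>"
  shows "summable (\<lambda>k. log_weight \<gamma> \<epsilon> (Suc k) * (step_seq \<alpha> \<beta> \<gamma> k)\<^sup>2)"
proof (rule summable_comparison_test_ev)
  show "summable (\<lambda>k. 2 * \<alpha>\<^sup>2 * (1 / (real (Suc k) * ln (real (Suc k)) powr (1 + \<epsilon>))))"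
    by (intro summable_mult summable_inverse_ln_powr assms)
  show "\<forall>\<^sub>F k in sequentially. norm (log_weight \<gamma> \<epsilon> (Suc k) * (step_seq \<alpha> \<beta> \<gamma> k)\<^sup>2)
      \<le> 2 * \<alpha>\<^sup>2 * (1 / (real (Suc k) * ln (real (Suc k)) powr (1 + \<epsilon>)))"
    using eventually_ge_at_top[of 1]
  proof eventually_elim
    case (elim k)
    have "log_weight \<gamma> \<epsilon> (Suc k) \<le> (1 + 1 / real (Suc k)) * log_weight \<gamma> \<epsilon> k"
      using elim \<gamma> assms by (intro log_weight_ratio) auto
    also have "\<dots> \<le> 2 * log_weight \<gamma> \<epsilon> k"
      using log_weight_pos[OF elim] by (intro mult_right_mono) (auto simp: less_imp_le)
    finally have "log_weight \<gamma> \<epsilon> (Suc k) * (step_seq \<alpha> \<beta> \<gamma> k)\<^sup>2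
        \<le> 2 * log_weight \<gamma> \<epsilon> k * (\<alpha> * real (Suc k) powr - \<gamma>)\<^sup>2"
      using step_seq_le[of k] step_seq_pos[of k] log_weight_pos[OF elim, of \<gamma> \<epsilon>]
      by (intro mult_mono power_mono) auto
    also have "\<dots> = 2 * \<alpha>\<^sup>2 * (real (Suc k) powr (2 * \<gamma> - 1) * real (Suc k) powr (- (2 * \<gamma>)) / ln (real (Suc k)) powr (1 + \<epsilon>))"
    proof -
      have "(real (Suc k) powr - \<gamma>)\<^sup>2 = real (Suc k) powr (- (2 * \<gamma>))"
        by (simp add: power2_eq_square flip: powr_add)
      then show ?thesis by (simp only: log_weight_def power_mult_distrib) simp
    qed
    also have "real (Suc k) powr (2 * \<gamma> - 1) * real (Suc k) powr (- (2 * \<gamma>)) = 1 / real (Suc k)"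
    proof -
      have "real (Suc k) powr (2 * \<gamma> - 1) * real (Suc k) powr (- (2 * \<gamma>)) = real (Suc k) powr - 1"
        by (simp flip: powr_add)
      then show ?thesis by (simp add: powr_minus_divide)
    qed
    finally show ?case
      using log_weight_pos[of "Suc k" \<gamma> \<epsilon>] by (simp add: abs_of_nonneg less_imp_le)
  qed
qed

end

context martingale_errors
begin

text \<open>Stated for a general rate \<open>q\<close>, because two filters are needed: one
  forgetting at the speed of the steps (\<open>gain\<close>) and one at the constant rate
  \<open>1 - lam\<close>.\<close>

lemma AE_filter_rates:
  fixes q :: "nat \<Rightarrow> real"
  assumes "0 < \<alpha>" "0 \<le> \<beta>" "2 / 3 < \<gamma>" "\<gamma> \<le> 1" "0 < \<epsilon>"
    and q: "\<And>k. 0 \<le> q k" "\<And>k. q k \<le> 1" "\<forall>\<^sub>F k in sequentially. 1 / real (Suc k) \<le> q k"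
    and c: "\<And>k. step_seq \<alpha> \<beta> \<gamma> k \<le> c * q k"
  defines "Y \<equiv> \<lambda>k \<omega>. (norm (filt q (step_seq \<alpha> \<beta> \<gamma>) (\<lambda>j. e j \<omega>) k))\<^sup>2"
  shows "AE \<omega> in M. summable (\<lambda>k. log_weight \<gamma> \<epsilon> k * (step_seq \<alpha> \<beta> \<gamma> k * Y k \<omega>))"
    and "AE \<omega> in M. \<exists>K. \<forall>\<^sub>F k in sequentially. log_weight \<gamma> \<epsilon> k * Y k \<omega> \<le> K"
proof -
  obtain N where N: "1 \<le> N" "\<And>k. N \<le> k \<Longrightarrow> 1 / real (Suc k) \<le> q k"
    using eventually_conj[OF q(3) eventually_ge_at_top[of 1]] unfolding eventually_sequentially
    by (metis order.trans nle_le)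
  have pos: "0 < log_weight \<gamma> \<epsilon> k" if "N \<le> k" for k
    using N that by (intro log_weight_pos) auto
  have ratio: "log_weight \<gamma> \<epsilon> (Suc k) \<le> (1 + q k) * log_weight \<gamma> \<epsilon> k" if "N \<le> k" for k
  proof -
    have "log_weight \<gamma> \<epsilon> (Suc k) \<le> (1 + 1 / real (Suc k)) * log_weight \<gamma> \<epsilon> k"
      using N that assms by (intro log_weight_ratio) auto
    also have "\<dots> \<le> (1 + q k) * log_weight \<gamma> \<epsilon> k"
      using N pos that by (intro mult_right_mono) (auto simp: less_imp_le)
    finally show ?thesis .
  qed
  have q1: "0 \<le> q k" and q2: "q k \<le> 1" if "N \<le> k" for k
    using q by auto
  note sum = log_weight_step_summable[OF assms(1-5)]
  have "AE \<omega> in M. summable (\<lambda>k. q k * log_weight \<gamma> \<epsilon> k * Y k \<omega>)"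
    using AE_weighted_summable[of N "log_weight \<gamma> \<epsilon>" q, OF pos q1 q2 ratio sum]
    unfolding filtered_def Y_def by simp
  then show "AE \<omega> in M. summable (\<lambda>k. log_weight \<gamma> \<epsilon> k * (step_seq \<alpha> \<beta> \<gamma> k * Y k \<omega>))"
  proof eventually_elim
    case (elim \<omega>)
    show ?case
    proof (rule summable_comparison_test_ev[OF _ summable_mult[OF elim, of c]])
      show "\<forall>\<^sub>F k in sequentially. norm (log_weight \<gamma> \<epsilon> k * (step_seq \<alpha> \<beta> \<gamma> k * Y k \<omega>))
          \<le> c * (q k * log_weight \<gamma> \<epsilon> k * Y k \<omega>)"
        using eventually_ge_at_top[of N]
      proof eventually_elim
        case (elim k)
        have "0 \<le> Y k \<omega>" "0 < step_seq \<alpha> \<beta> \<gamma> k"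
          using step_seq_pos[OF assms(1-4)] by (auto simp: Y_def)
        then have "norm (log_weight \<gamma> \<epsilon> k * (step_seq \<alpha> \<beta> \<gamma> k * Y k \<omega>))
            = (log_weight \<gamma> \<epsilon> k * Y k \<omega>) * step_seq \<alpha> \<beta> \<gamma> k"
          using pos[OF elim] by simp
        also have "\<dots> \<le> (log_weight \<gamma> \<epsilon> k * Y k \<omega>) * (c * q k)"
          using c pos[OF elim] \<open>0 \<le> Y k \<omega>\<close> by (intro mult_left_mono) auto
        finally show ?case by (simp add: mult_ac)
      qed
    qed
  qed
  have "AE \<omega> in M. \<exists>K. \<forall>k\<ge>N. log_weight \<gamma> \<epsilon> k * Y k \<omega> \<le> K"
    using AE_weighted_bounded[of N "log_weight \<gamma> \<epsilon>" q, OF pos q1 q2 ratio sum]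
    unfolding filtered_def Y_def by simp
  then show "AE \<omega> in M. \<exists>K. \<forall>\<^sub>F k in sequentially. log_weight \<gamma> \<epsilon> k * Y k \<omega> \<le> K"
    by eventually_elim (auto simp: eventually_sequentially)
qed

end

section \<open>Paths of the stochastic gradient method with momentum\<close>

text \<open>Where the function difference is below 1, a larger exponent gives a smaller power; hence
  the minimum with 1 in the witness for \<eta>.\<close>

lemma lojasiewicz_exponent_local:
  assumes loja: "lojasiewicz_exponent f zs \<theta>" and th: "\<theta> \<le> \<theta>'" "\<theta>' < 1"
  obtains C \<delta> \<eta> :: real where "0 < C" "0 < \<delta>" "0 < \<eta>"
    "\<And>y. norm (y - zs) < \<delta> \<Longrightarrow> \<bar>f y - f zs\<bar> < \<eta> \<Longrightarrow> C * \<bar>f y - f zs\<bar> powr \<theta>' \<le> norm (grad f y)"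
proof -
  obtain \<eta> :: ereal and U C where U: "0 < \<eta>" "open U" "zs \<in> U" "0 < C"
    and le: "\<And>y. y \<in> U \<Longrightarrow> 0 < \<bar>f y - f zs\<bar> \<Longrightarrow> ereal \<bar>f y - f zs\<bar> < \<eta> \<Longrightarrow>
      C * \<bar>f y - f zs\<bar> powr \<theta> \<le> norm (grad f y)"
    using loja unfolding lojasiewicz_exponent_def by metis
  have th2: "1 / 2 \<le> \<theta>" using loja by (simp add: lojasiewicz_exponent_def)
  obtain \<delta> where \<delta>: "0 < \<delta>" "\<And>y. dist y zs < \<delta> \<Longrightarrow> y \<in> U"
    using U unfolding open_dist by metis
  obtain \<eta>' :: real where \<eta>': "0 < \<eta>'" "ereal \<eta>' < \<eta>"
    using ereal_dense2[OF U(1)] by auto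
  show thesis
  proof (rule that[of C \<delta> "min 1 \<eta>'"])
    fix y assume y: "norm (y - zs) < \<delta>" "\<bar>f y - f zs\<bar> < min 1 \<eta>'"
    show "C * \<bar>f y - f zs\<bar> powr \<theta>' \<le> norm (grad f y)"
    proof (cases "f y = f zs")
      case False
      have "ereal \<bar>f y - f zs\<bar> < \<eta>"
        using y \<eta>' by (auto intro: less_trans[of _ "ereal \<eta>'"])
      then have "C * \<bar>f y - f zs\<bar> powr \<theta> \<le> norm (grad f y)"
        using False y by (intro le \<delta>) (auto simp: dist_norm)
      moreover have "\<bar>f y - f zs\<bar> powr \<theta>' \<le> \<bar>f y - f zs\<bar> powr \<theta>"
        using th y False by (intro powr_mono') auto
      then have "C * \<bar>f y - f zs\<bar> powr \<theta>' \<le> C * \<bar>f y - f zs\<bar> powr \<theta>"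
        using U by (intro mult_left_mono) auto
      ultimately show ?thesis by linarith
    qed simp
  qed (use U \<delta> \<eta>' in auto)
qed

text \<open>Restrict to the diagonal: there the quadratic term and its derivative vanish, so the
  merit function reduces to \<open>f\<close> and its gradient to \<open>(0, grad f y)\<close>, and
  \<open>C\<close> becomes a constant for \<open>f\<close> itself.\<close>

lemma merit_lojasiewicz_constant_local:
  fixes f :: "'a::euclidean_space \<Rightarrow> real"
  assumes diff: "\<And>y. f differentiable (at y)"
    and mer: "merit_lojasiewicz_constant f L lam zs \<theta> C"
  obtains \<delta> \<eta> :: real where "0 < C" "0 < \<delta>" "0 < \<eta>"
    "\<And>y. norm (y - zs) < \<delta> \<Longrightarrow> \<bar>f y - f zs\<bar> < \<eta> \<Longrightarrow> C * \<bar>f y - f zs\<bar> powr \<theta> \<le> norm (grad f y)"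
proof -
  obtain \<eta> :: ereal and U where U: "0 < \<eta>" "open U" "zs \<in> U" "0 < C"
    and le: "\<And>x z. x \<in> U \<Longrightarrow> ereal \<bar>f x - f zs\<bar> < \<eta> \<Longrightarrow> z \<in> U \<Longrightarrow> ereal \<bar>f z - f zs\<bar> < \<eta> \<Longrightarrow>
      C * \<bar>merit f L lam (x, z) - f zs\<bar> powr \<theta> \<le> norm (grad (merit f L lam) (x, z))"
    using mer unfolding merit_lojasiewicz_constant_def by auto
  have grad_merit: "grad (merit f L lam) (y, y) = (0, grad f y)" for y
  proof (rule grad_eqI)
    have "(f has_derivative (\<lambda>h. h \<bullet> grad f y)) (at (snd (y, y)))"
      using GDERIV_grad[OF diff] by (simp add: gderiv_def)
    then have 1: "((\<lambda>p. f (snd p)) has_derivative (\<lambda>h. snd h \<bullet> grad f y)) (at (y, y))"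
      using has_derivative_compose[OF has_derivative_snd[OF has_derivative_ident]] by blast
    have 2: "((\<lambda>p. c * ((snd p - fst p) \<bullet> (snd p - fst p))) has_derivative (\<lambda>h. 0)) (at (y, y))" for c :: real
      by (auto intro!: derivative_eq_intros)
    have "(merit f L lam has_derivative (\<lambda>h. snd h \<bullet> grad f y)) (at (y, y))"
      using has_derivative_add[OF 1 2[of "3 * L / (1 - lam)"]]
      by (simp add: merit_def case_prod_unfold power2_norm_eq_inner)
    then show "GDERIV (merit f L lam) (y, y) :> (0, grad f y)"
      by (simp add: gderiv_def inner_prod_def)
  qed
  obtain \<delta> where \<delta>: "0 < \<delta>" "\<And>y. dist y zs < \<delta> \<Longrightarrow> y \<in> U"
    using U unfolding open_dist by metis
  obtain \<eta>' :: real where \<eta>': "0 < \<eta>'" "ereal \<eta>' < \<eta>"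
    using ereal_dense2[OF U(1)] by auto
  show thesis
  proof (rule that[of \<delta> \<eta>'])
    fix y assume y: "norm (y - zs) < \<delta>" "\<bar>f y - f zs\<bar> < \<eta>'"
    then have "ereal \<bar>f y - f zs\<bar> < \<eta>" "y \<in> U"
      using \<eta>' \<delta> by (auto intro: less_trans[of _ "ereal \<eta>'"] simp: dist_norm)
    then show "C * \<bar>f y - f zs\<bar> powr \<theta> \<le> norm (grad f y)"
      using le[of y y] by (simp add: grad_merit) (simp add: merit_def)
  qed (use U \<delta> \<eta>' in auto)
qed

locale sgdm_path =
  fixes f :: "'a::euclidean_space \<Rightarrow> real" and L lam \<nu> \<alpha> \<beta> \<gamma> :: real and x e :: "nat \<Rightarrow> 'a"
  assumes diff: "\<And>y. f differentiable (at y)"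
    and bdd: "bdd_below (range f)"
    and L: "0 < L" "L-lipschitz_on UNIV (grad f)"
    and lam: "0 \<le> lam" "lam < 1"
    and alpha: "0 < \<alpha>" and beta: "0 \<le> \<beta>" and gamma: "2 / 3 < \<gamma>" "\<gamma> \<le> 1"
    and x_step: "\<And>k. x (Suc (Suc k)) = x (Suc k)
        - step_seq \<alpha> \<beta> \<gamma> k *\<^sub>R (grad f (x (Suc k) + \<nu> *\<^sub>R (x (Suc k) - x k)) - e (Suc k))
        + lam *\<^sub>R (x (Suc k) - x k)"
begin

text \<open>The sum of the geometric series in \<open>lam\<close>: the total displacement that
  momentum finally makes of a unit impulse.\<close>

definition "\<kappa> = 1 / (1 - lam)"

definition "u = filt (gain \<alpha> \<beta> \<gamma>) (step_seq \<alpha> \<beta> \<gamma>) (\<lambda>j. e (Suc j))"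

text \<open>The momentum generated by the errors alone: forgetting at rate \<open>1 - lam\<close>
  reproduces the factor \<open>lam\<close>, so subtracting \<open>v\<close> frees the remainder
  \<open>h\<close> of errors.\<close>

definition "v = filt (\<lambda>_. 1 - lam) (step_seq \<alpha> \<beta> \<gamma>) (\<lambda>j. e (Suc j))"

definition "h k = x (Suc k) - x k - v k"

definition "z k = x (Suc k) + (lam * \<kappa>) *\<^sub>R (x (Suc k) - x k) - \<kappa> *\<^sub>R u k"

definition "\<rho> k = norm (u k) + norm (v k)"

definition "a k = \<kappa> * step_seq \<alpha> \<beta> \<gamma> k"

text \<open>The first summand bounds the change of gradient between the extrapolated point and
  \<open>z k\<close>; the second bounds the decay of the filter \<open>u\<close>, since
  \<open>gain\<close> is at most \<open>2 / \<alpha>\<close> times the step.\<close>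

definition "B = L * (\<bar>\<nu> - lam * \<kappa>\<bar> + \<kappa>) + 2 / \<alpha>"

lemma kappa: "1 \<le> \<kappa>" "\<kappa> = 1 + lam * \<kappa>"
  using lam by (auto simp: \<kappa>_def field_simps)

lemma s_pos: "0 < step_seq \<alpha> \<beta> \<gamma> k"
  by (rule step_seq_pos[OF alpha beta gamma])

lemma rho_nonneg: "0 \<le> \<rho> k"
  by (simp add: \<rho>_def)

lemma grad_lipschitz: "norm (grad f y - grad f y') \<le> L * norm (y - y')"
  using lipschitz_onD[OF L(2), of y y'] by (simp add: dist_norm)

lemma momentum_decomposition: "x (Suc k) - x k = v k + h k"
  by (simp add: h_def)

lemma u_Suc: "u (Suc k) = (1 - gain \<alpha> \<beta> \<gamma> k) *\<^sub>R u k + step_seq \<alpha> \<beta> \<gamma> k *\<^sub>R e (Suc k)"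
  by (simp add: u_def)

lemma v_Suc: "v (Suc k) = lam *\<^sub>R v k + step_seq \<alpha> \<beta> \<gamma> k *\<^sub>R e (Suc k)"
  by (simp add: v_def)

abbreviation "xt k \<equiv> x (Suc k) + \<nu> *\<^sub>R (x (Suc k) - x k)"

lemma h_Suc: "h (Suc k) = lam *\<^sub>R h k - step_seq \<alpha> \<beta> \<gamma> k *\<^sub>R grad f (xt k)"
  unfolding h_def v_Suc x_step by (simp add: algebra_simps)

text \<open>By \<open>1 + lam * \<kappa> = \<kappa>\<close> the error enters the shifted iterate
  with the factor \<kappa> and cancels against the one in
  \<open>\<kappa> *\<^sub>R u (Suc k)\<close>. Only the decay of the filter remains.\<close>

lemma z_Suc: "z (Suc k) = z k - a k *\<^sub>R grad f (xt k) + (\<kappa> * gain \<alpha> \<beta> \<gamma> k) *\<^sub>R u k"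
proof -
  define s d G where "s = step_seq \<alpha> \<beta> \<gamma> k" and "d = x (Suc k) - x k" and "G = grad f (xt k)"
  have dS: "x (Suc (Suc k)) - x (Suc k) = lam *\<^sub>R d - s *\<^sub>R (G - e (Suc k))"
    unfolding x_step by (simp add: s_def d_def G_def)
  have "z (Suc k) = x (Suc k) + (1 + lam * \<kappa>) *\<^sub>R (x (Suc (Suc k)) - x (Suc k)) - \<kappa> *\<^sub>R u (Suc k)"
    by (simp add: z_def algebra_simps)
  also have "1 + lam * \<kappa> = \<kappa>" using kappa by simp
  finally show ?thesis
    unfolding dS u_Suc by (simp add: z_def a_def s_def d_def G_def algebra_simps)
qed

lemma xt_dist: "norm (xt k - z k) \<le> (\<bar>\<nu> - lam * \<kappa>\<bar> + \<kappa>) * (\<rho> k + norm (h k))"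
proof -
  have "xt k - z k = (\<nu> - lam * \<kappa>) *\<^sub>R (v k + h k) + \<kappa> *\<^sub>R u k"
    unfolding momentum_decomposition[symmetric] by (simp add: z_def algebra_simps)
  also have "norm \<dots> \<le> \<bar>\<nu> - lam * \<kappa>\<bar> * norm (v k + h k) + \<kappa> * norm (u k)"
    using norm_triangle_ineq[of "(\<nu> - lam * \<kappa>) *\<^sub>R (v k + h k)" "\<kappa> *\<^sub>R u k"] kappa by simp
  also have "\<dots> \<le> \<bar>\<nu> - lam * \<kappa>\<bar> * (\<rho> k + norm (h k)) + \<kappa> * (\<rho> k + norm (h k))"
    using norm_triangle_ineq[of "v k" "h k"] kappa
    by (intro add_mono mult_left_mono) (auto simp: \<rho>_def intro: order_trans)
  finally show ?thesis by (simp add: distrib_right)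
qed

lemma x_dist: "norm (x (Suc k) - z k) \<le> \<kappa> * (\<rho> k + norm (h k))"
proof -
  have "x (Suc k) - z k = \<kappa> *\<^sub>R u k - (lam * \<kappa>) *\<^sub>R (v k + h k)"
    unfolding momentum_decomposition[symmetric] by (simp add: z_def)
  also have "norm \<dots> \<le> \<kappa> * norm (u k) + lam * \<kappa> * norm (v k + h k)"
    using norm_triangle_ineq4[of "\<kappa> *\<^sub>R u k" "(lam * \<kappa>) *\<^sub>R (v k + h k)"] kappa lam by simp
  also have "\<dots> \<le> \<kappa> * norm (u k) + \<kappa> * (norm (v k) + norm (h k))"
    using norm_triangle_ineq[of "v k" "h k"] kappa lam
    by (intro add_mono mult_mono) auto
  finally show ?thesis by (simp add: \<rho>_def algebra_simps)
qed

lemma grad_xt: "norm (grad f (xt k) - grad f (z k)) \<le> L * (\<bar>\<nu> - lam * \<kappa>\<bar> + \<kappa>) * (\<rho> k + norm (h k))"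
  using mult_left_mono[OF xt_dist less_imp_le[OF L(1)], of k] grad_lipschitz[of "xt k" "z k"]
  by (simp only: mult.assoc)

lemma B_bounds: "0 \<le> B" "L * (\<bar>\<nu> - lam * \<kappa>\<bar> + \<kappa>) \<le> B"
  using L alpha kappa by (auto simp: B_def)

lemma z_step: "norm (z (Suc k) - z k + a k *\<^sub>R grad f (z k)) \<le> a k * (B * (\<rho> k + norm (h k)))"
proof -
  have eq: "z (Suc k) - z k + a k *\<^sub>R grad f (z k)
      = (\<kappa> * gain \<alpha> \<beta> \<gamma> k) *\<^sub>R u k - a k *\<^sub>R (grad f (xt k) - grad f (z k))"
    unfolding z_Suc by (simp add: algebra_simps)
  have a0: "0 \<le> a k" using s_pos[of k] kappa by (simp add: a_def)
  have g0: "0 \<le> gain \<alpha> \<beta> \<gamma> k" by (rule gain_bounds[OF alpha beta gamma])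
  have "\<kappa> * gain \<alpha> \<beta> \<gamma> k \<le> \<kappa> * (2 / \<alpha> * step_seq \<alpha> \<beta> \<gamma> k)"
    using gain_bounds(3)[OF alpha beta gamma] kappa by (intro mult_left_mono) auto
  then have 1: "\<kappa> * gain \<alpha> \<beta> \<gamma> k \<le> a k * (2 / \<alpha>)" by (simp add: a_def mult_ac)
  have 2: "norm (u k) \<le> \<rho> k + norm (h k)" by (simp add: \<rho>_def)
  have "\<kappa> * gain \<alpha> \<beta> \<gamma> k * norm (u k) \<le> a k * (2 / \<alpha>) * (\<rho> k + norm (h k))"
    using a0 alpha by (intro mult_mono[OF 1 2]) auto
  moreover have "a k * norm (grad f (xt k) - grad f (z k))
      \<le> a k * (L * (\<bar>\<nu> - lam * \<kappa>\<bar> + \<kappa>) * (\<rho> k + norm (h k)))"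
    using grad_xt a0 by (rule mult_left_mono)
  moreover have "norm ((\<kappa> * gain \<alpha> \<beta> \<gamma> k) *\<^sub>R u k - a k *\<^sub>R (grad f (xt k) - grad f (z k)))
      \<le> norm ((\<kappa> * gain \<alpha> \<beta> \<gamma> k) *\<^sub>R u k) + norm (a k *\<^sub>R (grad f (xt k) - grad f (z k)))"
    by (rule norm_triangle_ineq4)
  moreover have "norm ((\<kappa> * gain \<alpha> \<beta> \<gamma> k) *\<^sub>R u k) = \<kappa> * gain \<alpha> \<beta> \<gamma> k * norm (u k)"
    "norm (a k *\<^sub>R (grad f (xt k) - grad f (z k))) = a k * norm (grad f (xt k) - grad f (z k))"
    using a0 g0 kappa by simp_all
  moreover have "a k * (B * (\<rho> k + norm (h k))) = a k * (L * (\<bar>\<nu> - lam * \<kappa>\<bar> + \<kappa>) * (\<rho> k + norm (h k)))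
      + a k * (2 / \<alpha>) * (\<rho> k + norm (h k))"
    by (simp add: B_def distrib_left distrib_right)
  ultimately show ?thesis
    unfolding eq by linarith
qed

lemma h_step: "norm (h (Suc k)) \<le> lam * norm (h k) + a k * (norm (grad f (z k)) + B * (\<rho> k + norm (h k)))"
proof -
  have a0: "0 \<le> a k" "step_seq \<alpha> \<beta> \<gamma> k \<le> a k"
    using s_pos[of k] kappa mult_right_mono[of 1 \<kappa> "step_seq \<alpha> \<beta> \<gamma> k"] by (auto simp: a_def)
  have "norm (grad f (xt k)) \<le> norm (grad f (z k)) + norm (grad f (xt k) - grad f (z k))"
    by norm
  also have "\<dots> \<le> norm (grad f (z k)) + B * (\<rho> k + norm (h k))"
    using grad_xt[of k] mult_right_mono[OF B_bounds(2), of "\<rho> k + norm (h k)"] rho_nonneg[of k] by simp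
  finally have "step_seq \<alpha> \<beta> \<gamma> k * norm (grad f (xt k)) \<le> a k * (norm (grad f (z k)) + B * (\<rho> k + norm (h k)))"
    using a0 by (intro mult_mono) auto
  moreover have "norm (h (Suc k)) \<le> lam * norm (h k) + step_seq \<alpha> \<beta> \<gamma> k * norm (grad f (xt k))"
    unfolding h_Suc using norm_triangle_ineq4[of "lam *\<^sub>R h k" "step_seq \<alpha> \<beta> \<gamma> k *\<^sub>R grad f (xt k)"]
      lam s_pos[of k] by simp
  ultimately show ?thesis by linarith
qed

end

text \<open>Countably many logarithmic exponents \<open>1 / real (Suc n)\<close>, so that a single
  null set serves every \<epsilon>.\<close>

locale sgdm_noise_path = sgdm_path +
  assumes noise_sum: "\<And>n. summable (\<lambda>k. log_weight \<gamma> (1 / real (Suc n)) k * (a k * (\<rho> k)\<^sup>2))"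
    and noise_bound: "\<And>n. \<exists>K. \<forall>\<^sub>F k in sequentially. log_weight \<gamma> (1 / real (Suc n)) k * (\<rho> k)\<^sup>2 \<le> K"
begin

lemma a_pos: "0 < a k"
  using s_pos[of k] kappa by (simp add: a_def)

lemma noise_sum_powr:
  assumes "0 < p"
  shows "summable (\<lambda>k. real (Suc k) powr (2 * \<gamma> - 1 - p) * (a k * (\<rho> k)\<^sup>2))"
proof (rule summable_comparison_test_ev[OF _ noise_sum[of 0]])
  show "\<forall>\<^sub>F k in sequentially. norm (real (Suc k) powr (2 * \<gamma> - 1 - p) * (a k * (\<rho> k)\<^sup>2))
      \<le> log_weight \<gamma> (1 / real (Suc 0)) k * (a k * (\<rho> k)\<^sup>2)"
    using log_weight_ge_powr[OF assms, of \<gamma> "1 / real (Suc 0)"]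
    by eventually_elim (use a_pos in \<open>simp add: abs_mult less_imp_le mult_right_mono\<close>)
qed

lemma noise_bound_powr:
  assumes "0 < p"
  shows "\<exists>K. \<forall>\<^sub>F k in sequentially. real (Suc k) powr (2 * \<gamma> - 1 - p) * (\<rho> k)\<^sup>2 \<le> K"
proof -
  obtain K where "\<forall>\<^sub>F k in sequentially. log_weight \<gamma> (1 / real (Suc 0)) k * (\<rho> k)\<^sup>2 \<le> K"
    using noise_bound by blast
  then have "\<forall>\<^sub>F k in sequentially. real (Suc k) powr (2 * \<gamma> - 1 - p) * (\<rho> k)\<^sup>2 \<le> K"
    using log_weight_ge_powr[OF assms, of \<gamma> "1 / real (Suc 0)"]
    by eventually_elim (smt (verit) mult_right_mono zero_le_power2)
  then show ?thesis by blast
qed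

lemma rho_square_lim: "(\<lambda>k. (\<rho> k)\<^sup>2) \<longlonglongrightarrow> 0"
proof -
  define p where "p = \<gamma> - 1 / 2"
  have p: "0 < p" "2 * \<gamma> - 1 - p = p" using gamma by (auto simp: p_def)
  obtain K where K: "\<forall>\<^sub>F k in sequentially. real (Suc k) powr p * (\<rho> k)\<^sup>2 \<le> K"
    using noise_bound_powr[OF p(1)] p by auto
  show ?thesis
  proof (rule tendsto_sandwich[OF _ _ tendsto_const])
    show "\<forall>\<^sub>F k in sequentially. (\<rho> k)\<^sup>2 \<le> K * real (Suc k) powr - p"
      using K by eventually_elim (simp add: powr_minus_divide field_simps)
    show "(\<lambda>k. K * real (Suc k) powr - p) \<longlonglongrightarrow> 0"
      using p(1) by real_asymp
  qed simp
qed

sublocale inexact_momentum f "grad f" L lam B z h a \<rho>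
proof
  show "\<bar>f y - f x - grad f x \<bullet> (y - x)\<bar> \<le> L * (norm (y - x))\<^sup>2" for x y
    by (rule lipschitz_grad_taylor[OF diff L(2)])
  show "a \<longlonglongrightarrow> 0"
    using tendsto_mult[OF tendsto_const step_seq_lim[OF alpha beta gamma], of \<kappa>] by (simp add: a_def[abs_def])
  show "\<not> summable a"
  proof
    assume "summable a"
    then have "summable (\<lambda>k. 1 / \<kappa> * a k)" by (rule summable_mult)
    then show False
      using step_seq_not_summable[OF alpha beta gamma] kappa(1) by (simp add: a_def[abs_def])
  qed
  define p where "p = \<gamma> - 1 / 2"
  have p: "0 < p" "2 * \<gamma> - 1 - p = p" using gamma by (auto simp: p_def)
  show "summable (\<lambda>k. a k * (\<rho> k)\<^sup>2)"
  proof (rule summable_comparison_test'[OF noise_sum_powr[OF p(1), unfolded p(2)]])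
    fix k :: nat
    have "1 \<le> real (Suc k) powr p" using p by (intro ge_one_powr_ge_zero) auto
    then show "norm (a k * (\<rho> k)\<^sup>2) \<le> real (Suc k) powr p * (a k * (\<rho> k)\<^sup>2)"
      using a_pos[of k] mult_right_mono[of 1 "real (Suc k) powr p" "a k * (\<rho> k)\<^sup>2"] by simp
  qed
qed (use L lam bdd B_bounds grad_lipschitz a_pos rho_nonneg z_step h_step in auto)

lemma rho_lim: "\<rho> \<longlonglongrightarrow> 0"
  using tendsto_real_sqrt[OF rho_square_lim] rho_nonneg by simp

lemma x_minus_z_lim: "(\<lambda>k. norm (x (Suc k) - z k)) \<longlonglongrightarrow> 0"
proof (rule tendsto_sandwich[OF _ _ tendsto_const])
  show "(\<lambda>k. \<kappa> * (\<rho> k + norm (h k))) \<longlonglongrightarrow> 0"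
    using tendsto_mult[OF tendsto_const tendsto_add[OF rho_lim h_lim], of \<kappa>] by simp
qed (use x_dist in auto)

text \<open>The finite liminf makes \<open>x\<close>, and with it \<open>z\<close>, return
  infinitely often to a ball; compactness gives a cluster point. Gradient and function value
  converge along the whole sequence, which identifies it as critical with value
  \<open>flim\<close>.\<close>

lemma accumulation_point:
  assumes "liminf (\<lambda>k. ereal (norm (x k))) < \<infinity>"
  obtains zs where "zs \<in> crit f" "f zs = flim"
    "\<And>r. 0 < r \<Longrightarrow> \<exists>\<^sub>F k in sequentially. norm (z k - zs) < r"
proof -
  obtain r :: real where r: "liminf (\<lambda>k. ereal (norm (x k))) < ereal r"
    using ereal_dense2[OF assms] by auto
  have "\<not> (\<forall>\<^sub>F k in sequentially. \<not> norm (x (Suc k)) < r)"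
  proof
    assume "\<forall>\<^sub>F k in sequentially. \<not> norm (x (Suc k)) < r"
    then have "\<forall>\<^sub>F k in sequentially. \<not> norm (x k) < r"
      by (simp only: eventually_sequentially_Suc[of "\<lambda>k. \<not> norm (x k) < r"])
    then have "\<forall>\<^sub>F k in sequentially. ereal r \<le> ereal (norm (x k))"
      by eventually_elim simp
    then show False using Liminf_bounded r by (metis not_le)
  qed
  then have freq: "\<exists>\<^sub>F k in sequentially. norm (x (Suc k)) < r"
    unfolding frequently_def .
  have "\<forall>\<^sub>F k in sequentially. norm (x (Suc k) - z k) < 1"
    using x_minus_z_lim by (rule order_tendstoD) simp
  from frequently_eventually_conj[OF freq this]
  have "\<exists>\<^sub>F k in sequentially. z k \<in> cball 0 (r + 1)"
  proof (rule frequently_elim1)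
    fix k assume "norm (x (Suc k) - z k) < 1 \<and> norm (x (Suc k)) < r"
    then show "z k \<in> cball 0 (r + 1)"
      using norm_triangle_ineq4[of "x (Suc k)" "x (Suc k) - z k"] by simp
  qed
  then have "infinite {k. z k \<in> cball 0 (r + 1)}"
    by (simp add: frequently_cofinite flip: cofinite_eq_sequentially)
  from infinite_enumerate[OF this] obtain s :: "nat \<Rightarrow> nat"
    where s: "strict_mono s" "\<And>n. s n \<in> {k. z k \<in> cball 0 (r + 1)}" by blast
  have "seq_compact (cball (0::'a) (r + 1))"
    by (intro compact_imp_seq_compact compact_cball)
  then obtain zs s' where s': "strict_mono s'" "((z \<circ> s) \<circ> s') \<longlonglongrightarrow> zs"
    using s(2) by (auto elim!: seq_compactE[where f = "z \<circ> s"])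
  define w where "w = s \<circ> s'"
  have w: "strict_mono w" "(\<lambda>n. z (w n)) \<longlonglongrightarrow> zs"
    using strict_mono_o[OF s(1) s'(1)] s' by (simp_all add: w_def o_def)
  have sub: "(\<lambda>n. y (w n)) \<longlonglongrightarrow> l" if "y \<longlonglongrightarrow> l" for y :: "nat \<Rightarrow> real" and l
    using LIMSEQ_subseq_LIMSEQ[OF that w(1)] by (simp add: o_def)
  show thesis
  proof (rule that)
    have "continuous_on UNIV (grad f)"
      using L(2) by (rule lipschitz_on_continuous_on)
    then have "isCont (grad f) zs"
      by (simp add: continuous_on_eq_continuous_at)
    then have "(\<lambda>n. grad f (z (w n))) \<longlonglongrightarrow> grad f zs"
      using w(2) by (rule isCont_tendsto_compose)
    then have "(\<lambda>n. (norm (grad f (z (w n))))\<^sup>2) \<longlonglongrightarrow> (norm (grad f zs))\<^sup>2"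
      by (intro tendsto_intros)
    moreover have "(\<lambda>n. (norm (grad f (z (w n))))\<^sup>2) \<longlonglongrightarrow> 0"
      using sub[OF grad_lim] .
    ultimately have "(norm (grad f zs))\<^sup>2 = 0" by (rule LIMSEQ_unique)
    then show "zs \<in> crit f" by (simp add: crit_def)
    have "(\<lambda>n. f (z (w n))) \<longlonglongrightarrow> f zs"
      using differentiable_imp_continuous_within[OF diff] w(2) by (rule isCont_tendsto_compose)
    then show "f zs = flim" using sub[OF f_lim] by (rule LIMSEQ_unique)
    fix r :: real assume "0 < r"
    then have ev: "\<forall>\<^sub>F n in sequentially. norm (z (w n) - zs) < r"
      using w(2) by (simp add: tendsto_iff dist_norm)
    show "\<exists>\<^sub>F k in sequentially. norm (z k - zs) < r"
      unfolding frequently_def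
    proof
      assume "\<forall>\<^sub>F k in sequentially. \<not> norm (z k - zs) < r"
      then have "\<forall>\<^sub>F n in sequentially. \<not> norm (z (w n) - zs) < r"
        by (rule eventually_subseq[OF w(1)])
      with ev have "\<forall>\<^sub>F n in sequentially. False"
        by eventually_elim simp
      then show False by simp
    qed
  qed
qed

text \<open>The price of returning from \<open>z k\<close> to the iterate: their difference contains
  the filters, so \<open>(\<rho> k)\<^sup>2\<close> appears beside the gap, and the rates of the
  iterates are limited by both.\<close>

lemma x_bounds:
  obtains K where "0 \<le> K" "\<forall>\<^sub>F k in sequentially.
    (norm (x (Suc k) - z k))\<^sup>2 \<le> K * (gap k + (\<rho> k)\<^sup>2) \<and>
    \<bar>f (x (Suc k)) - flim\<bar> \<le> K * (gap k + (\<rho> k)\<^sup>2) \<and>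
    (norm (grad f (x (Suc k))))\<^sup>2 \<le> K * (gap k + (\<rho> k)\<^sup>2)"
proof -
  define K1 where "K1 = 2 * \<kappa>\<^sup>2 * (1 + 1 / c\<^sub>0)"
  define Kf where "Kf = 2 * B\<^sup>2 + 2 + 1 / c\<^sub>0"
  define K where "K = K1 + (Kf + c\<^sub>1 + (1 + L) * K1) + (2 * c\<^sub>1 + 2 * L\<^sup>2 * K1)"
  have nn: "0 \<le> K1" "0 \<le> Kf" using c0 by (auto simp: K1_def Kf_def)
  have nn2: "0 \<le> (1 + L) * K1" "0 \<le> 2 * L\<^sup>2 * K1" "0 \<le> c\<^sub>1"
    using nn L c1_nonneg by auto
  have "\<forall>\<^sub>F k in sequentially.
    (norm (x (Suc k) - z k))\<^sup>2 \<le> K * (gap k + (\<rho> k)\<^sup>2) \<and>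
    \<bar>f (x (Suc k)) - flim\<bar> \<le> K * (gap k + (\<rho> k)\<^sup>2) \<and>
    (norm (grad f (x (Suc k))))\<^sup>2 \<le> K * (gap k + (\<rho> k)\<^sup>2)"
    using eventually_ge_at_top[of N\<^sub>0]
  proof eventually_elim
    case (elim k)
    define D W G where "D = gap k + (\<rho> k)\<^sup>2" and "W = norm (x (Suc k) - z k)" and "G = norm (grad f (z k))"
    have g0: "0 \<le> gap k" "gap k \<le> D" "0 \<le> D" using gap_nonneg[OF elim] by (auto simp: D_def)
    have HD: "(norm (h k))\<^sup>2 \<le> 1 / c\<^sub>0 * D"
    proof -
      have "c\<^sub>0 * (norm (h k))\<^sup>2 \<le> D" using h_bound[OF elim] g0 by linarith
      then show ?thesis using c0 by (simp add: field_simps)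
    qed
    have "W\<^sup>2 \<le> (\<kappa> * (\<rho> k + norm (h k)))\<^sup>2"
      unfolding W_def using x_dist by (intro power_mono) auto
    also have "\<dots> \<le> \<kappa>\<^sup>2 * (2 * ((\<rho> k)\<^sup>2 + (norm (h k))\<^sup>2))"
      unfolding power_mult_distrib using sum_squares_bound[of "\<rho> k" "norm (h k)"]
      by (intro mult_left_mono) (auto simp: power2_sum)
    also have "\<dots> \<le> \<kappa>\<^sup>2 * (2 * (D + 1 / c\<^sub>0 * D))"
      using HD g0 by (intro mult_left_mono) (auto simp: D_def)
    also have "\<dots> = K1 * D" by (simp add: K1_def algebra_simps)
    finally have W: "W\<^sup>2 \<le> K1 * D" .
    have G: "G\<^sup>2 \<le> c\<^sub>1 * D"
      using grad_bound[OF elim] mult_left_mono[OF g0(2) nn2(3)] by (simp add: G_def)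
    have fz: "\<bar>f (z k) - flim\<bar> \<le> Kf * D"
      using f_bound[OF elim] mult_left_mono[OF g0(2) nn(2)] by (simp add: Kf_def)
    have "\<bar>f (x (Suc k)) - f (z k) - grad f (z k) \<bullet> (x (Suc k) - z k)\<bar> \<le> L * W\<^sup>2"
      unfolding W_def by (rule taylor)
    moreover have "\<bar>grad f (z k) \<bullet> (x (Suc k) - z k)\<bar> \<le> G * W"
      unfolding G_def W_def by (rule Cauchy_Schwarz_ineq2)
    moreover have "G * W \<le> G\<^sup>2 + W\<^sup>2"
    proof -
      have "0 \<le> G * W" by (simp add: G_def W_def)
      then show ?thesis using sum_squares_bound[of G W] by linarith
    qed
    ultimately have "\<bar>f (x (Suc k)) - flim\<bar> \<le> Kf * D + (c\<^sub>1 * D + W\<^sup>2) + L * W\<^sup>2"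
      using fz G by linarith
    also have "\<dots> = (Kf + c\<^sub>1) * D + (1 + L) * W\<^sup>2" by (simp add: algebra_simps)
    also have "\<dots> \<le> (Kf + c\<^sub>1) * D + (1 + L) * (K1 * D)"
      using W L by (intro add_left_mono mult_left_mono) auto
    finally have F: "\<bar>f (x (Suc k)) - flim\<bar> \<le> (Kf + c\<^sub>1 + (1 + L) * K1) * D"
      by (simp add: algebra_simps)
    have "norm (grad f (x (Suc k))) \<le> G + L * W"
      using grad_lipschitz[of "x (Suc k)" "z k"] norm_triangle_sub[of "grad f (x (Suc k))" "grad f (z k)"]
      by (simp add: G_def W_def)
    then have "(norm (grad f (x (Suc k))))\<^sup>2 \<le> (G + L * W)\<^sup>2"
      by (intro power_mono) auto
    also have "\<dots> \<le> 2 * G\<^sup>2 + 2 * L\<^sup>2 * W\<^sup>2"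
      using sum_squares_bound[of G "L * W"] by (simp add: power2_sum power_mult_distrib)
    also have "\<dots> \<le> 2 * (c\<^sub>1 * D) + 2 * L\<^sup>2 * (K1 * D)"
      using G W by (intro add_mono mult_left_mono) auto
    finally have GX: "(norm (grad f (x (Suc k))))\<^sup>2 \<le> (2 * c\<^sub>1 + 2 * L\<^sup>2 * K1) * D"
      by (simp add: algebra_simps)
    have "K1 * D \<le> K * D" "(Kf + c\<^sub>1 + (1 + L) * K1) * D \<le> K * D" "(2 * c\<^sub>1 + 2 * L\<^sup>2 * K1) * D \<le> K * D"
      using nn nn2 g0 by (auto intro!: mult_right_mono simp: K_def)
    then show ?case
      using W F GX unfolding D_def[symmetric] W_def by linarith
  qed
  moreover have "0 \<le> K" using nn nn2 by (simp add: K_def)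
  ultimately show thesis using that by blast
qed

lemma lojasiewicz_path_powr:
  assumes th: "1 / 2 \<le> \<theta>" "\<theta> < 1" and "0 < C" "0 < \<delta>" "0 < \<eta>" and zs: "f zs = flim"
    and loja: "\<And>y. norm (y - zs) < \<delta> \<Longrightarrow> \<bar>f y - f zs\<bar> < \<eta> \<Longrightarrow>
      C * \<bar>f y - f zs\<bar> powr \<theta> \<le> norm (grad f y)"
    and p: "0 < p" "p \<le> 2 * \<gamma> - 1"
  obtains S where "lojasiewicz_path f (grad f) L lam B z h a \<rho> zs \<theta> C \<delta> \<eta> S
    (\<lambda>k. real (Suc k) powr (2 * \<gamma> - 1 - p))"
proof -
  obtain S where "0 \<le> S" "\<forall>\<^sub>F k in sequentially. noise_tail k \<le> S / real (Suc k) powr (2 * \<gamma> - 1 - p)"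
  proof (rule noise_tail_rate[OF noise_sum_powr[OF p(1)], of 0])
    show "real (Suc k) powr (2 * \<gamma> - 1 - p) \<le> real (Suc j) powr (2 * \<gamma> - 1 - p)" if "k \<le> j" for j k
      using p that by (intro powr_mono2) auto
  qed auto
  then have "lojasiewicz_path f (grad f) L lam B z h a \<rho> zs \<theta> C \<delta> \<eta> S
    (\<lambda>k. real (Suc k) powr (2 * \<gamma> - 1 - p))"
    using assms by unfold_locales auto
  then show thesis by (rule that)
qed

end

section \<open>Convergence and rates along a path\<close>

lemma smallo_shifted_powr:
  fixes y :: "nat \<Rightarrow> real"
  assumes "\<forall>\<^sub>F k in sequentially. \<bar>y (Suc k)\<bar> \<le> K * real (Suc k) powr - b" "c < b"
  shows "y \<in> o(\<lambda>k. 1 / real k powr c)"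
proof -
  have "\<forall>\<^sub>F k in sequentially. \<bar>y k\<bar> \<le> K * real k powr - b"
    using assms(1) by (subst (asm) eventually_sequentially_Suc)
  then have "y \<in> O(\<lambda>k. real k powr - b)"
    by (intro bigoI[of _ K]) (auto elim: eventually_mono)
  also have "(\<lambda>k. real k powr - b) \<in> o(\<lambda>k. 1 / real k powr c)"
    using assms(2) by real_asymp
  finally show ?thesis .
qed

lemma smallo_shifted_ln:
  fixes y :: "nat \<Rightarrow> real"
  assumes "\<forall>\<^sub>F k in sequentially. \<bar>y (Suc k)\<bar> \<le> K * (ln (real (Suc k)) powr b * real (Suc k) powr - q)"
    and "b < c"
  shows "y \<in> o(\<lambda>k. ln (real k) powr c / real k powr q)"
proof -
  have "\<forall>\<^sub>F k in sequentially. \<bar>y k\<bar> \<le> K * (ln (real k) powr b * real k powr - q)"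
    using assms(1) by (subst (asm) eventually_sequentially_Suc)
  then have "\<forall>\<^sub>F k in sequentially. norm (y k) \<le> K * norm (ln (real k) powr b * real k powr - q)"
    by eventually_elim simp
  then have "y \<in> O(\<lambda>k. ln (real k) powr b * real k powr - q)"
    by (rule bigoI)
  also have "(\<lambda>k. ln (real k) powr b * real k powr - q) \<in> o(\<lambda>k. ln (real k) powr c / real k powr q)"
    using assms(2) by real_asymp
  finally show ?thesis .
qed

context sgdm_noise_path
begin

lemma a_le: "a k \<le> \<kappa> * \<alpha> * real (Suc k) powr - \<gamma>"
  using mult_left_mono[OF step_seq_le[OF alpha beta gamma], of \<kappa> k] kappa by (simp add: a_def mult_ac)

lemma a_ge: "\<alpha> / (1 + \<beta>) * real (Suc k) powr - \<gamma> \<le> a k"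
proof -
  have "step_seq \<alpha> \<beta> \<gamma> k \<le> a k"
    using mult_right_mono[OF kappa(1), of "step_seq \<alpha> \<beta> \<gamma> k"] s_pos[of k] by (simp add: a_def)
  then show ?thesis using step_seq_ge_powr[OF alpha beta gamma, of k] by linarith
qed

text \<open>The third assumption says that \<theta> is at least the critical exponent. It gives
  \<open>(2 * \<gamma> - 1) * \<theta> \<ge> \<gamma> / 2\<close>, so the noise length has the
  positive decay exponent \<open>r\<close>, and also
  \<open>(1 - \<gamma>) / (2 * \<theta> - 1) \<le> 2 * \<gamma> - 1\<close>, so the rate of the gap
  is not cut off by the noise. The loss \<open>p\<close> absorbs all logarithms.\<close>

lemma powr_path:
  assumes th: "1 / 2 \<le> \<theta>" "\<theta> < 1" "\<gamma> \<le> (4 * \<gamma> - 2) * \<theta>"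
    and loj: "0 < C" "0 < \<delta>" "0 < \<eta>" and zs: "f zs = flim"
    and loja: "\<And>y. norm (y - zs) < \<delta> \<Longrightarrow> \<bar>f y - f zs\<bar> < \<eta> \<Longrightarrow>
      C * \<bar>f y - f zs\<bar> powr \<theta> \<le> norm (grad f y)"
    and p: "0 < p" "p < 3 / 2 * \<gamma> - 1"
    and acc: "\<And>r. 0 < r \<Longrightarrow> \<exists>\<^sub>F k in sequentially. norm (z k - zs) < r"
  shows "z \<longlonglongrightarrow> zs"
    and "\<exists>K. \<forall>\<^sub>F k in sequentially. norm (z k - zs)
      \<le> K * (gap k powr (1 - \<theta>) + real (Suc k) powr - (\<gamma> - 1 + (2 * \<gamma> - 1 - p) * \<theta>))"
    and "\<lbrakk>1 / 2 < \<theta>; \<gamma> < 1; p < (1 - \<gamma>) / (2 * \<theta> - 1)\<rbrakk> \<Longrightarrow>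
      \<exists>K\<ge>0. \<forall>\<^sub>F k in sequentially. gap k \<le> K * real (Suc k) powr - ((1 - \<gamma>) / (2 * \<theta> - 1) - p)"
proof -
  define w where "w = 2 * \<gamma> - 1 - p"
  define r where "r = \<gamma> - 1 + w * \<theta>"
  have w: "0 < w" "w = 2 * \<gamma> - 1 - p" using p gamma by (auto simp: w_def)
  obtain S where S: "lojasiewicz_path f (grad f) L lam B z h a \<rho> zs \<theta> C \<delta> \<eta> S (\<lambda>k. real (Suc k) powr w)"
    using lojasiewicz_path_powr[OF th(1,2) loj zs loja p(1)] w by auto
  interpret P: lojasiewicz_path f "grad f" L lam B z h a \<rho> zs \<theta> C \<delta> \<eta> S "\<lambda>k. real (Suc k) powr w"
    by (rule S)
  have "p * \<theta> \<le> p * 1" using p th by (intro mult_left_mono) auto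
  moreover have "r = \<gamma> - 1 + (2 * \<gamma> - 1) * \<theta> - p * \<theta>" by (simp add: r_def w_def algebra_simps)
  moreover have "\<gamma> / 2 \<le> (2 * \<gamma> - 1) * \<theta>" using th(3) by (simp add: algebra_simps)
  ultimately have r: "0 < r" using p by linarith
  \<comment> \<open>Normalized so that the lower bound of \<open>powr_minus_diff_ge\<close> for the
    decrements of \<open>s\<close> equals the upper bound
    \<open>\<kappa> * \<alpha> * real (Suc k) powr (- r - 1)\<close> for the noise length.\<close>
  define A where "A = \<kappa> * \<alpha> / (r * 2 powr (- r - 1))"
  have A: "0 \<le> A" using r alpha kappa(1) by (simp add: A_def)
  define s where "s k = A * real (Suc k) powr - r" for k :: nat
  have s_lim: "s \<longlonglongrightarrow> 0"
    unfolding s_def using r by real_asymp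
  have s: "a k * (real (Suc k) powr w) powr - \<theta> \<le> s k - s (Suc k)" for k
  proof -
    have "a k * (real (Suc k) powr w) powr - \<theta> \<le> \<kappa> * \<alpha> * real (Suc k) powr - \<gamma> * (real (Suc k) powr w) powr - \<theta>"
      using a_le by (rule mult_right_mono) simp
    also have "\<dots> = \<kappa> * \<alpha> * real (Suc k) powr (- r - 1)"
      by (simp add: powr_powr r_def algebra_simps flip: powr_add)
    also have "\<dots> = A * (r * 2 powr (- r - 1) * real (Suc k) powr (- r - 1))"
      using r by (simp add: A_def)
    also have "\<dots> \<le> A * (real (Suc k) powr - r - (real (Suc k) + 1) powr - r)"
      using r A by (intro mult_left_mono powr_minus_diff_ge) auto
    finally show ?thesis by (simp add: s_def algebra_simps)
  qed
  then have s': "\<forall>\<^sub>F k in sequentially. a k * (real (Suc k) powr w) powr - \<theta> \<le> s k - s (Suc k)"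
    by simp
  show conv: "z \<longlonglongrightarrow> zs" by (rule P.path_limit[OF s_lim s' acc])
  have "\<forall>\<^sub>F k in sequentially. norm (z k - zs)
      \<le> (1 + B) * (P.k\<^sub>2 + A) * (gap k powr (1 - \<theta>) + real (Suc k) powr - r)"
    using P.path_convergence[OF s_lim s' acc, simplified]
  proof eventually_elim
    case (elim k)
    have "P.k\<^sub>2 * gap k powr (1 - \<theta>) + s k \<le> (P.k\<^sub>2 + A) * (gap k powr (1 - \<theta>) + real (Suc k) powr - r)"
      using P.k2_nonneg A by (simp add: s_def algebra_simps)
    then have "(1 + B) * (P.k\<^sub>2 * gap k powr (1 - \<theta>) + s k)
        \<le> (1 + B) * ((P.k\<^sub>2 + A) * (gap k powr (1 - \<theta>) + real (Suc k) powr - r))"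
      using B_bounds by (intro mult_left_mono) auto
    then show ?case using elim by simp
  qed
  then show "\<exists>K. \<forall>\<^sub>F k in sequentially. norm (z k - zs)
      \<le> K * (gap k powr (1 - \<theta>) + real (Suc k) powr - (\<gamma> - 1 + (2 * \<gamma> - 1 - p) * \<theta>))"
    unfolding r_def w_def by blast
  assume th2: "1 / 2 < \<theta>" and g1: "\<gamma> < 1" and p2: "p < (1 - \<gamma>) / (2 * \<theta> - 1)"
  define q where "q = (1 - \<gamma>) / (2 * \<theta> - 1) - p"
  have psi: "(1 - \<gamma>) / (2 * \<theta> - 1) \<le> 2 * \<gamma> - 1"
  proof -
    have "1 - \<gamma> \<le> (2 * \<gamma> - 1) * (2 * \<theta> - 1)" using th(3) by (simp add: algebra_simps)
    then show ?thesis using th2 by (simp add: pos_divide_le_eq)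
  qed
  have q: "0 < q" "q \<le> w" "q \<le> 1"
    using p p2 psi gamma by (auto simp: q_def w_def)
  \<comment> \<open>By this identity \<open>a k * s k powr (1 - 2 * \<theta>)\<close>, for
    \<open>s\<close> the power \<open>q\<close>, has order at least
    \<open>k powr (- 1 + p * (2 * \<theta> - 1))\<close>. The loss \<open>p\<close> thus lets it
    exceed the relative growth \<open>1 / k\<close> of \<open>s\<close>, whatever the
    constants.\<close>
  have qth: "\<gamma> + q * (2 * \<theta> - 1) = 1 - p * (2 * \<theta> - 1)"
  proof -
    have "(1 - \<gamma>) / (2 * \<theta> - 1) * (2 * \<theta> - 1) = 1 - \<gamma>" using th2 by simp
    then show ?thesis by (simp add: q_def left_diff_distrib[of _ p])
  qed
  define c where "c = c\<^sub>0 / (3 * P.k\<^sub>1\<^sup>2)"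
  have c: "0 < c" using c0 P.k1 by (simp add: c_def)
  have ratio: "real (Suc (Suc k)) powr q \<le> real (Suc k) powr q * (1 + 1 / real (Suc k))" for k
  proof -
    have "real (Suc (Suc k)) = real (Suc k) * (1 + 1 / real (Suc k))"
      by (simp add: field_simps)
    then have "real (Suc (Suc k)) powr q = (real (Suc k) * (1 + 1 / real (Suc k))) powr q"
      by (rule arg_cong)
    also have "\<dots> = real (Suc k) powr q * (1 + 1 / real (Suc k)) powr q"
      by (rule powr_mult)
    also have "\<dots> \<le> real (Suc k) powr q * (1 + 1 / real (Suc k)) powr 1"
      using q by (intro mult_left_mono powr_mono) auto
    finally show ?thesis by (simp add: add_nonneg_nonneg)
  qed
  obtain K' where K': "0 \<le> K'" "\<forall>\<^sub>F k in sequentially. gap k \<le> K' / real (Suc k) powr q"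
  proof (rule nonlinear_recursion_rate[where D = gap and a = a and c = c and \<theta> = \<theta> and K = "3 * P.k\<^sub>1\<^sup>2"
        and t = "\<lambda>k. real (Suc k) powr w" and s = "\<lambda>k. real (Suc k) powr q"])
    show "\<forall>\<^sub>F k in sequentially. 0 \<le> gap k" "\<forall>\<^sub>F k in sequentially. gap (Suc k) \<le> gap k"
      by (rule eventually_sequentiallyI, erule gap_nonneg) (rule eventually_sequentiallyI, erule gap_Suc_le)
    show "\<forall>\<^sub>F k in sequentially. gap (Suc k) \<le> gap k - c * a k *
        (gap k powr (2 * \<theta>) - 3 * P.k\<^sub>1\<^sup>2 * (real (Suc k) powr w) powr - (2 * \<theta>))"
      using P.gap_recursion[OF conv] by (simp add: c_def)
    show "\<forall>\<^sub>F k in sequentially. 0 < real (Suc k) powr q \<and> real (Suc k) powr q \<le> real (Suc k) powr w"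
      using q by (intro always_eventually allI conjI powr_mono) auto
    have "0 < p * (2 * \<theta> - 1)" "0 < c / 2 * (\<alpha> / (1 + \<beta>))"
      using p th2 c alpha beta by auto
    then have "\<forall>\<^sub>F k in sequentially. 1 \<le> c / 2 * (\<alpha> / (1 + \<beta>)) * real (Suc k) powr (p * (2 * \<theta> - 1))"
      by real_asymp
    then show "\<forall>\<^sub>F k in sequentially. real (Suc (Suc k)) powr q
        \<le> real (Suc k) powr q * (1 + c / 2 * a k * (real (Suc k) powr q) powr (1 - 2 * \<theta>))"
    proof eventually_elim
      case (elim k)
      have "1 / real (Suc k) \<le> 1 / real (Suc k) * (c / 2 * (\<alpha> / (1 + \<beta>)) * real (Suc k) powr (p * (2 * \<theta> - 1)))"
        using mult_left_mono[OF elim, of "1 / real (Suc k)"] by simp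
      also have "\<dots> = c / 2 * (\<alpha> / (1 + \<beta>)) * real (Suc k) powr (- 1 + p * (2 * \<theta> - 1))"
        unfolding powr_add by (simp add: powr_minus_divide)
      also have "- 1 + p * (2 * \<theta> - 1) = - \<gamma> + q * (1 - 2 * \<theta>)"
        using qth by (simp add: algebra_simps)
      also have "c / 2 * (\<alpha> / (1 + \<beta>)) * real (Suc k) powr (- \<gamma> + q * (1 - 2 * \<theta>))
          = c / 2 * (\<alpha> / (1 + \<beta>) * real (Suc k) powr - \<gamma>) * (real (Suc k) powr q) powr (1 - 2 * \<theta>)"
        unfolding powr_add powr_powr by simp
      also have "\<dots> \<le> c / 2 * a k * (real (Suc k) powr q) powr (1 - 2 * \<theta>)"
        using a_ge c by (intro mult_right_mono mult_left_mono) auto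
      finally have "real (Suc k) powr q * (1 + 1 / real (Suc k))
          \<le> real (Suc k) powr q * (1 + c / 2 * a k * (real (Suc k) powr q) powr (1 - 2 * \<theta>))"
        by (intro mult_left_mono) auto
      then show ?case using ratio[of k] by linarith
    qed
    have "real (Suc k) powr q * (1 + 1 / real (Suc k)) \<le> real (Suc k) powr q * 2" for k
      by (intro mult_left_mono) auto
    then show "\<forall>\<^sub>F k in sequentially. real (Suc (Suc k)) powr q \<le> 2 * real (Suc k) powr q"
      using ratio by (intro always_eventually allI) (metis mult.commute order_trans)
  qed (use a_pos c th P.k1 in auto)
  then show "\<exists>K\<ge>0. \<forall>\<^sub>F k in sequentially. gap k \<le> K * real (Suc k) powr - ((1 - \<gamma>) / (2 * \<theta> - 1) - p)"
    unfolding q_def[symmetric] by (intro exI[of _ K']) (simp add: powr_minus_divide)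
qed

lemma z_tendsto_iff: "z \<longlonglongrightarrow> zs \<longleftrightarrow> x \<longlonglongrightarrow> zs"
proof -
  have d: "(\<lambda>k. x (Suc k) - z k) \<longlonglongrightarrow> 0"
    using x_minus_z_lim by (simp add: tendsto_norm_zero_iff)
  have "x \<longlonglongrightarrow> zs \<longleftrightarrow> (\<lambda>k. x (Suc k)) \<longlonglongrightarrow> zs"
    by (rule filterlim_sequentially_Suc[symmetric])
  also have "\<dots> \<longleftrightarrow> z \<longlonglongrightarrow> zs"
    using Lim_transform[OF _ d] Lim_transform2[OF _ d] by blast
  finally show ?thesis by simp
qed

lemma limit_facts:
  assumes "x \<longlonglongrightarrow> zs"
  shows "f zs = flim" and "0 < r \<Longrightarrow> \<exists>\<^sub>F k in sequentially. norm (z k - zs) < r"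
proof -
  have zs: "z \<longlonglongrightarrow> zs" using assms z_tendsto_iff by simp
  have "(\<lambda>n. f (z n)) \<longlonglongrightarrow> f zs"
    using differentiable_imp_continuous_within[OF diff] zs by (rule isCont_tendsto_compose)
  then show "f zs = flim" using f_lim by (rule LIMSEQ_unique)
  assume "0 < r"
  then have "\<forall>\<^sub>F k in sequentially. norm (z k - zs) < r"
    using zs by (simp add: tendsto_iff dist_norm)
  then show "\<exists>\<^sub>F k in sequentially. norm (z k - zs) < r"
    by (rule eventually_frequently[OF sequentially_bot])
qed

text \<open>The upper bound by 1 is where \<open>2 / 3 < \<gamma>\<close> enters; the lower bound by
  1/2 amounts to \<open>\<gamma> \<le> 1\<close>.\<close>

lemma critical_exponent:
  "1 / 2 \<le> \<gamma> / (4 * \<gamma> - 2)" "\<gamma> / (4 * \<gamma> - 2) < 1" "\<gamma> \<le> (4 * \<gamma> - 2) * (\<gamma> / (4 * \<gamma> - 2))"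
  using gamma by (auto simp: field_simps)

lemma convergence:
  assumes loja: "lojasiewicz_on_crit f" and fin: "liminf (\<lambda>k. ereal (norm (x k))) < \<infinity>"
  shows "\<exists>zs\<in>crit f. x \<longlonglongrightarrow> zs"
proof -
  obtain zs where zs: "zs \<in> crit f" "f zs = flim"
    and acc: "\<And>r. 0 < r \<Longrightarrow> \<exists>\<^sub>F k in sequentially. norm (z k - zs) < r"
    using accumulation_point[OF fin] by blast
  obtain \<theta> where \<theta>: "lojasiewicz_exponent f zs \<theta>"
    using loja zs by (auto simp: lojasiewicz_on_crit_def)
  define \<theta>' where "\<theta>' = max \<theta> (\<gamma> / (4 * \<gamma> - 2))"
  have th: "\<theta> \<le> \<theta>'" "\<theta>' < 1" "1 / 2 \<le> \<theta>'"
    using \<theta> critical_exponent by (auto simp: \<theta>'_def lojasiewicz_exponent_def)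
  have th3: "\<gamma> \<le> (4 * \<gamma> - 2) * \<theta>'"
    using gamma by (intro order_trans[OF critical_exponent(3)] mult_left_mono) (auto simp: \<theta>'_def)
  obtain C \<delta> \<eta> :: real where loj: "0 < C" "0 < \<delta>" "0 < \<eta>"
    and le: "\<And>y. norm (y - zs) < \<delta> \<Longrightarrow> \<bar>f y - f zs\<bar> < \<eta> \<Longrightarrow> C * \<bar>f y - f zs\<bar> powr \<theta>' \<le> norm (grad f y)"
    using lojasiewicz_exponent_local[OF \<theta> th(1,2)] by blast
  have p: "0 < (3 / 2 * \<gamma> - 1) / 2" "(3 / 2 * \<gamma> - 1) / 2 < 3 / 2 * \<gamma> - 1"
    using gamma by auto
  have "z \<longlonglongrightarrow> zs"
    by (rule powr_path(1)[OF th(3,2) th3 loj zs(2) le p acc])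
  then show ?thesis using zs z_tendsto_iff by blast
qed

text \<open>At the critical exponent the two fractions equal \<open>2 * \<gamma> - 1\<close> and
  \<open>3 / 2 * \<gamma> - 1\<close>, the noise parts of the minima; above it nothing was enlarged,
  and they are the Lojasiewicz parts.\<close>

lemma Phi_Psi_le:
  assumes "1 / 2 \<le> \<theta>" "\<theta> < 1" "\<gamma> < 1"
  defines "\<theta>' \<equiv> max \<theta> (\<gamma> / (4 * \<gamma> - 2))"
  shows "Psi_rate \<gamma> \<theta> \<le> (1 - \<gamma>) / (2 * \<theta>' - 1)"
    and "Phi_rate \<gamma> \<theta> \<le> (1 - \<gamma>) / (2 * \<theta>' - 1) * (1 - \<theta>')"
proof -
  show "Psi_rate \<gamma> \<theta> \<le> (1 - \<gamma>) / (2 * \<theta>' - 1)" "Phi_rate \<gamma> \<theta> \<le> (1 - \<gamma>) / (2 * \<theta>' - 1) * (1 - \<theta>')"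
  proof (atomize(full), cases "\<theta> \<le> \<gamma> / (4 * \<gamma> - 2)")
    case True
    then have th: "\<theta>' = \<gamma> / (4 * \<gamma> - 2)" by (simp add: \<theta>'_def)
    have "2 * \<theta>' - 1 = (1 - \<gamma>) / (2 * \<gamma> - 1)"
      unfolding th using gamma by (simp add: field_simps)
    then have 1: "(1 - \<gamma>) / (2 * \<theta>' - 1) = 2 * \<gamma> - 1"
      using assms gamma by simp
    have 2: "(2 * \<gamma> - 1) * (1 - \<theta>') = 3 / 2 * \<gamma> - 1"
      unfolding th using gamma by (simp add: field_simps)
    show "Psi_rate \<gamma> \<theta> \<le> (1 - \<gamma>) / (2 * \<theta>' - 1) \<and> Phi_rate \<gamma> \<theta> \<le> (1 - \<gamma>) / (2 * \<theta>' - 1) * (1 - \<theta>')"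
      unfolding 1 2 by (simp add: Psi_rate_def Phi_rate_def)
  next
    case False
    then have "1 / 2 < \<theta>" using critical_exponent(1) by linarith
    then have "\<theta>' = \<theta>" "\<theta> \<noteq> 1 / 2"
      using False by (auto simp: \<theta>'_def)
    then show "Psi_rate \<gamma> \<theta> \<le> (1 - \<gamma>) / (2 * \<theta>' - 1) \<and> Phi_rate \<gamma> \<theta> \<le> (1 - \<gamma>) / (2 * \<theta>' - 1) * (1 - \<theta>')"
      by (simp add: Psi_rate_def Phi_rate_def)
  qed
qed

lemma powr_rates:
  assumes conv: "x \<longlonglongrightarrow> zs" and \<theta>: "lojasiewicz_exponent f zs \<theta>" and \<epsilon>: "0 < \<epsilon>" and g1: "\<gamma> < 1"
  shows "(\<lambda>k. norm (x k - zs)) \<in> o(\<lambda>k. 1 / real k powr (Phi_rate \<gamma> \<theta> - \<epsilon>))"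
    and "(\<lambda>k. \<bar>f (x k) - f zs\<bar>) \<in> o(\<lambda>k. 1 / real k powr (Psi_rate \<gamma> \<theta> - \<epsilon>))"
    and "(\<lambda>k. (norm (grad f (x k)))\<^sup>2) \<in> o(\<lambda>k. 1 / real k powr (Psi_rate \<gamma> \<theta> - \<epsilon>))"
proof -
  define \<theta>' where "\<theta>' = max \<theta> (\<gamma> / (4 * \<gamma> - 2))"
  have th0: "1 / 2 \<le> \<theta>" "\<theta> < 1" using \<theta> by (auto simp: lojasiewicz_exponent_def)
  have th: "\<theta> \<le> \<theta>'" "\<theta>' < 1" "1 / 2 \<le> \<theta>'"
    using th0 critical_exponent by (auto simp: \<theta>'_def)
  have "1 / 2 < \<gamma> / (4 * \<gamma> - 2)" using gamma g1 by (simp add: field_simps)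
  then have th2: "1 / 2 < \<theta>'" unfolding \<theta>'_def by (rule less_le_trans) simp
  have th3: "\<gamma> \<le> (4 * \<gamma> - 2) * \<theta>'"
    using gamma by (intro order_trans[OF critical_exponent(3)] mult_left_mono) (auto simp: \<theta>'_def)
  obtain C \<delta> \<eta> :: real where loj: "0 < C" "0 < \<delta>" "0 < \<eta>"
    and le: "\<And>y. norm (y - zs) < \<delta> \<Longrightarrow> \<bar>f y - f zs\<bar> < \<eta> \<Longrightarrow> C * \<bar>f y - f zs\<bar> powr \<theta>' \<le> norm (grad f y)"
    using lojasiewicz_exponent_local[OF \<theta> th(1,2)] by blast
  define \<psi> where "\<psi> = (1 - \<gamma>) / (2 * \<theta>' - 1)"
  have rates: "Psi_rate \<gamma> \<theta> \<le> \<psi>" "Phi_rate \<gamma> \<theta> \<le> \<psi> * (1 - \<theta>')"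
    unfolding \<psi>_def \<theta>'_def by (rule Phi_Psi_le[OF th0 g1])+
  have psi: "0 < \<psi>" "\<psi> \<le> 2 * \<gamma> - 1" "\<psi> * (2 * \<theta>' - 1) = 1 - \<gamma>"
  proof -
    have "1 - \<gamma> \<le> (2 * \<gamma> - 1) * (2 * \<theta>' - 1)" using th3 by (simp add: algebra_simps)
    then show "\<psi> \<le> 2 * \<gamma> - 1" using th2 by (simp add: \<psi>_def pos_divide_le_eq)
  qed (use g1 th2 in \<open>auto simp: \<psi>_def\<close>)
  \<comment> \<open>Below \<epsilon> so that the total loss stays under \<epsilon>, below \<psi> so
    that the gap still decays, and below \<open>3 / 2 * \<gamma> - 1\<close> as required by
    \<open>powr_path\<close>; the halves make these strict.\<close>
  define p where "p = min (\<epsilon> / 2) (min (\<psi> / 2) ((3 / 2 * \<gamma> - 1) / 2))"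
  have p: "0 < p" "p < 3 / 2 * \<gamma> - 1" "p < \<psi>" "p < \<epsilon>"
    using psi \<epsilon> gamma by (auto simp: p_def min_def)
  note path = powr_path[OF th(3,2) th3 loj limit_facts(1)[OF conv] le p(1,2) limit_facts(2)[OF conv]]
  obtain K1 where K1: "\<forall>\<^sub>F k in sequentially. norm (z k - zs)
      \<le> K1 * (gap k powr (1 - \<theta>') + real (Suc k) powr - (\<gamma> - 1 + (2 * \<gamma> - 1 - p) * \<theta>'))"
    using path(2) by blast
  obtain K2 where K2: "0 \<le> K2" "\<forall>\<^sub>F k in sequentially. gap k \<le> K2 * real (Suc k) powr - (\<psi> - p)"
    using path(3) th2 g1 p(3) unfolding \<psi>_def by blast
  obtain K3 where K3: "\<forall>\<^sub>F k in sequentially. real (Suc k) powr (2 * \<gamma> - 1 - p) * (\<rho> k)\<^sup>2 \<le> K3"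
    using noise_bound_powr[OF p(1)] by blast
  obtain K4 where K4: "0 \<le> K4" "\<forall>\<^sub>F k in sequentially.
    (norm (x (Suc k) - z k))\<^sup>2 \<le> K4 * (gap k + (\<rho> k)\<^sup>2) \<and>
    \<bar>f (x (Suc k)) - flim\<bar> \<le> K4 * (gap k + (\<rho> k)\<^sup>2) \<and>
    (norm (grad f (x (Suc k))))\<^sup>2 \<le> K4 * (gap k + (\<rho> k)\<^sup>2)"
    by (rule x_bounds)
  define K5 where "K5 = K4 * (K2 + \<bar>K3\<bar>)"
  have sum_rate: "\<forall>\<^sub>F k in sequentially. K4 * (gap k + (\<rho> k)\<^sup>2) \<le> K5 * real (Suc k) powr - (\<psi> - p)"
    using K2(2) K3
  proof eventually_elim
    case (elim k)
    have "(\<rho> k)\<^sup>2 \<le> K3 * real (Suc k) powr - (2 * \<gamma> - 1 - p)"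
      using elim(2) unfolding powr_minus_divide by (simp add: pos_le_divide_eq mult.commute)
    also have "\<dots> \<le> \<bar>K3\<bar> * real (Suc k) powr - (\<psi> - p)"
      using psi by (intro mult_mono powr_mono) auto
    finally have "gap k + (\<rho> k)\<^sup>2 \<le> (K2 + \<bar>K3\<bar>) * real (Suc k) powr - (\<psi> - p)"
      using elim(1) by (simp add: distrib_right)
    then show ?case
      using mult_left_mono[OF _ K4(1)] by (simp add: K5_def mult.assoc)
  qed
  have K5: "0 \<le> K5" using K2 K4 by (simp add: K5_def)
  have psi_lt: "Psi_rate \<gamma> \<theta> - \<epsilon> < \<psi> - p" using rates p by linarith
  have fl: "f zs = flim" by (rule limit_facts(1)[OF conv])
  show "(\<lambda>k. \<bar>f (x k) - f zs\<bar>) \<in> o(\<lambda>k. 1 / real k powr (Psi_rate \<gamma> \<theta> - \<epsilon>))"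
    by (rule smallo_shifted_powr[OF _ psi_lt, where K = K5])
       (use K4(2) sum_rate in eventually_elim, simp add: fl)
  show "(\<lambda>k. (norm (grad f (x k)))\<^sup>2) \<in> o(\<lambda>k. 1 / real k powr (Psi_rate \<gamma> \<theta> - \<epsilon>))"
    by (rule smallo_shifted_powr[OF _ psi_lt, where K = K5])
       (use K4(2) sum_rate in eventually_elim, simp)
  define \<phi> where "\<phi> = \<psi> * (1 - \<theta>')"
  have phi_lt: "Phi_rate \<gamma> \<theta> - \<epsilon> < \<phi> - p" using rates p by (simp add: \<phi>_def)
  \<comment> \<open>The distance to the limit has three contributions, each to be shown of exponent
    at least \<open>\<phi> - p\<close>: the power of the gap (\<open>e1\<close>), the noise length
    (\<open>e2\<close>) and the passage from \<open>z k\<close> to the iterate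
    (\<open>e3\<close>).\<close>
  have e1: "\<phi> - p \<le> (\<psi> - p) * (1 - \<theta>')"
    using p th mult_left_mono[of "1 - \<theta>'" 1 p] by (simp add: \<phi>_def left_diff_distrib)
  have e2: "\<phi> - p \<le> \<gamma> - 1 + (2 * \<gamma> - 1 - p) * \<theta>'"
  proof -
    have "\<psi> * \<theta>' \<le> (2 * \<gamma> - 1) * \<theta>'" using psi th by (intro mult_right_mono) auto
    moreover have "\<psi> * \<theta>' + \<gamma> - 1 = \<phi>" using psi(3) by (simp add: \<phi>_def algebra_simps)
    moreover have "p * \<theta>' \<le> p * 1" using p th by (intro mult_left_mono) auto
    moreover have "(2 * \<gamma> - 1 - p) * \<theta>' = (2 * \<gamma> - 1) * \<theta>' - p * \<theta>'" by (rule left_diff_distrib)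
    ultimately show ?thesis by linarith
  qed
  have e3: "\<phi> - p \<le> (\<psi> - p) / 2"
  proof -
    have "\<phi> \<le> \<psi> * (1 / 2)" unfolding \<phi>_def using psi th by (intro mult_left_mono) auto
    then show ?thesis using p(1) by simp
  qed
  define K6 where "K6 = \<bar>K1\<bar> * (K2 powr (1 - \<theta>') + 1) + sqrt K5"
  show "(\<lambda>k. norm (x k - zs)) \<in> o(\<lambda>k. 1 / real k powr (Phi_rate \<gamma> \<theta> - \<epsilon>))"
  proof (rule smallo_shifted_powr[OF _ phi_lt, where K = K6])
    show "\<forall>\<^sub>F k in sequentially. \<bar>norm (x (Suc k) - zs)\<bar> \<le> K6 * real (Suc k) powr - (\<phi> - p)"
      using K1 K2(2) K4(2) sum_rate eventually_ge_at_top[of N\<^sub>0]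
    proof eventually_elim
      case (elim k)
      define y where "y = real (Suc k)"
      have y: "1 \<le> y" by (simp add: y_def)
      have mono: "y powr - b \<le> y powr - (\<phi> - p)" if "\<phi> - p \<le> b" for b
        using y that by (intro powr_mono) auto
      have "gap k powr (1 - \<theta>') \<le> (K2 * y powr - (\<psi> - p)) powr (1 - \<theta>')"
        using elim th gap_nonneg unfolding y_def by (intro powr_mono2) auto
      also have "\<dots> = K2 powr (1 - \<theta>') * y powr - ((\<psi> - p) * (1 - \<theta>'))"
        using K2(1) y by (simp add: powr_mult powr_powr algebra_simps)
      also have "\<dots> \<le> K2 powr (1 - \<theta>') * y powr - (\<phi> - p)"
        by (intro mult_left_mono mono e1) auto
      finally have 1: "gap k powr (1 - \<theta>') + y powr - (\<gamma> - 1 + (2 * \<gamma> - 1 - p) * \<theta>')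
          \<le> (K2 powr (1 - \<theta>') + 1) * y powr - (\<phi> - p)"
        using mono[OF e2] by (simp add: distrib_right)
      have "norm (z k - zs) \<le> \<bar>K1\<bar> * (gap k powr (1 - \<theta>') + y powr - (\<gamma> - 1 + (2 * \<gamma> - 1 - p) * \<theta>'))"
        using elim(1) unfolding y_def by (rule order_trans) (intro mult_right_mono, auto)
      also have "\<dots> \<le> \<bar>K1\<bar> * ((K2 powr (1 - \<theta>') + 1) * y powr - (\<phi> - p))"
        using 1 by (intro mult_left_mono) auto
      finally have Z: "norm (z k - zs) \<le> \<bar>K1\<bar> * (K2 powr (1 - \<theta>') + 1) * y powr - (\<phi> - p)" by simp
      have "(norm (x (Suc k) - z k))\<^sup>2 \<le> K5 * y powr - (\<psi> - p)"
        using elim unfolding y_def by linarith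
      then have "norm (x (Suc k) - z k) \<le> sqrt (K5 * y powr - (\<psi> - p))"
        by (rule real_le_rsqrt)
      also have "\<dots> = sqrt K5 * y powr - ((\<psi> - p) / 2)"
      proof -
        have "sqrt (y powr - (\<psi> - p)) = (y powr - (\<psi> - p)) powr (1 / 2)"
          by (simp add: powr_half_sqrt)
        also have "\<dots> = y powr (- (\<psi> - p) * (1 / 2))" by (rule powr_powr)
        also have "- (\<psi> - p) * (1 / 2) = - ((\<psi> - p) / 2)" by (simp only: minus_mult_left[symmetric] mult_1_right times_divide_eq_right)
        finally show ?thesis by (simp only: real_sqrt_mult)
      qed
      also have "\<dots> \<le> sqrt K5 * y powr - (\<phi> - p)"
        using K5 by (intro mult_left_mono mono e3) auto
      finally have X: "norm (x (Suc k) - z k) \<le> sqrt K5 * y powr - (\<phi> - p)" .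
      have "norm (x (Suc k) - zs) \<le> norm (x (Suc k) - z k) + norm (z k - zs)"
        by norm
      also have "\<dots> \<le> K6 * y powr - (\<phi> - p)"
        using X Z by (simp add: K6_def distrib_right)
      finally show ?case by (simp add: y_def)
    qed
  qed
qed

text \<open>No power of \<open>k\<close> can be sacrificed here, so the logarithmic weight itself is
  used, both as noise weight and as comparison sequence for the gap.\<close>

lemma log_rates:
  assumes conv: "x \<longlonglongrightarrow> zs" and mer: "merit_lojasiewicz_constant f L lam zs (1 / 2) C"
    and \<alpha>: "200 / C\<^sup>2 < \<alpha>" and \<epsilon>: "0 < \<epsilon>" and g1: "\<gamma> = 1"
  shows "(\<lambda>k. norm (x k - zs)) \<in> o(\<lambda>k. ln (real k) powr (1 / 2 + \<epsilon>) / sqrt (real k))"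
    and "(\<lambda>k. \<bar>f (x k) - f zs\<bar>) \<in> o(\<lambda>k. ln (real k) powr (1 + \<epsilon>) / real k)"
    and "(\<lambda>k. (norm (grad f (x k)))\<^sup>2) \<in> o(\<lambda>k. ln (real k) powr (1 + \<epsilon>) / real k)"
proof -
  \<comment> \<open>A smaller exponent from the countable family; the strict inequality later turns
    a big-O bound into a little-o bound.\<close>
  obtain n where n: "1 / real (Suc n) < \<epsilon>"
    using \<epsilon> by (rule nat_approx_posE)
  define e where "e = 1 / real (Suc n)"
  have e: "0 < e" "e < \<epsilon>" using n by (auto simp: e_def)
  define t where "t = log_weight \<gamma> e"
  have t_eq: "t k = real (Suc k) / ln (real (Suc k)) powr (1 + e)" for k
    by (simp add: t_def log_weight_def g1)
  have t_pos: "0 < t k" if "1 \<le> k" for k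
    using log_weight_pos[OF that] by (simp add: t_def)
  have "\<forall>\<^sub>F k in sequentially. real (Suc k) / ln (real (Suc k)) powr (1 + e)
      \<le> real (Suc (Suc k)) / ln (real (Suc (Suc k))) powr (1 + e)"
    using e(1) by real_asymp
  then obtain N where N: "\<And>k. N \<le> k \<Longrightarrow> t k \<le> t (Suc k)"
    unfolding eventually_sequentially t_eq by blast
  have t_mono: "t k \<le> t j" if "max 1 N \<le> k" "k \<le> j" for j k
    using that(2)
  proof (induction j rule: dec_induct)
    case (step j)
    then show ?case using N[of j] that(1) by simp
  qed simp
  obtain \<delta> \<eta> where loj: "0 < C" "0 < \<delta>" "0 < \<eta>"
    and le: "\<And>y. norm (y - zs) < \<delta> \<Longrightarrow> \<bar>f y - f zs\<bar> < \<eta> \<Longrightarrow> C * \<bar>f y - f zs\<bar> powr (1 / 2) \<le> norm (grad f y)"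
    using merit_lojasiewicz_constant_local[OF diff mer] by blast
  have fl: "f zs = flim" by (rule limit_facts(1)[OF conv])
  obtain S where S: "0 \<le> S" "\<forall>\<^sub>F k in sequentially. noise_tail k \<le> S / t k"
  proof (rule noise_tail_rate[where t = t and N = "max 1 N"])
    show "summable (\<lambda>k. t k * (a k * (\<rho> k)\<^sup>2))"
      unfolding t_def e_def by (rule noise_sum)
  qed (use t_mono t_pos in auto)
  have t_pos': "\<forall>\<^sub>F k in sequentially. 0 < t k"
    using eventually_ge_at_top[of 1] by eventually_elim (rule t_pos)
  interpret P: lojasiewicz_path f "grad f" L lam B z h a \<rho> zs "1 / 2" C \<delta> \<eta> S t
    using loj le fl S t_pos' by unfold_locales auto
  have zconv: "z \<longlonglongrightarrow> zs" using conv z_tendsto_iff by simp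
  define b where "b = (1 + e) / 2"
  have b: "0 < b" using e by (simp add: b_def)
  define y where "y k = ln (real (Suc k)) powr b * real (Suc k) powr - (1 / 2)" for k :: nat
  have t_half: "t k powr - (1 / 2) = y k" for k
    by (simp add: t_eq y_def b_def powr_divide powr_powr powr_minus_divide field_simps)
  define A where "A = 4 * (\<kappa> * \<alpha>)"
  have A: "0 \<le> A" using alpha kappa(1) by (simp add: A_def)
  have s_lim: "(\<lambda>k. A * y k) \<longlonglongrightarrow> 0"
    unfolding y_def using b by real_asymp
  have s: "\<forall>\<^sub>F k in sequentially. a k * t k powr - (1 / 2) \<le> A * y k - A * y (Suc k)"
    using ln_powr_div_sqrt_diff[OF b]
  proof eventually_elim
    case (elim k)
    have "0 \<le> y k" by (simp add: y_def)
    have "a k * y k \<le> \<kappa> * \<alpha> * real (Suc k) powr - \<gamma> * y k"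
      using a_le \<open>0 \<le> y k\<close> by (rule mult_right_mono)
    also have "\<dots> = A * (1 / 4 * (y k / real (Suc k)))"
      by (simp add: A_def g1 powr_minus_divide del: of_nat_Suc)
    also have "\<dots> \<le> A * (y k - y (Suc k))"
      using elim A unfolding y_def by (intro mult_left_mono) auto
    finally show ?case unfolding t_half by (simp add: right_diff_distrib)
  qed
  have zrate: "\<forall>\<^sub>F k in sequentially. norm (z k - zs) \<le> (1 + B) * (P.k\<^sub>2 * gap k powr (1 - 1 / 2) + A * y k)"
    using P.path_convergence[OF s_lim s] limit_facts(2)[OF conv] by blast
  have step_ratio: "\<forall>\<^sub>F k in sequentially. t (Suc k) \<le> t k * (1 + 1 / real (Suc k)) \<and>
      1 / real (Suc k) \<le> C\<^sup>2 / 4 / 2 * a k"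
  proof -
    have "\<forall>\<^sub>F k in sequentially. \<beta> \<le> real (Suc k)" by real_asymp
    then show ?thesis
      using eventually_ge_at_top[of 1]
    proof eventually_elim
      case (elim k)
      have "t (Suc k) \<le> t k * (1 + 1 / real (Suc k))"
        using log_weight_ratio[OF elim(2), of \<gamma> e] gamma e by (simp add: t_def mult.commute)
      moreover have "1 / real (Suc k) \<le> C\<^sup>2 / 4 / 2 * a k"
      proof -
        have Ca: "200 \<le> C\<^sup>2 * \<alpha>" using \<alpha> loj by (simp add: pos_divide_less_eq mult.commute)
        have den: "0 < real (Suc k) + \<beta>" using beta by (simp add: add_pos_nonneg)
        \<comment> \<open>The recursion needs half of its coefficient, \<open>C\<^sup>2 / 8\<close>,
          times the step to dominate \<open>1 / real (Suc k)\<close>. The threshold 200 makes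
          \<open>C\<^sup>2 * \<alpha> / 8\<close> at least 25, ample for the shift \<beta> once
          \<open>\<beta> \<le> real (Suc k)\<close>.\<close>
        have "1 / real (Suc k) = 25 / (25 * real (Suc k))" by (simp del: of_nat_Suc)
        also have "\<dots> \<le> 25 / (real (Suc k) + \<beta>)"
          using elim den by (intro divide_left_mono) auto
        also have "\<dots> = 1 / 8 * 200 / (real (Suc k) + \<beta>)" by simp
        also have "\<dots> \<le> 1 / 8 * (C\<^sup>2 * \<alpha>) / (real (Suc k) + \<beta>)"
          using Ca den by (intro divide_right_mono) auto
        also have "\<dots> = C\<^sup>2 / 4 / 2 * step_seq \<alpha> \<beta> \<gamma> k"
          using den by (simp add: step_seq_def g1)
        also have "\<dots> \<le> C\<^sup>2 / 4 / 2 * a k"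
          using mult_right_mono[OF kappa(1), of "step_seq \<alpha> \<beta> \<gamma> k"] s_pos[of k]
          by (intro mult_left_mono) (auto simp: a_def)
        finally show ?thesis .
      qed
      ultimately show ?case by simp
    qed
  qed
  obtain K2 where K2: "0 \<le> K2" "\<forall>\<^sub>F k in sequentially. gap k \<le> K2 / t k"
  proof (rule nonlinear_recursion_rate[where D = gap and a = a and c = "C\<^sup>2 / 4" and \<theta> = "1 / 2"
        and K = "(2 * B\<^sup>2 + 1) * S" and t = t and s = t])
    show "\<forall>\<^sub>F k in sequentially. 0 \<le> gap k" "\<forall>\<^sub>F k in sequentially. gap (Suc k) \<le> gap k"
      by (rule eventually_sequentiallyI, erule gap_nonneg) (rule eventually_sequentiallyI, erule gap_Suc_le)
    show "\<forall>\<^sub>F k in sequentially. gap (Suc k) \<le> gap k - C\<^sup>2 / 4 * a k *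
        (gap k powr (2 * (1 / 2)) - (2 * B\<^sup>2 + 1) * S * t k powr - (2 * (1 / 2)))"
      by (rule P.gap_recursion_half[OF zconv refl])
    show "\<forall>\<^sub>F k in sequentially. 0 < t k \<and> t k \<le> t k" using t_pos' by simp
    show "\<forall>\<^sub>F k in sequentially. t (Suc k) \<le> t k * (1 + C\<^sup>2 / 4 / 2 * a k * t k powr (1 - 2 * (1 / 2)))"
      using step_ratio t_pos'
    proof eventually_elim
      case (elim k)
      then have "t k * (1 + 1 / real (Suc k)) \<le> t k * (1 + C\<^sup>2 / 4 / 2 * a k)"
        by (intro mult_left_mono) auto
      moreover have "t k powr (1 - 2 * (1 / 2)) = 1" using elim by simp
      ultimately show ?case using elim by (simp only: mult_1_right) linarith
    qed
    show "\<forall>\<^sub>F k in sequentially. t (Suc k) \<le> 2 * t k"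
      using step_ratio t_pos'
    proof eventually_elim
      case (elim k)
      then have "t k * (1 + 1 / real (Suc k)) \<le> t k * 2"
        by (intro mult_left_mono) auto
      then show ?case using elim by linarith
    qed
  qed (use a_pos loj S in auto)
  obtain K3 where K3: "\<forall>\<^sub>F k in sequentially. t k * (\<rho> k)\<^sup>2 \<le> K3"
    using noise_bound unfolding t_def e_def by blast
  obtain K4 where K4: "0 \<le> K4" "\<forall>\<^sub>F k in sequentially.
    (norm (x (Suc k) - z k))\<^sup>2 \<le> K4 * (gap k + (\<rho> k)\<^sup>2) \<and>
    \<bar>f (x (Suc k)) - flim\<bar> \<le> K4 * (gap k + (\<rho> k)\<^sup>2) \<and>
    (norm (grad f (x (Suc k))))\<^sup>2 \<le> K4 * (gap k + (\<rho> k)\<^sup>2)"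
    by (rule x_bounds)
  define K5 where "K5 = K4 * (K2 + \<bar>K3\<bar>)"
  have t_inv: "1 / t k = ln (real (Suc k)) powr (1 + e) * real (Suc k) powr - 1" for k
    by (simp add: t_eq powr_minus_divide)
  have sum_rate: "\<forall>\<^sub>F k in sequentially. K4 * (gap k + (\<rho> k)\<^sup>2) \<le> K5 * (1 / t k)"
    using K2(2) K3 t_pos'
  proof eventually_elim
    case (elim k)
    have "(\<rho> k)\<^sup>2 \<le> \<bar>K3\<bar> * (1 / t k)"
      using elim by (simp add: pos_le_divide_eq mult.commute)
    then have "gap k + (\<rho> k)\<^sup>2 \<le> (K2 + \<bar>K3\<bar>) * (1 / t k)"
      using elim(1) by (simp add: add_divide_distrib)
    then show ?case
      using mult_left_mono[OF _ K4(1)] by (simp only: K5_def mult.assoc)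
  qed
  have K5: "0 \<le> K5" using K2 K4 by (simp add: K5_def)
  have "(\<lambda>k. \<bar>f (x k) - f zs\<bar>) \<in> o(\<lambda>k. ln (real k) powr (1 + \<epsilon>) / real k powr 1)"
  proof (rule smallo_shifted_ln[where K = K5 and b = "1 + e"])
    show "\<forall>\<^sub>F k in sequentially. \<bar>\<bar>f (x (Suc k)) - f zs\<bar>\<bar> \<le> K5 * (ln (real (Suc k)) powr (1 + e) * real (Suc k) powr - 1)"
      using K4(2) sum_rate unfolding t_inv by eventually_elim (simp add: fl)
  qed (use e in simp)
  then show "(\<lambda>k. \<bar>f (x k) - f zs\<bar>) \<in> o(\<lambda>k. ln (real k) powr (1 + \<epsilon>) / real k)" by simp
  have "(\<lambda>k. (norm (grad f (x k)))\<^sup>2) \<in> o(\<lambda>k. ln (real k) powr (1 + \<epsilon>) / real k powr 1)"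
  proof (rule smallo_shifted_ln[where K = K5 and b = "1 + e"])
    show "\<forall>\<^sub>F k in sequentially. \<bar>(norm (grad f (x (Suc k))))\<^sup>2\<bar> \<le> K5 * (ln (real (Suc k)) powr (1 + e) * real (Suc k) powr - 1)"
      using K4(2) sum_rate unfolding t_inv by eventually_elim simp
  qed (use e in simp)
  then show "(\<lambda>k. (norm (grad f (x k)))\<^sup>2) \<in> o(\<lambda>k. ln (real k) powr (1 + \<epsilon>) / real k)" by simp
  define K6 where "K6 = sqrt K5 + (1 + B) * (P.k\<^sub>2 * sqrt K2 + A)"
  have "(\<lambda>k. norm (x k - zs)) \<in> o(\<lambda>k. ln (real k) powr (1 / 2 + \<epsilon>) / real k powr (1 / 2))"
  proof (rule smallo_shifted_ln[where K = K6 and b = b])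
    show "\<forall>\<^sub>F k in sequentially. \<bar>norm (x (Suc k) - zs)\<bar> \<le> K6 * (ln (real (Suc k)) powr b * real (Suc k) powr - (1 / 2))"
      using zrate K2(2) K4(2) sum_rate eventually_ge_at_top[of "max 1 N\<^sub>0"]
    proof eventually_elim
      case (elim k)
      then have t0: "0 < t k" "0 \<le> gap k" using t_pos gap_nonneg by auto
      have sq: "sqrt (1 / t k) = y k"
        using t0 by (simp add: t_half[symmetric] powr_minus_divide powr_half_sqrt real_sqrt_divide)
      have "gap k powr (1 - 1 / 2) = sqrt (gap k)" using t0 by (simp add: powr_half_sqrt)
      also have "\<dots> \<le> sqrt (K2 * (1 / t k))" using elim by simp
      also have "\<dots> = sqrt K2 * y k" by (simp only: real_sqrt_mult sq)
      finally have "P.k\<^sub>2 * gap k powr (1 - 1 / 2) + A * y k \<le> P.k\<^sub>2 * (sqrt K2 * y k) + A * y k"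
        using P.k2_nonneg by (intro add_right_mono mult_left_mono) auto
      then have "(1 + B) * (P.k\<^sub>2 * gap k powr (1 - 1 / 2) + A * y k) \<le> (1 + B) * (P.k\<^sub>2 * (sqrt K2 * y k) + A * y k)"
        using B_bounds by (intro mult_left_mono) auto
      then have Z: "norm (z k - zs) \<le> (1 + B) * (P.k\<^sub>2 * sqrt K2 + A) * y k"
        using elim(1) by (simp add: algebra_simps)
      have "(norm (x (Suc k) - z k))\<^sup>2 \<le> K5 * (1 / t k)" using elim by linarith
      then have "norm (x (Suc k) - z k) \<le> sqrt (K5 * (1 / t k))" by (rule real_le_rsqrt)
      also have "\<dots> = sqrt K5 * y k" by (simp only: real_sqrt_mult sq)
      finally have X: "norm (x (Suc k) - z k) \<le> sqrt K5 * y k" .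
      have "norm (x (Suc k) - zs) \<le> norm (x (Suc k) - z k) + norm (z k - zs)"
        by norm
      also have "\<dots> \<le> K6 * y k"
        using X Z by (simp add: K6_def distrib_right)
      finally show ?case by (simp add: y_def)
    qed
  qed (use e in \<open>simp add: b_def\<close>)
  then show "(\<lambda>k. norm (x k - zs)) \<in> o(\<lambda>k. ln (real k) powr (1 / 2 + \<epsilon>) / sqrt (real k))"
    by (simp add: powr_half_sqrt)
qed

end

section \<open>Almost sure convergence\<close>

lemma space_natural_filtration [simp]: "space (natural_filtration M X k) = space M"
  unfolding natural_filtration_def by (rule space_measure_of) auto

lemma sets_natural_filtration:
  "sets (natural_filtration M X k) =
     sigma_sets (space M) (\<Union>i\<le>k. {X i -` A \<inter> space M | A. A \<in> sets borel})"
  unfolding natural_filtration_def by (rule sets_measure_of) auto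

lemma natural_filtration_mono:
  "j \<le> k \<Longrightarrow> sets (natural_filtration M X j) \<subseteq> sets (natural_filtration M X k)"
  unfolding sets_natural_filtration by (intro sigma_sets_mono') force

lemma measurable_natural_filtration:
  "i \<le> k \<Longrightarrow> X i \<in> borel_measurable (natural_filtration M X k)"
  by (intro measurableI) (auto simp: sets_natural_filtration intro!: sigma_sets.Basic)

lemma subalgebra_natural_filtration:
  assumes "\<And>i. X i \<in> borel_measurable M"
  shows "subalgebra M (natural_filtration M X k)"
  unfolding subalgebra_def sets_natural_filtration
  using assms by (auto intro!: sets.sigma_sets_subset measurable_sets)

theorem corollary5p1:
  fixes M :: "'w measure"
    and f :: "'a::euclidean_space \<Rightarrow> real"
    and x0 :: 'a
    and x e :: "nat \<Rightarrow> 'w \<Rightarrow> 'a"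
    and L lam \<nu> \<alpha> \<beta> \<gamma> \<sigma> :: real
  assumes prob: "prob_space M"
    and diff: "\<And>y. f differentiable (at y)"
    and bdd: "bdd_below (range f)"
    and L: "0 < L" "L-lipschitz_on UNIV (grad f)"
    and loja: "lojasiewicz_on_crit f"
    and lam: "0 \<le> lam" "lam < 1"
    and nu: "0 \<le> \<nu>"
    and step: "0 < \<alpha>" "0 \<le> \<beta>" "2 / 3 < \<gamma>" "\<gamma> \<le> 1"
    and sgdm: "sgdm M f x0 lam \<nu> (\<lambda>k. \<alpha> / (real k + \<beta>) powr \<gamma>) e x"
    and err: "0 \<le> \<sigma>" "sgdm_errors M x e \<sigma>"
  shows "\<exists>xs \<in> borel_measurable M.
      (AE \<omega> in M. \<omega> \<in> liminf_bounded_event M x \<longrightarrow>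
         xs \<omega> \<in> crit f \<and> (\<lambda>k. x k \<omega>) \<longlonglongrightarrow> xs \<omega>) \<and>
      (\<exists>R \<in> sets M. measure M R = measure M (liminf_bounded_event M x) \<and>
        (\<forall>\<omega>\<in>R. xs \<omega> \<in> crit f \<and> (\<lambda>k. x k \<omega>) \<longlonglongrightarrow> xs \<omega> \<and>
          (\<gamma> < 1 \<longrightarrow>
            (\<forall>\<theta> \<epsilon>. lojasiewicz_exponent f (xs \<omega>) \<theta> \<and> 0 < \<epsilon> \<longrightarrow>
              (\<lambda>k. norm (x k \<omega> - xs \<omega>)) \<in> o(\<lambda>k. 1 / real k powr (Phi_rate \<gamma> \<theta> - \<epsilon>)) \<and>
              (\<lambda>k. \<bar>f (x k \<omega>) - f (xs \<omega>)\<bar>) \<in> o(\<lambda>k. 1 / real k powr (Psi_rate \<gamma> \<theta> - \<epsilon>)) \<and>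
              (\<lambda>k. (norm (grad f (x k \<omega>)))\<^sup>2) \<in> o(\<lambda>k. 1 / real k powr (Psi_rate \<gamma> \<theta> - \<epsilon>)))) \<and>
          (\<gamma> = 1 \<longrightarrow>
            (\<forall>C \<epsilon>. lojasiewicz_exponent f (xs \<omega>) (1 / 2) \<and>
                    merit_lojasiewicz_constant f L lam (xs \<omega>) (1 / 2) C \<and>
                    \<alpha> > 200 / C\<^sup>2 \<and> 0 < \<epsilon> \<longrightarrow>
              (\<lambda>k. norm (x k \<omega> - xs \<omega>)) \<in> o(\<lambda>k. ln (real k) powr (1 / 2 + \<epsilon>) / sqrt (real k)) \<and>
              (\<lambda>k. \<bar>f (x k \<omega>) - f (xs \<omega>)\<bar>) \<in> o(\<lambda>k. ln (real k) powr (1 + \<epsilon>) / real k) \<and>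
              (\<lambda>k. (norm (grad f (x k \<omega>)))\<^sup>2) \<in> o(\<lambda>k. ln (real k) powr (1 + \<epsilon>) / real k)))))"
proof -
  let ?s = "step_seq \<alpha> \<beta> \<gamma>"
  interpret prob_space M by (rule prob)
  have e_meas [measurable]: "e (Suc k) \<in> borel_measurable M" for k
    using err by (simp add: sgdm_errors_def)
  have x_init: "x 0 \<omega> = x0" "x 1 \<omega> = x0" if "\<omega> \<in> space M" for \<omega>
    using sgdm that by (auto simp: sgdm_def)
  have x_step: "x (Suc (Suc k)) \<omega> = x (Suc k) \<omega>
      - ?s k *\<^sub>R (grad f (x (Suc k) \<omega> + \<nu> *\<^sub>R (x (Suc k) \<omega> - x k \<omega>)) - e (Suc k) \<omega>)
      + lam *\<^sub>R (x (Suc k) \<omega> - x k \<omega>)" if "\<omega> \<in> space M" for k \<omega>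
    using sgdm that unfolding sgdm_def Let_def
    by (auto simp: step_seq_def dest!: bspec[of _ _ \<omega>] spec[of _ "Suc k"])
  have "continuous_on UNIV (grad f)"
    using L(2) by (rule lipschitz_on_continuous_on)
  then have grad_meas [measurable]: "grad f \<in> borel_measurable borel"
    by (rule borel_measurable_continuous_onI)
  have "x k \<in> borel_measurable M \<and> x (Suc k) \<in> borel_measurable M" for k
  proof (induction k)
    case 0
    show ?case
      using x_init by (auto cong: measurable_cong)
  next
    case (Suc k)
    then have [measurable]: "x k \<in> borel_measurable M" "x (Suc k) \<in> borel_measurable M" by auto
    have "x (Suc (Suc k)) \<in> borel_measurable M"
      by (subst measurable_cong[OF x_step]) simp_all
    then show ?case by simp
  qed
  then have x_meas [measurable]: "x k \<in> borel_measurable M" for k by blast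
  \<comment> \<open>Shifted to match \<open>step_seq\<close>: the error with index
    \<open>Suc k\<close> is centred given the iterates up to \<open>Suc k\<close>.\<close>
  define F where "F k = natural_filtration M x (Suc k)" for k
  interpret E: martingale_errors M F "\<lambda>k. e (Suc k)" \<sigma>
  proof
    fix k
    show "subalgebra M (F k)"
      unfolding F_def by (rule subalgebra_natural_filtration) (rule x_meas)
    show "sets (F k) \<subseteq> sets (F (Suc k))"
      unfolding F_def by (rule natural_filtration_mono) simp
    have [measurable]: "x k \<in> borel_measurable (F (Suc k))" "x (Suc k) \<in> borel_measurable (F (Suc k))"
      "x (Suc (Suc k)) \<in> borel_measurable (F (Suc k))"
      unfolding F_def by (auto intro: measurable_natural_filtration)
    \<comment> \<open>Solving the update for the error shows that it is a function of three
      consecutive iterates, the last being \<open>x (Suc (Suc k))\<close>; this is why it is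
      measurable one step later in the filtration.\<close>
    have "e (Suc k) \<omega> = (1 / ?s k) *\<^sub>R (x (Suc (Suc k)) \<omega> - x (Suc k) \<omega> - lam *\<^sub>R (x (Suc k) \<omega> - x k \<omega>))
        + grad f (x (Suc k) \<omega> + \<nu> *\<^sub>R (x (Suc k) \<omega> - x k \<omega>))" if "\<omega> \<in> space (F (Suc k))" for \<omega>
    proof -
      let ?G = "grad f (x (Suc k) \<omega> + \<nu> *\<^sub>R (x (Suc k) \<omega> - x k \<omega>))"
      have "x (Suc (Suc k)) \<omega> - x (Suc k) \<omega> - lam *\<^sub>R (x (Suc k) \<omega> - x k \<omega>) = ?s k *\<^sub>R (e (Suc k) \<omega> - ?G)"
        using x_step[of \<omega> k] that by (simp add: F_def algebra_simps)
      then show ?thesis using step_seq_pos[OF step, of k] by simp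
    qed
    from measurable_cong[OF this] show "e (Suc k) \<in> borel_measurable (F (Suc k))"
      by (rule iffD2) simp_all
    show "AE \<omega> in M. vec_cond_exp M (F k) (e (Suc k)) \<omega> = 0"
      "AE \<omega> in M. nn_cond_exp M (F k) (\<lambda>\<omega>'. ennreal ((norm (e (Suc k) \<omega>'))\<^sup>2)) \<omega> \<le> ennreal (\<sigma>\<^sup>2)"
      using err(2) by (auto simp: sgdm_errors_def F_def)
  qed
  have q_const: "\<forall>\<^sub>F k in sequentially. 1 / real (Suc k) \<le> 1 - lam"
    using lam by real_asymp
  have c_const: "?s k \<le> \<alpha> / (1 - lam) * (1 - lam)" for k
    using step_seq_le_alpha[OF step] lam by simp
  define U V where "U k \<omega> = (norm (filt (gain \<alpha> \<beta> \<gamma>) ?s (\<lambda>j. e (Suc j) \<omega>) k))\<^sup>2"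
    and "V k \<omega> = (norm (filt (\<lambda>_. 1 - lam) ?s (\<lambda>j. e (Suc j) \<omega>) k))\<^sup>2" for k \<omega>
  have ev: "AE \<omega> in M. \<forall>n. summable (\<lambda>k. log_weight \<gamma> (1 / real (Suc n)) k * (?s k * U k \<omega>))"
    "AE \<omega> in M. \<forall>n. \<exists>K. \<forall>\<^sub>F k in sequentially. log_weight \<gamma> (1 / real (Suc n)) k * U k \<omega> \<le> K"
    "AE \<omega> in M. \<forall>n. summable (\<lambda>k. log_weight \<gamma> (1 / real (Suc n)) k * (?s k * V k \<omega>))"
    "AE \<omega> in M. \<forall>n. \<exists>K. \<forall>\<^sub>F k in sequentially. log_weight \<gamma> (1 / real (Suc n)) k * V k \<omega> \<le> K"
    unfolding AE_all_countable U_def V_def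
    using E.AE_filter_rates[OF step _ gain_bounds(1,2)[OF step] gain_ge[OF step] gain_bounds(4)[OF step]]
      E.AE_filter_rates[OF step _ _ _ q_const c_const] lam by auto
  have "AE \<omega> in M. sgdm_noise_path f L lam \<nu> \<alpha> \<beta> \<gamma> (\<lambda>k. x k \<omega>) (\<lambda>k. e k \<omega>)"
    using ev AE_space
  proof eventually_elim
    case (elim \<omega>)
    interpret P: sgdm_path f L lam \<nu> \<alpha> \<beta> \<gamma> "\<lambda>k. x k \<omega>" "\<lambda>k. e k \<omega>"
      using diff bdd L lam step x_step[OF elim(5)] by unfold_locales auto
    have rho2: "(P.\<rho> k)\<^sup>2 \<le> 2 * (U k \<omega> + V k \<omega>)" for k
      using sum_squares_bound[of "norm (P.u k)" "norm (P.v k)"]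
      by (simp add: P.\<rho>_def U_def V_def P.u_def P.v_def power2_sum)
    have lw: "0 \<le> log_weight \<gamma> d k" for d k
      by (simp add: log_weight_def)
    show ?case
    proof
      fix n
      let ?w = "log_weight \<gamma> (1 / real (Suc n))"
      have "summable (\<lambda>k. 2 * P.\<kappa> * (?w k * (?s k * U k \<omega>) + ?w k * (?s k * V k \<omega>)))"
        using elim by (intro summable_mult summable_add) auto
      then show "summable (\<lambda>k. ?w k * (P.a k * (P.\<rho> k)\<^sup>2))"
      proof (rule summable_comparison_test')
        fix k
        have "?w k * (P.a k * (P.\<rho> k)\<^sup>2) \<le> ?w k * (P.a k * (2 * (U k \<omega> + V k \<omega>)))"
          using rho2 lw P.s_pos[of k] P.kappa(1) by (intro mult_left_mono) (auto simp: P.a_def)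
        also have "\<dots> = 2 * P.\<kappa> * (?w k * (?s k * U k \<omega>) + ?w k * (?s k * V k \<omega>))"
          by (simp add: P.a_def algebra_simps)
        finally show "norm (?w k * (P.a k * (P.\<rho> k)\<^sup>2)) \<le> 2 * P.\<kappa> * (?w k * (?s k * U k \<omega>) + ?w k * (?s k * V k \<omega>))"
          using lw P.s_pos[of k] P.kappa(1) by (simp add: P.a_def)
      qed
      obtain K K' where "\<forall>\<^sub>F k in sequentially. ?w k * U k \<omega> \<le> K" "\<forall>\<^sub>F k in sequentially. ?w k * V k \<omega> \<le> K'"
        using elim(2,4) by blast
      then have "\<forall>\<^sub>F k in sequentially. ?w k * (P.\<rho> k)\<^sup>2 \<le> 2 * (K + K')"
      proof eventually_elim
        case (elim k)
        have "?w k * (P.\<rho> k)\<^sup>2 \<le> ?w k * (2 * (U k \<omega> + V k \<omega>))"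
          using rho2 lw by (rule mult_left_mono)
        then show ?case using elim by (simp add: algebra_simps)
      qed
      then show "\<exists>K. \<forall>\<^sub>F k in sequentially. ?w k * (P.\<rho> k)\<^sup>2 \<le> K" by blast
    qed
  qed
  then obtain N where N: "N \<in> null_sets M"
    and good: "\<And>\<omega>. \<omega> \<in> space M \<Longrightarrow> \<omega> \<notin> N \<Longrightarrow> sgdm_noise_path f L lam \<nu> \<alpha> \<beta> \<gamma> (\<lambda>k. x k \<omega>) (\<lambda>k. e k \<omega>)"
    unfolding eventually_ae_filter by blast
  \<comment> \<open>Defined on all of the space: where the iterates diverge, \<open>lim\<close> is
    one fixed unspecified value, so measurability is not lost.\<close>
  define xs where "xs \<omega> = lim (\<lambda>k. x k \<omega>)" for \<omega>
  have xs_meas: "xs \<in> borel_measurable M"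
    unfolding xs_def[abs_def] by (rule borel_measurable_lim_metric) simp
  have X_sets [measurable]: "liminf_bounded_event M x \<in> sets M"
    unfolding liminf_bounded_event_def by measurable
  \<comment> \<open>Removing the null set keeps the probability and leaves only paths on which the
    deterministic results apply.\<close>
  define R where "R = liminf_bounded_event M x - N"
  have R: "R \<in> sets M" "measure M R = measure M (liminf_bounded_event M x)"
    unfolding R_def using N by (auto simp: measure_Diff_null_set)
  have path: "sgdm_noise_path f L lam \<nu> \<alpha> \<beta> \<gamma> (\<lambda>k. x k \<omega>) (\<lambda>k. e k \<omega>)" if "\<omega> \<in> R" for \<omega>
    using that good by (auto simp: R_def liminf_bounded_event_def)
  have lim: "xs \<omega> \<in> crit f" "(\<lambda>k. x k \<omega>) \<longlonglongrightarrow> xs \<omega>" if \<omega>: "\<omega> \<in> R" for \<omega>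
  proof -
    have "liminf (\<lambda>k. ereal (norm (x k \<omega>))) < \<infinity>"
      using \<omega> by (auto simp: R_def liminf_bounded_event_def)
    then obtain zs where "zs \<in> crit f" "(\<lambda>k. x k \<omega>) \<longlonglongrightarrow> zs"
      using sgdm_noise_path.convergence[OF path[OF \<omega>] loja] by blast
    then show "xs \<omega> \<in> crit f" "(\<lambda>k. x k \<omega>) \<longlonglongrightarrow> xs \<omega>"
      by (simp_all add: xs_def limI)
  qed
  have AE: "AE \<omega> in M. \<omega> \<in> liminf_bounded_event M x \<longrightarrow> xs \<omega> \<in> crit f \<and> (\<lambda>k. x k \<omega>) \<longlonglongrightarrow> xs \<omega>"
    using AE_not_in[OF N] by eventually_elim (use lim in \<open>auto simp: R_def\<close>)
  show ?thesis
    using sgdm_noise_path.powr_rates[OF path lim(2)] sgdm_noise_path.log_rates[OF path lim(2)]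
    by (intro bexI[OF _ xs_meas] conjI AE bexI[OF _ R(1)] R(2) ballI impI allI lim) auto
qed

end
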